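(* Assume that $m>p$ and that $\mathbf{Z}\sim\mathbb{C}N_{m\times p}(\mathbf{\Xi},\mathbf{I}_m\otimes\mathbf{I}_p)$ with $\mathbf{\Xi}\in\mathbb{C}^{m\times p}$ unknown. Write $\mathbf{Z}^*\mathbf{Z}=\mathbf{U}\mathbf{L}\mathbf{U}^*$ with $\mathbf{U}$ a $p\times p$ unitary matrix and $\mathbf{L}=\mathrm{Diag}(\ell_1,\ldots,\ell_p)$, $\ell_1>\ell_2>\cdots>\ell_p>0$ (almost surely). Let $\gamma_1(\mathbf{L}),\gamma_2(\mathbf{L}),\ldots,\gamma_p(\mathbf{L})$ be differentiable real-valued functions (on $\mathbb{R}^p_{>}$) satisfying (i) $0\le\gamma_k(\mathbf{L})\le 2(m-p)$ for $k=1,2,\ldots,p$; (ii) $(\partial\gamma_k/\partial\ell_k)(\mathbf{L})\ge 0$ for $k=1,2,\ldots,p$; (iii) $\gamma_1(\mathbf{L})\ge\gamma_2(\mathbf{L})\ge\cdots\ge\gamma_p(\mathbf{L})$. Then the estimator $\mathbf{Z}[\mathbf{I}_p+\mathbf{U}\mathbf{H}(\mathbf{L})\mathbf{U}^*]$ of $\mathbf{\Xi}$ with $$\mathbf{H}(\mathbf{L})=-\mathrm{Diag}\Big(\frac{\gamma_1(\mathbf{L})}{\ell_1},\frac{\gamma_2(\mathbf{L})}{\ell_2},\ldots,\frac{\gamma_p(\mathbf{L})}{\ell_p}\Big)$$ is minimax.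
   Context: $^*$ denotes conjugate transpose. $\mathbb{R}^p_{>}=\{(\ell_1,\ldots,\ell_p)\in\mathbb{R}^p:\ell_1>\cdots>\ell_p>0\}$. $\mathbf{Z}\sim\mathbb{C}N_{m\times p}(\mathbf{\Xi},\mathbf{I}_m\otimes\mathbf{I}_p)$ means that $\mathbf{Z}$ has density $\pi^{-mp}\exp\{-\mathrm{Tr}((\mathbf{z}-\mathbf{\Xi})(\mathbf{z}-\mathbf{\Xi})^* )\}$ with respect to Lebesgue measure on $\mathbb{C}^{m\times p}$. The risk of an estimator $\widehat{\mathbf{\Xi}}=\widehat{\mathbf{\Xi}}(\mathbf{Z})$ is $\mathcal{R}_0(\widehat{\mathbf{\Xi}},\mathbf{\Xi})=\mathbb{E}[\mathrm{Tr}\{(\widehat{\mathbf{\Xi}}-\mathbf{\Xi})^*(\widehat{\mathbf{\Xi}}-\mathbf{\Xi})\}]$. An estimator is minimax if its supremum risk over all $\mathbf{\Xi}\in\mathbb{C}^{m\times p}$ equals the infimum over all estimators of the supremum risk. *)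

theory Defs
  imports "HOL-Analysis.Analysis"
begin

definition conj_transpose :: "complex^'n^'m \<Rightarrow> complex^'m^'n" where
  "conj_transpose A = (\<chi> i j. cnj (A $ j $ i))"

definition unitary :: "complex^'n^'n \<Rightarrow> bool" where
  "unitary U \<longleftrightarrow> conj_transpose U ** U = mat 1 \<and> U ** conj_transpose U = mat 1"

definition real_diag :: "real^'n \<Rightarrow> complex^'n^'n" where
  "real_diag d = (\<chi> i j. if i = j then complex_of_real (d $ i) else 0)"

(* A p-element linearly ordered index type 'p plays the role of {1,...,p}. *)
definition decreasing_positive :: "(real^'p::{finite,linorder}) set" where
  "decreasing_positive = {l. (\<forall>i j. i < j \<longrightarrow> l $ j < l $ i) \<and> (\<forall>i. 0 < l $ i)}"

definition is_spectral_decomp ::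
    "complex^('p::{finite,linorder})^'m \<Rightarrow>
      complex^('p::{finite,linorder})^('p::{finite,linorder}) \<Rightarrow>
      real^('p::{finite,linorder}) \<Rightarrow> bool" where
  "is_spectral_decomp z U l \<longleftrightarrow>
     unitary U \<and> l \<in> decreasing_positive \<and>
     conj_transpose z ** z = U ** real_diag l ** conj_transpose U"

definition partial_deriv :: "(real^'n \<Rightarrow> real) \<Rightarrow> 'n \<Rightarrow> real^'n \<Rightarrow> real" where
  "partial_deriv f k l = deriv (\<lambda>t. f (\<chi> j. if j = k then t else l $ j)) (l $ k)"

(* lebesgue is the completion of lborel, whose orthonormal basis in complex^'p^'m
   consists of the real and imaginary coordinates of the entries.  The argument of
   exp is real, so taking Re discards nothing. *)
definition complex_normal :: "complex^'p^'m \<Rightarrow> (complex^'p^'m) measure" where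
  "complex_normal \<Xi> = density lebesgue
     (\<lambda>z. ennreal (exp (- Re (trace ((z - \<Xi>) ** conj_transpose (z - \<Xi>))))
                     / pi ^ (CARD('m) * CARD('p))))"

(* Lebesgue rather than Borel measurability, so that an estimator specified only
   almost everywhere is an estimator whatever its values on the exceptional null set. *)
definition estimators :: "(complex^'p^'m \<Rightarrow> complex^'p^'m) set" where
  "estimators = borel_measurable lebesgue"

definition risk ::
    "(complex^'p^'m \<Rightarrow> complex^'p^'m) \<Rightarrow> complex^'p^'m \<Rightarrow> ennreal" where
  "risk \<delta> \<Xi> =
     (\<integral>\<^sup>+ z. ennreal (Re (trace (conj_transpose (\<delta> z - \<Xi>) ** (\<delta> z - \<Xi>)))) \<partial>complex_normal \<Xi>)"

definition minimax :: "(complex^'p^'m \<Rightarrow> complex^'p^'m) \<Rightarrow> bool" where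
  "minimax \<delta> \<longleftrightarrow>
     \<delta> \<in> estimators \<and>
     (SUP \<Xi>. risk \<delta> \<Xi>) = (INF \<delta>'\<in>(estimators :: (complex^'p^'m \<Rightarrow> complex^'p^'m) set). SUP \<Xi>. risk \<delta>' \<Xi>)"

definition shrinkage_matrix :: "('p \<Rightarrow> real^'p \<Rightarrow> real) \<Rightarrow> real^'p \<Rightarrow> complex^'p^'p" where
  "shrinkage_matrix \<gamma> l = - real_diag (\<chi> k. \<gamma> k l / l $ k)"

end

theory Submission
  imports Defs "HOL-Probability.Distributions" "HOL-Computational_Algebra.Polynomial"
    "HOL-Real_Asymp.Real_Asymp"
begin

text \<open>
  The minimax risk is $mp$, the constant risk of $Z$ itself. No estimator has a smaller supremum of
  the risk: under a normal prior of variance $t$ for the entries of $\Xi$ the best Bayes risk is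
  $mp\,t/(1+t)$, which tends to $mp$ (\<open>gaussian_prior_bound\<close>, \<open>sup_risk_lower_bound\<close>). What remains
  is that the shrinkage estimator has risk at most $mp$ at every $\Xi$.

  Write the estimator as $Z - W(Z)$ with $W(Z) = Z\sum_k (\gamma_k/\ell_k) P_k$, where
  $Z^*Z = \sum_k \ell_k P_k$ is the spectral resolution. For a $C^1$ field $W$ of compact support,
  integration by parts against the normal density gives Stein's identity: the risk is
  $mp + E(|W|^2 - \mathrm{div}\,W)$, with the divergence over the $2mp$ real coordinates
  (\<open>stein_risk_bound\<close>). Here $|W|^2 = \sum_k \gamma_k^2/\ell_k$, while
  \[ \mathrm{div}\,W = \sum_k \Big(2\,\frac{\partial\gamma_k}{\partial\ell_k}
       + 2(m-p)\frac{\gamma_k}{\ell_k}\Big)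
       + 4\sum_{k<j}\frac{\gamma_k-\gamma_j}{\ell_k-\ell_j} \]
  (\<open>divergence_spectral_field\<close>, \<open>spectral_divergence_lower_bound\<close>). Conditions (ii) and (iii) make
  the first and the last term nonnegative, and (i) bounds $|W|^2$ by the middle one, so
  $|W|^2 \le \mathrm{div}\,W$ pointwise.

  The derivatives of eigenvalues and spectral projections needed for the divergence come from exact
  formulas: for two Hermitian matrices with resolutions $(\ell,P)$ and $(\ell',P')$,
  $P_j(S'-S)P'_k = (\ell'_k-\ell_j)P_jP'_k$. Together with the continuity of $\ell$ and $P$, which is a
  compactness argument, this already contains the first-order expansion.

  The field $W$ of the theorem need not be continuously differentiable or compactly supported, and it
  may be singular where eigenvalues meet or vanish. The proof uses no estimate near these walls: the
  approximations are arranged so that every error made there has the favourable sign. First, the open cone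
  $\ell_1 > \cdots > \ell_p > 0$ is closed under addition, so averaging $\gamma_k$ over small
  translates by vectors of the cone preserves (i)--(iii) and makes the functions $C^1$
  (\<open>smoothed\<close>). Second, the cutoff towards the walls is an increasing function of
  $\prod_{i<j}(\ell_i-\ell_j)\prod_i\ell_i$. This product increases in the direction
  $(\gamma_1,\ldots,\gamma_p)$, because that vector is nonnegative and decreasing; hence the cutoff
  adds a nonnegative term to the divergence (\<open>cutoff_directional\<close>). Third, the cutoff for large
  $\sum_k\ell_k$ costs $O(1/n)$. So the approximating estimators have risk at most $mp + O(1/n)$, and
  Fatou's lemma carries the bound to the limit (\<open>risk_integral_bound\<close>).

  Finally, almost every $Z$ has the required decomposition, because it fails to exist
  only where a nonzero polynomial in the real and imaginary parts of the entries vanishes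
  (\<open>AE_regular\<close>).
\<close>

section \<open>Gaussian integrals and integration by parts\<close>

text \<open>The integral of $F(x + te)$ does not depend on $t$. Differentiating under the integral at $t = 0$
is justified by dominated convergence, since the difference quotients are bounded and supported
in a common ball.\<close>

lemma integral_directional_derivative_eq_0:
  fixes F :: "'a::euclidean_space \<Rightarrow> real"
  assumes deriv: "\<And>x. (F has_derivative F' x) (at x)"
    and cont: "continuous_on UNIV (\<lambda>x. F' x e)"
    and supp: "\<And>x. r < norm x \<Longrightarrow> F x = 0"
  shows "integrable lborel (\<lambda>x. F' x e)" "(\<integral>x. F' x e \<partial>lborel) = 0"
proof -
  define R where "R = \<bar>r\<bar> + norm e + 1"
  have F'0: "F' x e = 0" if "r < norm x" for x
  proof -
    have "((\<lambda>_. 0::real) has_derivative F' x) (at x)"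
    proof (rule has_derivative_transform_within_open[OF deriv])
      show "open {y. r < norm y}" by (intro open_Collect_less continuous_intros)
      show "x \<in> {y. r < norm y}" using that by simp
    qed (use supp in auto)
    with has_derivative_const[of "0::real" "at x"] have "F' x = (\<lambda>_. 0)"
      using has_derivative_unique by blast
    then show ?thesis by simp
  qed
  have line: "((\<lambda>t. F (x + t *\<^sub>R e)) has_real_derivative F' (x + t *\<^sub>R e) e) (at t)" for x t
  proof -
    have 1: "((\<lambda>t. x + t *\<^sub>R e) has_derivative (\<lambda>t. t *\<^sub>R e)) (at t)"
      by (auto intro!: derivative_eq_intros)
    have "F' (x + t *\<^sub>R e) (h *\<^sub>R e) = F' (x + t *\<^sub>R e) e * h" for h
      using linear_cmul[OF has_derivative_linear[OF deriv]] by simp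
    then show ?thesis
      using has_derivative_compose[OF 1 deriv] by (simp add: has_field_derivative_def)
  qed
  have contF: "continuous_on UNIV F"
    using deriv by (meson continuous_at_imp_continuous_on has_derivative_continuous)
  have "compact ((\<lambda>x. F' x e) ` cball 0 R)"
    by (intro compact_continuous_image continuous_on_subset[OF cont]) auto
  then obtain B where B: "\<And>x. x \<in> cball 0 R \<Longrightarrow> \<bar>F' x e\<bar> \<le> B"
    using compact_imp_bounded[of "(\<lambda>x. F' x e) ` cball 0 R"] unfolding bounded_iff real_norm_def by blast
  have B0: "0 \<le> B" using B[of 0] by (auto simp: R_def) 
  have B': "\<bar>F' x e\<bar> \<le> B" for x
  proof (cases "x \<in> cball 0 R")
    case False
    then have "r < norm x" using norm_ge_zero[of e] unfolding R_def mem_cball dist_0_norm by linarith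
    then show ?thesis using F'0 B0 by simp
  qed (rule B)
  have quot: "\<bar>F (x + t *\<^sub>R e) - F x\<bar> \<le> B * t" if "0 < t" for x t
  proof -
    define g where "g s = F (x + s *\<^sub>R e)" for s
    have g: "(g has_real_derivative F' (x + s *\<^sub>R e) e) (at s)" for s
      unfolding g_def by (rule line)
    have "\<exists>s>0. s < t \<and> g t - g 0 = (t - 0) * F' (x + s *\<^sub>R e) e"
      by (rule MVT2[OF that]) (rule g)
    then obtain s where "g t - g 0 = t * F' (x + s *\<^sub>R e) e"
      by (simp only: diff_zero) blast
    then show ?thesis
      using B'[of "x + s *\<^sub>R e"] that by (simp add: g_def abs_mult mult.commute mult_left_mono)
  qed
  define s where "s n = (\<lambda>x. (F (x + inverse (real (Suc n)) *\<^sub>R e) - F x) / inverse (real (Suc n)))" for n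
  have dom: "norm (s n x) \<le> B * indicator (cball 0 R) x" for n x
  proof (cases "x \<in> cball 0 R")
    case True
    have "\<bar>s n x\<bar> = \<bar>F (x + inverse (real (Suc n)) *\<^sub>R e) - F x\<bar> / inverse (real (Suc n))"
      by (simp add: s_def abs_mult)
    also have "\<dots> \<le> B"
      using quot[of "inverse (real (Suc n))" x] by (simp add: divide_le_eq)
    finally show ?thesis using True by simp
  next
    case False
    then have x: "norm x > R" by simp
    have "norm (inverse (real (Suc n)) *\<^sub>R e) \<le> norm e"
      by (simp add: inverse_le_1_iff mult_left_le_one_le)
    then have "norm (x + inverse (real (Suc n)) *\<^sub>R e) \<ge> norm x - norm e"
      by (smt (verit) norm_diff_ineq)
    moreover have "r < norm x - norm e" using x unfolding R_def by linarith
    moreover have "norm x - norm e \<le> norm x" by simp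
    ultimately have "F (x + inverse (real (Suc n)) *\<^sub>R e) = 0" "F x = 0"
      using supp by (metis less_le_trans)+
    then show ?thesis using B0 by (simp add: s_def)
  qed
  have lim: "(\<lambda>n. s n x) \<longlonglongrightarrow> F' x e" for x
  proof -
    have "((\<lambda>t. F (x + t *\<^sub>R e)) has_real_derivative F' x e) (at 0)"
      using line[of x 0] by simp
    then have "((\<lambda>t. (F (x + t *\<^sub>R e) - F x) / t) \<longlongrightarrow> F' x e) (at 0)"
      by (simp add: DERIV_def)
    moreover have "filterlim (\<lambda>n. inverse (real (Suc n))) (at 0) sequentially"
      unfolding filterlim_at using LIMSEQ_inverse_real_of_nat by (auto intro: eventuallyI)
    ultimately show ?thesis
      unfolding s_def by (rule filterlim_compose)
  qed
  have intF: "integrable lborel F"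
  proof -
    have "integrable lborel (\<lambda>x. indicator (cball 0 R) x *\<^sub>R F x)"
      by (rule borel_integrable_compact) (auto intro: continuous_on_subset[OF contF])
    moreover have "(indicator (cball 0 R) x :: real) *\<^sub>R F x = F x" for x
    proof (cases "x \<in> cball 0 R")
      case False
      then have "r < norm x" using norm_ge_zero[of e] unfolding R_def mem_cball dist_0_norm by linarith
      then show ?thesis using supp by simp
    qed simp
    ultimately show ?thesis by (simp only: )
  qed
  have shift: "integrable lborel (\<lambda>x. F (x + c))" "(\<integral>x. F (x + c) \<partial>lborel) = (\<integral>x. F x \<partial>lborel)" for c
  proof -
    have [measurable]: "F \<in> borel_measurable borel" using contF by (rule borel_measurable_continuous_onI)
    have eq: "(lborel::'a measure) = distr lborel borel ((+) c)" by (simp add: lborel_distr_plus)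
    show "integrable lborel (\<lambda>x. F (x + c))"
      using intF by (subst (asm) eq) (simp add: integrable_distr_eq add.commute)
    show "(\<integral>x. F (x + c) \<partial>lborel) = (\<integral>x. F x \<partial>lborel)"
      by (subst (2) eq) (simp add: integral_distr add.commute)
  qed
  have m1: "(\<lambda>x. F' x e) \<in> borel_measurable lborel"
    using borel_measurable_continuous_onI[OF cont] by simp
  have m2: "s n \<in> borel_measurable lborel" for n
    unfolding s_def using shift(1) intF by (intro borel_measurable_divide borel_measurable_diff) auto
  have w: "integrable lborel (\<lambda>x::'a. B * indicator (cball 0 R) x :: real)"
    using emeasure_lborel_cball_finite[of "0::'a" R]
    by (intro integrable_mult_right) (simp add: integrable_indicator_iff)
  show "integrable lborel (\<lambda>x. F' x e)"
    by (rule integrable_dominated_convergence[OF m1 m2 w AE_I2[OF lim] AE_I2[OF dom]])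
  have "(\<lambda>n. \<integral>x. s n x \<partial>lborel) \<longlonglongrightarrow> (\<integral>x. F' x e \<partial>lborel)"
    by (rule integral_dominated_convergence[OF m1 m2 w AE_I2[OF lim] AE_I2[OF dom]])
  moreover have "(\<integral>x. s n x \<partial>lborel) = 0" for n
    unfolding s_def using shift intF by simp
  ultimately show "(\<integral>x. F' x e \<partial>lborel) = 0"
    by (simp add: LIMSEQ_const_iff)
qed

lemma nn_integral_gaussian_real:
  assumes s: "0 < s"
  shows "(\<integral>\<^sup>+x. ennreal (exp (- x\<^sup>2 / s)) \<partial>lborel) = ennreal (sqrt (pi * s))"
    and "(\<integral>\<^sup>+x. ennreal (x\<^sup>2 * exp (- x\<^sup>2 / s)) \<partial>lborel) = ennreal (s / 2 * sqrt (pi * s))"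
proof -
  define \<sigma> where "\<sigma> = sqrt (s / 2)"
  have \<sigma>: "0 < \<sigma>" "2 * \<sigma>\<^sup>2 = s" using s by (simp_all add: \<sigma>_def)
  have nd: "exp (- x\<^sup>2 / s) = sqrt (pi * s) * normal_density 0 \<sigma> x" for x
  proof -
    have e: "2 * pi * \<sigma>\<^sup>2 = pi * s" using \<sigma>(2) by (simp add: mult.assoc mult.left_commute)
    show ?thesis unfolding normal_density_def e \<sigma>(2) using s by simp
  qed
  have m: "has_bochner_integral lborel (\<lambda>x. sqrt (pi * s) * (normal_density 0 \<sigma> x * (x - 0) ^ (2 * k)))
      (sqrt (pi * s) * (fact (2 * k) / ((2 / \<sigma>\<^sup>2) ^ k * fact k)))" for k
    by (intro has_bochner_integral_mult_right normal_moment_even \<sigma>)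
  have nn: "(\<integral>\<^sup>+x. ennreal (sqrt (pi * s) * (normal_density 0 \<sigma> x * (x - 0) ^ (2 * k))) \<partial>lborel)
      = ennreal (sqrt (pi * s) * (fact (2 * k) / ((2 / \<sigma>\<^sup>2) ^ k * fact k)))" for k
    using m[of k] s
    by (subst nn_integral_eq_integral) (auto simp: has_bochner_integral_iff)
  show "(\<integral>\<^sup>+x. ennreal (exp (- x\<^sup>2 / s)) \<partial>lborel) = ennreal (sqrt (pi * s))"
    using nn[of 0] unfolding nd by simp
  have eq: "x\<^sup>2 * exp (- x\<^sup>2 / s) = sqrt (pi * s) * (normal_density 0 \<sigma> x * (x - 0) ^ (2 * 1))" for x
    unfolding nd by simp
  have f: "sqrt (pi * s) * (fact (2 * 1) / ((2 / \<sigma>\<^sup>2) ^ 1 * fact 1)) = s / 2 * sqrt (pi * s)"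
    using \<sigma> by (simp add: fact_numeral)
  show "(\<integral>\<^sup>+x. ennreal (x\<^sup>2 * exp (- x\<^sup>2 / s)) \<partial>lborel) = ennreal (s / 2 * sqrt (pi * s))"
    unfolding eq nn f ..
qed

lemma norm_power2_eq_sum_Basis: "(norm (u::'a::euclidean_space))\<^sup>2 = (\<Sum>b\<in>Basis. (u \<bullet> b)\<^sup>2)"
  unfolding power2_norm_eq_inner by (subst euclidean_inner) (simp add: power2_eq_square)

text \<open>The density factorises over the coordinates; for the second moment, expand
$|u|^2 = \sum_c (u\cdot c)^2$ and move each square into its own factor.\<close>

lemma nn_integral_gaussian:
  assumes s: "0 < s"
  shows "(\<integral>\<^sup>+u. ennreal (exp (- (norm (u::'a::euclidean_space))\<^sup>2 / s)) \<partial>lborel) = ennreal (sqrt (pi * s) ^ DIM('a))"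
    and "(\<integral>\<^sup>+u. ennreal ((norm (u::'a))\<^sup>2 * exp (- (norm u)\<^sup>2 / s)) \<partial>lborel)
          = ennreal (DIM('a) * (s / 2) * sqrt (pi * s) ^ DIM('a))"
proof -
  have prod: "exp (- (norm (u::'a))\<^sup>2 / s) = (\<Prod>b\<in>Basis. exp (- (u \<bullet> b)\<^sup>2 / s))" for u
    by (simp add: norm_power2_eq_sum_Basis exp_sum[symmetric] sum_divide_distrib sum_negf)
  show "(\<integral>\<^sup>+u. ennreal (exp (- (norm (u::'a))\<^sup>2 / s)) \<partial>lborel) = ennreal (sqrt (pi * s) ^ DIM('a))"
    unfolding prod
    by (simp add: prod_ennreal[symmetric], subst nn_integral_lborel_prod)
       (use nn_integral_gaussian_real(1)[OF s] s in \<open>auto simp: ennreal_power less_imp_le\<close>)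
  have "(\<integral>\<^sup>+u. ennreal ((norm (u::'a))\<^sup>2 * exp (- (norm u)\<^sup>2 / s)) \<partial>lborel)
      = (\<integral>\<^sup>+u. (\<Sum>c\<in>Basis. \<Prod>b\<in>Basis. ennreal ((if b = c then ((u::'a) \<bullet> b)\<^sup>2 else 1) * exp (- (u \<bullet> b)\<^sup>2 / s))) \<partial>lborel)"
  proof (intro nn_integral_cong)
    fix u :: 'a
    have 1: "(\<Prod>b\<in>Basis. ennreal ((if b = c then (u \<bullet> b)\<^sup>2 else 1) * exp (- (u \<bullet> b)\<^sup>2 / s)))
        = ennreal ((u \<bullet> c)\<^sup>2 * exp (- (norm u)\<^sup>2 / s))" if "c \<in> Basis" for c
    proof -
      have "(\<Prod>b\<in>Basis. (if b = c then (u \<bullet> b)\<^sup>2 else 1)) = (u \<bullet> c)\<^sup>2"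
        using that by (subst prod.delta) auto
      moreover have "(\<Prod>b\<in>Basis. ennreal ((if b = c then (u \<bullet> b)\<^sup>2 else 1) * exp (- (u \<bullet> b)\<^sup>2 / s)))
          = ennreal (\<Prod>b\<in>Basis. (if b = c then (u \<bullet> b)\<^sup>2 else 1) * exp (- (u \<bullet> b)\<^sup>2 / s))"
        by (rule prod_ennreal) auto
      ultimately show ?thesis by (simp only: prod.distrib prod)
    qed
    have 2: "(norm u)\<^sup>2 * exp (- (norm u)\<^sup>2 / s) = (\<Sum>c\<in>Basis. (u \<bullet> c)\<^sup>2 * exp (- (norm u)\<^sup>2 / s))"
      by (subst norm_power2_eq_sum_Basis) (rule sum_distrib_right)
    have "ennreal ((norm u)\<^sup>2 * exp (- (norm u)\<^sup>2 / s)) = (\<Sum>c\<in>Basis. ennreal ((u \<bullet> c)\<^sup>2 * exp (- (norm u)\<^sup>2 / s)))"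
      unfolding 2 by (rule sum_ennreal[symmetric]) simp
    also have "\<dots> = (\<Sum>c\<in>Basis. \<Prod>b\<in>Basis. ennreal ((if b = c then (u \<bullet> b)\<^sup>2 else 1) * exp (- (u \<bullet> b)\<^sup>2 / s)))"
      by (rule sum.cong[OF refl], rule 1[symmetric])
    finally show "ennreal ((norm u)\<^sup>2 * exp (- (norm u)\<^sup>2 / s)) = (\<Sum>c\<in>Basis. \<Prod>b\<in>Basis. ennreal ((if b = c then (u \<bullet> b)\<^sup>2 else 1) * exp (- (u \<bullet> b)\<^sup>2 / s)))" .
  qed
  also have "\<dots> = (\<Sum>c\<in>(Basis::'a set). \<integral>\<^sup>+u. (\<Prod>b\<in>Basis. ennreal ((if b = c then (u \<bullet> b)\<^sup>2 else 1) * exp (- (u \<bullet> b)\<^sup>2 / s))) \<partial>lborel)"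
    by (intro nn_integral_sum) auto
  also have "\<dots> = (\<Sum>c\<in>(Basis::'a set). \<Prod>b\<in>(Basis::'a set). \<integral>\<^sup>+x. ennreal ((if b = c then x\<^sup>2 else 1) * exp (- x\<^sup>2 / s)) \<partial>lborel)"
    by (intro sum.cong refl nn_integral_lborel_prod) auto
  also have "\<dots> = (\<Sum>c\<in>(Basis::'a set). \<Prod>b\<in>(Basis::'a set). ennreal ((if b = c then s / 2 else 1) * sqrt (pi * s)))"
    using nn_integral_gaussian_real[OF s] by (intro sum.cong prod.cong refl) auto
  also have "\<dots> = (\<Sum>c\<in>(Basis::'a set). ennreal (s / 2 * sqrt (pi * s) ^ DIM('a)))"
    using s by (intro sum.cong refl) (simp add: prod_ennreal prod.distrib del: sum_constant)
  also have "\<dots> = ennreal (DIM('a) * (s / 2) * sqrt (pi * s) ^ DIM('a))"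
    using s by (simp add: ennreal_of_nat_eq_real_of_nat flip: ennreal_mult)
  finally show "(\<integral>\<^sup>+u. ennreal ((norm (u::'a))\<^sup>2 * exp (- (norm u)\<^sup>2 / s)) \<partial>lborel)
          = ennreal (DIM('a) * (s / 2) * sqrt (pi * s) ^ DIM('a))" .
qed

lemma nn_integral_lborel_translate:
  assumes "f \<in> borel_measurable borel"
  shows "(\<integral>\<^sup>+z. f (z + c) \<partial>lborel) = (\<integral>\<^sup>+z. f (z :: 'a::euclidean_space) \<partial>lborel)"
proof -
  have "(\<integral>\<^sup>+z. f z \<partial>lborel) = (\<integral>\<^sup>+z. f z \<partial>distr lborel borel ((+) c))"
    by (simp add: lborel_distr_plus)
  also have "\<dots> = (\<integral>\<^sup>+z. f (z + c) \<partial>lborel)"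
    using assms by (subst nn_integral_distr) (auto simp: add.commute)
  finally show ?thesis ..
qed

lemma nn_integral_lborel_reflect:
  assumes [measurable]: "f \<in> borel_measurable borel"
  shows "(\<integral>\<^sup>+z. f (- z) \<partial>lborel) = (\<integral>\<^sup>+z. f (z :: 'a::euclidean_space) \<partial>lborel)"
proof -
  have "(lborel :: 'a measure) = distr lborel borel (\<lambda>x. 0 + (- 1) *\<^sub>R x)"
    using lborel_affine[of "- 1" "0::'a"] by (simp add: density_1)
  then have "(\<integral>\<^sup>+z. f z \<partial>lborel) = (\<integral>\<^sup>+z. f z \<partial>distr lborel borel (\<lambda>x. 0 + (- 1) *\<^sub>R (x::'a)))"
    by simp
  also have "\<dots> = (\<integral>\<^sup>+z. f (- z) \<partial>lborel)"
    by (subst nn_integral_distr) auto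
  finally show ?thesis ..
qed

text \<open>Up to the factor $\pi^{-d/2}$, where $d$ is the real dimension, this is the quadratic risk of
$\delta$ at $\xi$ for one observation with variance $1/2$ in every real coordinate.\<close>

definition gaussian_risk :: "('a::euclidean_space \<Rightarrow> 'a) \<Rightarrow> 'a \<Rightarrow> ennreal" where
  "gaussian_risk \<delta> \<xi> = (\<integral>\<^sup>+z. ennreal ((norm (\<delta> z - \<xi>))\<^sup>2 * exp (- (norm (z - \<xi>))\<^sup>2)) \<partial>lborel)"

text \<open>With $\phi$ the unnormalised density, $\mathrm{div}(\phi W) = \phi\,\mathrm{div}\,W - 2\phi\,(z-\xi)\cdot W$
has integral zero. Adding it to the integrand $|z-\xi-W|^2\phi$ removes the cross term and leaves
$(|z-\xi|^2 + |W|^2 - \mathrm{div}\,W)\phi \le (|z-\xi|^2 + c)\phi$, whose integral is explicit.\<close>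

lemma stein_risk_bound:
  fixes W :: "'a::euclidean_space \<Rightarrow> 'a" and \<xi> :: 'a
  assumes deriv: "\<And>z. (W has_derivative W' z) (at z)"
    and cont: "\<And>e. e \<in> Basis \<Longrightarrow> continuous_on UNIV (\<lambda>z. W' z e)"
    and supp: "\<And>z. r < norm z \<Longrightarrow> W z = 0"
    and div: "\<And>z. (norm (W z))\<^sup>2 \<le> (\<Sum>e\<in>Basis. W' z e \<bullet> e) + c"
    and c: "0 \<le> c"
  shows "gaussian_risk (\<lambda>z. z - W z) \<xi> \<le> ennreal ((DIM('a) / 2 + c) * sqrt pi ^ DIM('a))"
proof -
  define \<phi> where "\<phi> z = exp (- (norm (z - \<xi>))\<^sup>2)" for z
  define F' where "F' e z h = \<phi> z * (W' z h \<bullet> e) - 2 * ((z - \<xi>) \<bullet> h) * \<phi> z * (W z \<bullet> e)" for e z h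
  have contW: "continuous_on UNIV W"
    using deriv by (meson continuous_at_imp_continuous_on has_derivative_continuous)
  have d: "((\<lambda>z. \<phi> z * (W z \<bullet> e)) has_derivative F' e z) (at z)" for e z
    unfolding \<phi>_def power2_norm_eq_inner F'_def
    by (rule derivative_eq_intros deriv refl)+ 
       (auto simp: inner_commute algebra_simps fun_eq_iff power2_norm_eq_inner \<phi>_def)
  have cF: "continuous_on UNIV (\<lambda>z. F' e z e)" if "e \<in> Basis" for e
    unfolding F'_def \<phi>_def by (intro continuous_intros cont contW that)
  have F: "integrable lborel (\<lambda>z. F' e z e)" "(\<integral>z. F' e z e \<partial>lborel) = 0" if "e \<in> Basis" for e
    using integral_directional_derivative_eq_0[OF d cF[OF that], of r] supp by auto
  define D where "D z = (\<Sum>e\<in>Basis. F' e z e)" for z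
  have D: "integrable lborel D" "(\<integral>z. D z \<partial>lborel) = 0"
    unfolding D_def using F by auto
  have D_eq: "D z = \<phi> z * (\<Sum>e\<in>Basis. W' z e \<bullet> e) - 2 * \<phi> z * ((z - \<xi>) \<bullet> W z)" for z
    unfolding D_def F'_def
    by (subst (2) euclidean_inner) (simp add: sum_subtractf sum_distrib_left mult_ac)
  define g where "g z = ((norm (z - \<xi>))\<^sup>2 + c) * \<phi> z" for z
  have "(\<integral>\<^sup>+z. ennreal (g z) \<partial>lborel)
     = (\<integral>\<^sup>+z. ennreal (((norm (z + - \<xi>))\<^sup>2 + c) * exp (- (norm (z + - \<xi>))\<^sup>2)) \<partial>lborel)"
    by (simp add: g_def \<phi>_def)
  also have "\<dots> = (\<integral>\<^sup>+z. ennreal (((norm (z::'a))\<^sup>2 + c) * exp (- (norm z)\<^sup>2)) \<partial>lborel)"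
    by (rule nn_integral_lborel_translate) measurable
  also have "\<dots> = (\<integral>\<^sup>+z. ennreal ((norm (z::'a))\<^sup>2 * exp (- (norm z)\<^sup>2 / 1)) + ennreal c * ennreal (exp (- (norm z)\<^sup>2 / 1)) \<partial>lborel)"
    using c by (intro nn_integral_cong) (simp add: distrib_right flip: ennreal_mult ennreal_plus)
  also have "\<dots> = ennreal (DIM('a) * (1 / 2) * sqrt (pi * 1) ^ DIM('a)) + ennreal c * ennreal (sqrt (pi * 1) ^ DIM('a))"
    by (simp add: nn_integral_add nn_integral_cmult nn_integral_gaussian[of 1, simplified])
  also have "\<dots> = ennreal ((DIM('a) / 2 + c) * sqrt pi ^ DIM('a))"
    using c by (simp add: distrib_right flip: ennreal_mult ennreal_plus)
  finally have gi: "(\<integral>\<^sup>+z. ennreal (g z) \<partial>lborel) = ennreal ((DIM('a) / 2 + c) * sqrt pi ^ DIM('a))" .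
  have "has_bochner_integral lborel g ((DIM('a) / 2 + c) * sqrt pi ^ DIM('a))"
    using c gi by (intro has_bochner_integral_nn_integral) (auto simp: g_def[abs_def] \<phi>_def[abs_def])
  then have gD: "integrable lborel (\<lambda>z. g z + D z)" "(\<integral>z. g z + D z \<partial>lborel) = (DIM('a) / 2 + c) * sqrt pi ^ DIM('a)"
    using D by (auto simp: has_bochner_integral_iff)
  have le: "(norm (z - W z - \<xi>))\<^sup>2 * \<phi> z \<le> g z + D z" for z
  proof -
    have "(norm (z - W z - \<xi>))\<^sup>2 = (norm (z - \<xi>))\<^sup>2 - 2 * ((z - \<xi>) \<bullet> W z) + (norm (W z))\<^sup>2"
      by (simp add: power2_norm_eq_inner inner_diff_left inner_diff_right inner_commute)
    also have "\<dots> \<le> (norm (z - \<xi>))\<^sup>2 - 2 * ((z - \<xi>) \<bullet> W z) + ((\<Sum>e\<in>Basis. W' z e \<bullet> e) + c)"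
      using div by simp
    finally have "(norm (z - W z - \<xi>))\<^sup>2 * \<phi> z
        \<le> ((norm (z - \<xi>))\<^sup>2 - 2 * ((z - \<xi>) \<bullet> W z) + ((\<Sum>e\<in>Basis. W' z e \<bullet> e) + c)) * \<phi> z"
      by (intro mult_right_mono) (simp_all add: \<phi>_def)
    also have "\<dots> = g z + D z" by (simp add: g_def D_eq algebra_simps)
    finally show ?thesis .
  qed
  have "gaussian_risk (\<lambda>z. z - W z) \<xi> \<le> (\<integral>\<^sup>+z. ennreal (g z + D z) \<partial>lborel)"
    unfolding gaussian_risk_def using le by (intro nn_integral_mono ennreal_leI) (simp add: \<phi>_def)
  also have "\<dots> = ennreal (\<integral>z. g z + D z \<partial>lborel)"
  proof (rule nn_integral_eq_integral[OF gD(1)])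
    show "AE z in lborel. 0 \<le> g z + D z"
      using le by (intro AE_I2) (smt (verit) \<phi>_def exp_ge_zero mult_nonneg_nonneg zero_le_power2)
  qed
  finally show ?thesis by (simp only: gD(2))
qed

text \<open>Average the risk over a centred normal prior of variance $t/2$ per real coordinate and interchange
the integrals. Given $z$, the posterior of $\xi$ is symmetric about $cz$ with $c = t/(1+t)$; the
reflection $u \mapsto -u$ of $\xi = cz + u$ shows that no choice of $\delta(z)$ does better
than $cz$.\<close>

lemma gaussian_prior_bound:
  fixes \<delta> :: "'a::euclidean_space \<Rightarrow> 'a"
  assumes [measurable]: "\<delta> \<in> borel_measurable borel" and t: "0 < t"
    and B: "\<And>\<xi>. gaussian_risk \<delta> \<xi> \<le> B"
  shows "ennreal (DIM('a) / 2 * (t / (1 + t)) * sqrt pi ^ DIM('a)) \<le> B"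
proof -
  define c where "c = t / (1 + t)"
  have c: "0 < c" using t by (simp add: c_def)
  define D where "D = DIM('a)"
  have inner: "ennreal (exp (- (norm z)\<^sup>2 / (1 + t))) * ennreal (D * (c / 2) * sqrt (pi * c) ^ D)
      \<le> (\<integral>\<^sup>+\<xi>. ennreal (exp (- (norm \<xi>)\<^sup>2 / t)) * ennreal ((norm (\<delta> z - \<xi>))\<^sup>2 * exp (- (norm (z - \<xi>))\<^sup>2)) \<partial>lborel)" (is "_ \<le> ?I") for z
  proof -
    define a where "a = \<delta> z - c *\<^sub>R z"
    define w where "w u = exp (- (norm (u::'a))\<^sup>2 / c)" for u
    have [measurable]: "w \<in> borel_measurable borel" unfolding w_def by measurable
    \<comment> \<open>Completing the square; note that $1 + 1/t = 1/c$.\<close>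
    have sq: "(norm \<xi>)\<^sup>2 / t + (norm (z - \<xi>))\<^sup>2 = (norm z)\<^sup>2 / (1 + t) + (norm (\<xi> - c *\<^sub>R z))\<^sup>2 / c" for \<xi>
    proof -
      have "(norm (z - \<xi>))\<^sup>2 = (norm z)\<^sup>2 - 2 * (\<xi> \<bullet> z) + (norm \<xi>)\<^sup>2"
        by (simp add: power2_norm_eq_inner inner_diff_left inner_diff_right inner_commute)
      moreover have "(norm (\<xi> - c *\<^sub>R z))\<^sup>2 = (norm \<xi>)\<^sup>2 - 2 * c * (\<xi> \<bullet> z) + c\<^sup>2 * (norm z)\<^sup>2"
        by (simp only: power2_norm_eq_inner inner_diff_left inner_diff_right inner_scaleR_left inner_scaleR_right)
           (simp add: inner_commute power2_eq_square algebra_simps)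
      moreover have "x / t + (y - 2 * s + x) = y / (1 + t) + (x - 2 * c * s + c\<^sup>2 * y) / c" for x y s
      proof -
        have "(x - 2 * c * s + c\<^sup>2 * y) / c = x / c - 2 * s + c * y"
          using c by (simp add: field_simps power2_eq_square)
        moreover have "x / c = x / t + x" using t by (simp add: c_def field_simps)
        moreover have "y / (1 + t) + c * y = y"
        proof -
          have "1 / (1 + t) + c = 1" using t by (simp add: c_def add_divide_distrib[symmetric])
          then have "(1 / (1 + t) + c) * y = y" by simp
          then show ?thesis by (simp add: distrib_right)
        qed
        ultimately show ?thesis by simp
      qed
      ultimately show ?thesis by simp
    qed
    have "?I = (\<integral>\<^sup>+\<xi>. ennreal (exp (- (norm z)\<^sup>2 / (1 + t))) * ennreal ((norm (a - (\<xi> + - (c *\<^sub>R z))))\<^sup>2 * w (\<xi> + - (c *\<^sub>R z))) \<partial>lborel)"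
    proof (intro nn_integral_cong)
      fix \<xi> :: 'a
      have "exp (- (norm \<xi>)\<^sup>2 / t) * exp (- (norm (z - \<xi>))\<^sup>2) = exp (- (norm z)\<^sup>2 / (1 + t)) * w (\<xi> - c *\<^sub>R z)"
        unfolding w_def using sq[of \<xi>] by (simp add: exp_add[symmetric])
      then show "ennreal (exp (- (norm \<xi>)\<^sup>2 / t)) * ennreal ((norm (\<delta> z - \<xi>))\<^sup>2 * exp (- (norm (z - \<xi>))\<^sup>2))
         = ennreal (exp (- (norm z)\<^sup>2 / (1 + t))) * ennreal ((norm (a - (\<xi> + - (c *\<^sub>R z))))\<^sup>2 * w (\<xi> + - (c *\<^sub>R z)))"
        by (simp add: a_def mult.left_commute w_def flip: ennreal_mult)
    qed
    also have "\<dots> = ennreal (exp (- (norm z)\<^sup>2 / (1 + t))) * (\<integral>\<^sup>+\<xi>. ennreal ((norm (a - (\<xi> + - (c *\<^sub>R z))))\<^sup>2 * w (\<xi> + - (c *\<^sub>R z))) \<partial>lborel)"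
      by (rule nn_integral_cmult) measurable
    also have "(\<integral>\<^sup>+\<xi>. ennreal ((norm (a - (\<xi> + - (c *\<^sub>R z))))\<^sup>2 * w (\<xi> + - (c *\<^sub>R z))) \<partial>lborel)
       = (\<integral>\<^sup>+u. ennreal ((norm (a - u))\<^sup>2 * w u) \<partial>lborel)"
      by (rule nn_integral_lborel_translate) measurable
    finally have I: "?I = ennreal (exp (- (norm z)\<^sup>2 / (1 + t))) * (\<integral>\<^sup>+u. ennreal ((norm (a - u))\<^sup>2 * w u) \<partial>lborel)" .
    have "ennreal (D * (c / 2) * sqrt (pi * c) ^ D) \<le> (\<integral>\<^sup>+u. ennreal ((norm (a - u))\<^sup>2 * w u) \<partial>lborel)"
    proof -
      have refl: "(\<integral>\<^sup>+u. ennreal ((norm (a + u))\<^sup>2 * w u) \<partial>lborel) = (\<integral>\<^sup>+u. ennreal ((norm (a - u))\<^sup>2 * w u) \<partial>lborel)"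
        using nn_integral_lborel_reflect[of "\<lambda>u. ennreal ((norm (a - u))\<^sup>2 * w u)"] by (simp add: w_def)
      have "2 * ennreal (D * (c / 2) * sqrt (pi * c) ^ D) = 2 * (\<integral>\<^sup>+u. ennreal ((norm u)\<^sup>2 * w u) \<partial>lborel)"
        unfolding w_def D_def nn_integral_gaussian(2)[OF c] ..
      also have "\<dots> = (\<integral>\<^sup>+u. 2 * ennreal ((norm u)\<^sup>2 * w u) \<partial>lborel)"
        by (rule nn_integral_cmult[symmetric]) measurable
      also have "\<dots> \<le> (\<integral>\<^sup>+u. ennreal ((norm (a - u))\<^sup>2 * w u) + ennreal ((norm (a + u))\<^sup>2 * w u) \<partial>lborel)"
      proof (intro nn_integral_mono)
        fix u
        have "(norm (a - u))\<^sup>2 + (norm (a + u))\<^sup>2 = 2 * (norm a)\<^sup>2 + 2 * (norm u)\<^sup>2"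
          by (simp add: power2_norm_eq_inner inner_diff_left inner_diff_right inner_add_left inner_add_right inner_commute)
        then have "2 * (norm u)\<^sup>2 \<le> (norm (a - u))\<^sup>2 + (norm (a + u))\<^sup>2" by simp
        then have "2 * (norm u)\<^sup>2 * w u \<le> ((norm (a - u))\<^sup>2 + (norm (a + u))\<^sup>2) * w u"
          by (rule mult_right_mono) (simp add: w_def)
        moreover have "2 * ennreal ((norm u)\<^sup>2 * w u) = ennreal (2 * (norm u)\<^sup>2 * w u)"
          by (simp add: w_def ennreal_mult' mult.assoc)
        moreover have "ennreal ((norm (a - u))\<^sup>2 * w u) + ennreal ((norm (a + u))\<^sup>2 * w u)
            = ennreal (((norm (a - u))\<^sup>2 + (norm (a + u))\<^sup>2) * w u)"
          by (simp add: w_def distrib_right)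
        ultimately show "2 * ennreal ((norm u)\<^sup>2 * w u)
            \<le> ennreal ((norm (a - u))\<^sup>2 * w u) + ennreal ((norm (a + u))\<^sup>2 * w u)"
          by (metis ennreal_leI)
      qed
      also have "\<dots> = 2 * (\<integral>\<^sup>+u. ennreal ((norm (a - u))\<^sup>2 * w u) \<partial>lborel)"
        by (subst nn_integral_add) (auto simp: refl mult_2)
      finally show ?thesis
        by (subst (asm) ennreal_mult_le_mult_iff) auto
    qed
    then show ?thesis unfolding I by (rule mult_left_mono) simp
  qed
  have "ennreal (D * (c / 2) * sqrt (pi * c) ^ D) * ennreal (sqrt (pi * (1 + t)) ^ D)
      = (\<integral>\<^sup>+z. ennreal (exp (- (norm (z::'a))\<^sup>2 / (1 + t))) * ennreal (D * (c / 2) * sqrt (pi * c) ^ D) \<partial>lborel)"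
    using t nn_integral_gaussian(1)[of "1 + t", where 'a='a]
    by (subst nn_integral_multc) (auto simp: D_def mult.commute)
  also have "\<dots> \<le> (\<integral>\<^sup>+z. (\<integral>\<^sup>+\<xi>. ennreal (exp (- (norm \<xi>)\<^sup>2 / t)) * ennreal ((norm (\<delta> z - \<xi>))\<^sup>2 * exp (- (norm (z - \<xi>))\<^sup>2)) \<partial>lborel) \<partial>lborel)"
    by (intro nn_integral_mono inner)
  also have "\<dots> = (\<integral>\<^sup>+\<xi>. (\<integral>\<^sup>+z. ennreal (exp (- (norm \<xi>)\<^sup>2 / t)) * ennreal ((norm (\<delta> z - \<xi>))\<^sup>2 * exp (- (norm (z - \<xi>))\<^sup>2)) \<partial>lborel) \<partial>lborel)"
    by (rule lborel_pair.Fubini') measurable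
  also have "\<dots> = (\<integral>\<^sup>+\<xi>. ennreal (exp (- (norm \<xi>)\<^sup>2 / t)) * (\<integral>\<^sup>+z. ennreal ((norm (\<delta> z - \<xi>))\<^sup>2 * exp (- (norm (z - \<xi>))\<^sup>2)) \<partial>lborel) \<partial>lborel)"
    by (intro nn_integral_cong nn_integral_cmult) measurable
  also have "\<dots> \<le> (\<integral>\<^sup>+\<xi>. ennreal (exp (- (norm (\<xi>::'a))\<^sup>2 / t)) * B \<partial>lborel)"
    by (intro nn_integral_mono mult_left_mono B[unfolded gaussian_risk_def]) auto
  also have "\<dots> = B * ennreal (sqrt (pi * t) ^ D)"
    using t nn_integral_gaussian(1)[of t, where 'a='a]
    by (subst nn_integral_multc) (auto simp: D_def mult.commute)
  finally have 1: "ennreal (D * (c / 2) * sqrt (pi * c) ^ D) * ennreal (sqrt (pi * (1 + t)) ^ D) \<le> B * ennreal (sqrt (pi * t) ^ D)" .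
  have "sqrt (pi * c) * sqrt (pi * (1 + t)) = sqrt pi * sqrt (pi * t)"
    using t by (simp add: c_def flip: real_sqrt_mult)
  then have "sqrt (pi * c) ^ D * sqrt (pi * (1 + t)) ^ D = sqrt pi ^ D * sqrt (pi * t) ^ D"
    by (metis power_mult_distrib)
  then have "ennreal (D * (c / 2) * sqrt (pi * c) ^ D) * ennreal (sqrt (pi * (1 + t)) ^ D)
      = ennreal (D * (c / 2) * sqrt pi ^ D) * ennreal (sqrt (pi * t) ^ D)"
    using c t by (simp add: mult.assoc flip: ennreal_mult)
  with 1 have "ennreal (sqrt (pi * t) ^ D) * ennreal (D * (c / 2) * sqrt pi ^ D) \<le> ennreal (sqrt (pi * t) ^ D) * B"
    by (simp add: mult.commute)
  then have "ennreal (D * (c / 2) * sqrt pi ^ D) \<le> B"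
    using t by (subst (asm) ennreal_mult_le_mult_iff) auto
  then show ?thesis unfolding D_def c_def by (simp add: mult.commute)
qed

section \<open>Complex matrices and spectral resolutions\<close>

lemma conj_transpose_conj_transpose [simp]: "conj_transpose (conj_transpose A) = A"
  by (simp add: conj_transpose_def vec_eq_iff)

lemma conj_transpose_mult: "conj_transpose (A ** B) = conj_transpose B ** conj_transpose A"
  by (simp add: conj_transpose_def vec_eq_iff matrix_matrix_mult_def mult.commute)

lemma conj_transpose_add [simp]: "conj_transpose (A + B) = conj_transpose A + conj_transpose B"
  and conj_transpose_diff [simp]: "conj_transpose (A - B) = conj_transpose A - conj_transpose B"
  and conj_transpose_scaleR [simp]: "conj_transpose (c *\<^sub>R A) = c *\<^sub>R conj_transpose A"
  and conj_transpose_0 [simp]: "conj_transpose 0 = 0"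
  and conj_transpose_1 [simp]: "conj_transpose (mat 1) = mat 1"
  by (simp_all add: conj_transpose_def vec_eq_iff mat_def)

lemma conj_transpose_sum [simp]: "conj_transpose (sum f S) = (\<Sum>k\<in>S. conj_transpose (f k))"
  by (simp add: conj_transpose_def vec_eq_iff)

lemma linear_conj_transpose: "linear conj_transpose"
  by (intro linearI) auto

lemma bounded_linear_conj_transpose: "bounded_linear conj_transpose"
  using linear_conj_transpose by (simp add: linear_conv_bounded_linear)

text \<open>The real Euclidean structure of the space of matrices is $\mathrm{Re}\,\mathrm{tr}(A^*B)$, so
norms and inner products of matrices can be computed as traces.\<close>

lemma inner_eq_trace: "inner A B = Re (trace (conj_transpose A ** B))"
  by (simp add: inner_vec_def trace_def matrix_matrix_mult_def conj_transpose_def inner_complex_def)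
     (subst sum.swap, rule refl)

lemma trace_scaleR: "trace (c *\<^sub>R (A::complex^'n^'n)) = c *\<^sub>R trace A"
  by (simp add: trace_def scaleR_sum_right)

lemma trace_sum: "trace (sum f S) = (\<Sum>k\<in>S. trace (f k :: complex^'n^'n))"
  by (simp add: trace_def) (rule sum.swap)

lemma norm_power2_eq_trace: "(norm A)\<^sup>2 = Re (trace (conj_transpose A ** A))"
  by (simp add: power2_norm_eq_inner inner_eq_trace)

lemma norm_power2_eq_trace': "(norm A)\<^sup>2 = Re (trace (A ** conj_transpose A))"
  unfolding norm_power2_eq_trace by (subst trace_mul_sym) (rule refl)

lemma bounded_bilinear_matrix_mult:
  "bounded_bilinear ((**) :: complex^'n^'m \<Rightarrow> complex^'k^'n \<Rightarrow> complex^'k^'m)"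
proof -
  have "bilinear ((**) :: complex^'n^'m \<Rightarrow> complex^'k^'n \<Rightarrow> complex^'k^'m)"
    unfolding bilinear_def
  proof (intro conjI allI linearI)
    fix A A' :: "complex^'n^'m" and B B' :: "complex^'k^'n" and c :: real
    show "A ** (B + B') = A ** B + A ** B'" by (rule matrix_add_ldistrib)
    show "(A + A') ** B = A ** B + A' ** B" by (simp add: matrix_matrix_mult_def vec_eq_iff distrib_right sum.distrib)
    show "A ** (c *\<^sub>R B) = c *\<^sub>R (A ** B)" by (simp add: matrix_matrix_mult_def vec_eq_iff scaleR_sum_right)
    show "(c *\<^sub>R A) ** B = c *\<^sub>R (A ** B)" by (simp add: matrix_matrix_mult_def vec_eq_iff scaleR_sum_right)
  qed
  then show ?thesis by (simp add: bilinear_conv_bounded_bilinear)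
qed

interpretation matrix_mult: bounded_bilinear "(**) :: complex^'n^'m \<Rightarrow> complex^'k^'n \<Rightarrow> complex^'k^'m"
  by (rule bounded_bilinear_matrix_mult)

lemma bounded_linear_trace: "bounded_linear (trace :: complex^'n^'n \<Rightarrow> complex)"
  unfolding linear_conv_bounded_linear[symmetric]
  by (intro linearI) (auto simp: trace_add trace_scaleR)

lemma conj_transpose_nth: "conj_transpose A $ i $ j = cnj (A $ j $ i)"
  by (simp add: conj_transpose_def)

lemma matrix_mult_nth: "(A ** B) $ i $ j = (\<Sum>k\<in>UNIV. A $ i $ k * B $ k $ j)"
  by (simp add: matrix_matrix_mult_def)

text \<open>A Hermitian matrix is described by its eigenvalues and rank-one spectral projections rather than by
a diagonalising unitary matrix: the projections are determined by the matrix as soon as the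
eigenvalues are distinct, whereas the unitary matrix is only determined up to phases. All
projections are collected in one vector, so that they range over a Euclidean space.\<close>

definition resolution :: "complex^'p^'p \<Rightarrow> real^'p \<Rightarrow> complex^'p^'p^'p \<Rightarrow> bool" where
  "resolution S l P \<longleftrightarrow>
     (\<forall>k. conj_transpose (P $ k) = P $ k) \<and>
     (\<forall>i j. P $ i ** P $ j = (if i = j then P $ i else 0)) \<and>
     (\<Sum>k\<in>UNIV. P $ k) = mat 1 \<and> (\<forall>k. trace (P $ k) = 1) \<and>
     S = (\<Sum>k\<in>UNIV. l $ k *\<^sub>R P $ k)"

definition column_projections :: "complex^'p^'p \<Rightarrow> complex^'p^'p^'p" where
  "column_projections U = (\<chi> k i j. U $ i $ k * cnj (U $ j $ k))"

lemma mult_real_diag_nth: "(U ** real_diag d) $ i $ k = U $ i $ k * complex_of_real (d $ k)"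
proof -
  have "(U ** real_diag d) $ i $ k = (\<Sum>j\<in>UNIV. if j = k then U $ i $ k * complex_of_real (d $ k) else 0)"
    unfolding matrix_mult_nth real_diag_def by (intro sum.cong) auto
  then show ?thesis by simp
qed

lemma unitary_real_diag:
  "U ** real_diag d ** conj_transpose U = (\<Sum>k\<in>UNIV. d $ k *\<^sub>R column_projections U $ k)"
proof -
  have "(U ** real_diag d ** conj_transpose U) $ i $ j
      = (\<Sum>k\<in>UNIV. U $ i $ k * complex_of_real (d $ k) * cnj (U $ j $ k))" for i j
    by (subst matrix_mult_nth) (simp add: mult_real_diag_nth conj_transpose_nth)
  moreover have "(\<Sum>k\<in>UNIV. d $ k *\<^sub>R column_projections U $ k) $ i $ j
      = (\<Sum>k\<in>UNIV. U $ i $ k * complex_of_real (d $ k) * cnj (U $ j $ k))" for i j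
    by (simp add: column_projections_def) (simp add: scaleR_conv_of_real mult.commute mult.left_commute)
  ultimately show ?thesis by (simp only: vec_eq_iff) blast
qed

lemma resolution_column_projections:
  assumes U: "unitary U" and S: "S = U ** real_diag d ** conj_transpose U"
  shows "resolution S d (column_projections U)"
proof -
  have orth: "(\<Sum>k\<in>UNIV. cnj (U $ k $ i) * U $ k $ j) = (if i = j then 1 else 0)" for i j
  proof -
    have "(conj_transpose U ** U) $ i $ j = (if i = j then 1 else 0)"
      using U by (simp add: unitary_def mat_def)
    then show ?thesis by (simp add: matrix_mult_nth conj_transpose_nth)
  qed
  have orth': "(\<Sum>k\<in>UNIV. U $ i $ k * cnj (U $ j $ k)) = (if i = j then 1 else 0)" for i j
  proof -
    have "(U ** conj_transpose U) $ i $ j = (if i = j then 1 else 0)"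
      using U by (simp add: unitary_def mat_def)
    then show ?thesis by (simp add: matrix_mult_nth conj_transpose_nth)
  qed
  have "(column_projections U $ i ** column_projections U $ j) $ a $ b
       = (if i = j then column_projections U $ i else 0) $ a $ b" for i j a b
  proof -
    have "(column_projections U $ i ** column_projections U $ j) $ a $ b
      = U $ a $ i * cnj (U $ b $ j) * (\<Sum>k\<in>UNIV. cnj (U $ k $ i) * U $ k $ j)"
      by (simp add: matrix_mult_nth column_projections_def sum_distrib_left mult.assoc mult.left_commute mult.commute)
    also have "\<dots> = (if i = j then column_projections U $ i else 0) $ a $ b"
      by (subst orth) (simp add: column_projections_def)
    finally show ?thesis .
  qed
  then have 1: "column_projections U $ i ** column_projections U $ j
       = (if i = j then column_projections U $ i else 0)" for i j
    by (simp only: vec_eq_iff) blast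
  have 2: "trace (column_projections U $ k) = 1" for k
    using orth[of k k] by (simp add: trace_def column_projections_def mult.commute)
  have 3: "(\<Sum>k\<in>UNIV. column_projections U $ k) = mat 1"
    using orth' by (simp add: vec_eq_iff column_projections_def mat_def)
  have 4: "conj_transpose (column_projections U $ k) = column_projections U $ k" for k
    by (simp add: vec_eq_iff conj_transpose_nth column_projections_def mult.commute)
  show ?thesis
    unfolding resolution_def using 1 2 3 4 by (auto simp: S unitary_real_diag)
qed

type_synonym 'p rvec = "real^'p"
type_synonym ('p, 'm) cmat = "complex^'p^'m"

section \<open>The spectral theorem for Hermitian matrices\<close>

lemma quadratic_nonneg_imp_linear_coeff_0:
  fixes a b :: real
  assumes "\<And>t. 0 \<le> t * a + t\<^sup>2 * b"
  shows "a = 0"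
proof (rule ccontr)
  assume a: "a \<noteq> 0"
  define c where "c = \<bar>b\<bar> + 1"
  have c: "0 < c" "b < c" by (auto simp: c_def)
  have "(- a / c) * a + (- a / c)\<^sup>2 * b = (a\<^sup>2 / c\<^sup>2) * (b - c)"
    using c by (simp add: field_simps power2_eq_square)
  moreover have "(a\<^sup>2 / c\<^sup>2) * (b - c) < 0"
    using a c by (intro mult_pos_neg) auto
  ultimately show False using assms[of "- a / c"] by simp
qed

text \<open>A maximiser $x$ of the quadratic form on the unit sphere of $W$ is an eigenvector: for
$w = lx - Tx$ with $l = Tx\cdot x$, the nonnegative function $l|x+tw|^2 - T(x+tw)\cdot(x+tw)$ of
$t$ vanishes at $t = 0$, so its linear coefficient $2|w|^2$ is zero.\<close>

lemma self_adjoint_eigenvector: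
  fixes T :: "'a::euclidean_space \<Rightarrow> 'a"
  assumes T: "linear T" and adj: "\<And>x y. T x \<bullet> y = x \<bullet> T y"
    and W: "subspace W" and inv: "\<And>x. x \<in> W \<Longrightarrow> T x \<in> W" and nz: "\<exists>x\<in>W. x \<noteq> 0"
  obtains x l where "x \<in> W" "norm x = 1" "T x = l *\<^sub>R x"
proof -
  define K where "K = W \<inter> sphere 0 1"
  have contT: "continuous_on UNIV T" using T by (simp add: linear_continuous_on linear_conv_bounded_linear)
  have "compact K" unfolding K_def
    by (intro closed_Int_compact closed_subspace W compact_sphere)
  moreover have "K \<noteq> {}"
  proof -
    obtain x where "x \<in> W" "x \<noteq> 0" using nz by blast
    then have "x /\<^sub>R norm x \<in> K" unfolding K_def using W by (auto simp: subspace_scale)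
    then show ?thesis by blast
  qed
  moreover have "continuous_on K (\<lambda>x. T x \<bullet> x)"
    by (intro continuous_intros continuous_on_subset[OF contT]) auto
  ultimately obtain x where x: "x \<in> K" and max: "\<And>y. y \<in> K \<Longrightarrow> T y \<bullet> y \<le> T x \<bullet> x"
    using continuous_attains_sup[of K "\<lambda>x. T x \<bullet> x"] by blast
  define l where "l = T x \<bullet> x"
  have xW: "x \<in> W" "norm x = 1" "x \<bullet> x = 1" using x by (auto simp: K_def norm_eq_1)
  have le: "T y \<bullet> y \<le> l * (y \<bullet> y)" if "y \<in> W" for y
  proof (cases "y = 0")
    case True then show ?thesis using T by (simp add: linear_0)
  next
    case False
    define z where "z = y /\<^sub>R norm y"
    have z: "z \<in> K" using False that W by (auto simp: K_def z_def subspace_scale)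
    have y: "y = norm y *\<^sub>R z" using False by (simp add: z_def)
    have "T y \<bullet> y = (norm y)\<^sup>2 * (T z \<bullet> z)"
      by (subst (1 2) y) (simp add: linear_cmul[OF T] power2_eq_square)
    also have "\<dots> \<le> (norm y)\<^sup>2 * l" unfolding l_def by (intro mult_left_mono max z) auto
    finally show ?thesis by (simp add: power2_norm_eq_inner mult.commute)
  qed
  define w where "w = l *\<^sub>R x - T x"
  have wW: "w \<in> W" unfolding w_def by (intro subspace_diff subspace_scale W inv xW)
  have "2 * (w \<bullet> w) = 0"
  proof (rule quadratic_nonneg_imp_linear_coeff_0)
    fix t :: real
    have "T (x + t *\<^sub>R w) \<bullet> (x + t *\<^sub>R w) \<le> l * ((x + t *\<^sub>R w) \<bullet> (x + t *\<^sub>R w))"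
      by (intro le subspace_add subspace_scale W xW wW)
    then have "0 \<le> l * (1 + 2 * t * (x \<bullet> w) + t\<^sup>2 * (w \<bullet> w)) - (l + 2 * t * (T x \<bullet> w) + t\<^sup>2 * (T w \<bullet> w))"
      using adj[of w x] xW(3)
      by (simp add: linear_add[OF T] linear_cmul[OF T] inner_add_left inner_add_right l_def
          inner_commute power2_eq_square algebra_simps)
    also have "\<dots> = t * (2 * (w \<bullet> w)) + t\<^sup>2 * (l * (w \<bullet> w) - T w \<bullet> w)"
    proof -
      have e: "l * (x \<bullet> w) - T x \<bullet> w = w \<bullet> w" by (subst (3) w_def) (simp add: inner_diff_left)
      have "l * (1 + 2 * t * (x \<bullet> w) + t\<^sup>2 * (w \<bullet> w)) - (l + 2 * t * (T x \<bullet> w) + t\<^sup>2 * (T w \<bullet> w))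
          = t * (2 * (l * (x \<bullet> w) - T x \<bullet> w)) + t\<^sup>2 * (l * (w \<bullet> w) - T w \<bullet> w)"
        by (simp add: algebra_simps)
      then show ?thesis unfolding e .
    qed
    finally show "0 \<le> t * (2 * (w \<bullet> w)) + t\<^sup>2 * (l * (w \<bullet> w) - T w \<bullet> w)" .
  qed
  then have "T x = l *\<^sub>R x" by (simp add: w_def)
  then show ?thesis using that xW by blast
qed

text \<open>The Hermitian inner product, conjugate linear in the first argument; its real part is the real
inner product.\<close>

definition cdot :: "complex^'n \<Rightarrow> complex^'n \<Rightarrow> complex" where
  "cdot x y = (\<Sum>i\<in>UNIV. cnj (x $ i) * y $ i)"

lemma cdot_scaleR: "cdot (c *\<^sub>R x) y = c *\<^sub>R cdot x y" "cdot x (c *\<^sub>R y) = c *\<^sub>R cdot x y"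
  by (simp_all add: cdot_def scaleR_sum_right)

lemma cdot_add: "cdot x (y + z) = cdot x y + cdot x z"
  by (simp add: cdot_def distrib_left sum.distrib)

lemma cdot_commute: "cdot y x = cnj (cdot x y)"
  by (simp add: cdot_def mult.commute)

lemma cdot_self: "cdot x x = complex_of_real ((norm x)\<^sup>2)"
  by (simp add: cdot_def norm_vec_def L2_set_def sum_nonneg complex_norm_square mult.commute del: of_real_power)

lemma inner_eq_cdot: "x \<bullet> y = Re (cdot x y)"
  by (simp add: inner_vec_def cdot_def inner_complex_def)

lemma cdot_matrix_vector: "cdot x (A *v y) = cdot (conj_transpose A *v x) y"
proof -
  have "cdot x (A *v y) = (\<Sum>i\<in>UNIV. \<Sum>j\<in>UNIV. cnj (x $ i) * (A $ i $ j * y $ j))"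
    by (simp add: cdot_def matrix_vector_mult_def sum_distrib_left)
  also have "\<dots> = (\<Sum>j\<in>UNIV. \<Sum>i\<in>UNIV. cnj (x $ i) * (A $ i $ j * y $ j))"
    by (rule sum.swap)
  also have "\<dots> = cdot (conj_transpose A *v x) y"
    by (simp add: cdot_def matrix_vector_mult_def sum_distrib_right sum_distrib_left conj_transpose_nth mult.assoc mult.left_commute)
  finally show ?thesis .
qed

text \<open>Induction on the index set $K$: the orthogonal complement of the eigenvectors found so far is an
invariant subspace. It is nonzero because it contains the kernel of a square matrix with a zero row.\<close>

lemma hermitian_orthonormal_eigenvectors:
  fixes A :: "complex^'n^'n" and K :: "'n::finite set"
  assumes A: "conj_transpose A = A"
  shows "\<exists>u d. (\<forall>k\<in>K. A *v u k = (d k :: real) *\<^sub>R u k) \<and> (\<forall>i\<in>K. \<forall>j\<in>K. cdot (u i) (u j) = (if i = j then 1 else 0))"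
  using finite[of K]
proof (induction K rule: finite_induct)
  case empty
  show ?case by simp
next
  case (insert k K)
  obtain u and d :: "'n \<Rightarrow> real" where u: "\<And>k. k \<in> K \<Longrightarrow> A *v u k = d k *\<^sub>R u k"
    and orth: "\<And>i j. i \<in> K \<Longrightarrow> j \<in> K \<Longrightarrow> cdot (u i) (u j) = (if i = j then 1 else 0)"
    using insert.IH by blast
  define W where "W = {x. \<forall>i\<in>K. cdot (u i) x = 0}"
  define B :: "complex^'n^'n" where "B = (\<chi> i j. if i \<in> K then cnj (u i $ j) else 0)"
  have "row k B = 0" using insert.hyps(2) by (simp add: B_def row_def vec_eq_iff)
  then have "det B = 0" by (rule det_zero_row)
  then have "\<not> invertible B" by (simp add: invertible_det_nz)
  then have "\<not> inj ((*v) B)"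
    by (metis invertible_left_inverse matrix_left_invertible_injective)
  then obtain x0 where x0: "x0 \<noteq> 0" "B *v x0 = 0"
    by (metis (no_types, lifting) injI matrix_vector_mult_diff_distrib right_minus_eq)
  have "cdot (u i) x0 = 0" if "i \<in> K" for i
  proof -
    have "(B *v x0) $ i = 0" using x0 by simp
    then show ?thesis using that by (simp add: B_def cdot_def matrix_vector_mult_def)
  qed
  then have x0W: "x0 \<in> W" by (simp add: W_def)
  have sub: "subspace W" unfolding W_def
    by (auto intro!: subspaceI simp: cdot_add cdot_scaleR) (simp add: cdot_def)
  have inv: "A *v x \<in> W" if "x \<in> W" for x
    using that u by (simp add: W_def cdot_matrix_vector A cdot_scaleR)
  have adj: "(A *v x) \<bullet> y = x \<bullet> (A *v y)" for x y
    by (simp add: inner_eq_cdot cdot_matrix_vector A)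
  obtain x l where x: "x \<in> W" "norm x = 1" "A *v x = l *\<^sub>R x"
    by (rule self_adjoint_eigenvector[of "(*v) A" W])
       (use sub inv adj x0W x0 in auto)
  have "cdot x x = 1" using x by (simp add: cdot_self)
  moreover have "cdot (u i) x = 0" "cdot x (u i) = 0" if "i \<in> K" for i
    using x that cdot_commute[of x "u i"] by (auto simp: W_def)
  moreover have "i \<noteq> k" if "i \<in> K" for i using insert.hyps(2) that by blast
  ultimately show ?case
    using u orth x
    by (intro exI[of _ "u(k := x)"] exI[of _ "d(k := l)"]) auto
qed

text \<open>The position of an index, counted from 0; it turns the ordered index type into an initial segment of
the natural numbers.\<close>

definition rank_of :: "'p::{finite,linorder} \<Rightarrow> nat" where
  "rank_of k = card {j. j < k}"

lemma rank_of_strict_mono: "i < j \<Longrightarrow> rank_of i < rank_of j"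
  unfolding rank_of_def by (intro psubset_card_mono) auto

lemma inj_rank_of: "inj rank_of"
  by (metis injI less_irrefl linorder_neqE rank_of_strict_mono)

lemma rank_of_less_CARD: "rank_of (k::'p::{finite,linorder}) < CARD('p)"
  unfolding rank_of_def by (intro psubset_card_mono) auto

lemma bij_rank_of: "bij_betw (rank_of :: 'p::{finite,linorder} \<Rightarrow> nat) UNIV {..<CARD('p)}"
proof -
  have "rank_of ` (UNIV::'p set) = {..<CARD('p)}"
    by (intro card_subset_eq) (auto simp: rank_of_less_CARD card_image inj_rank_of)
  then show ?thesis by (simp add: bij_betw_def inj_rank_of)
qed

lemma ex_sorting_permutation:
  fixes d :: "'p::{finite,linorder} \<Rightarrow> real"
  shows "\<exists>\<sigma> :: 'p \<Rightarrow> 'p. bij \<sigma> \<and> (\<forall>i j. i < j \<longrightarrow> d (\<sigma> j) \<le> d (\<sigma> i))"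
proof -
  define ys where "ys = sort_key (\<lambda>k. - d k) (sorted_list_of_set (UNIV :: 'p set))"
  have ys: "distinct ys" "set ys = UNIV" "length ys = CARD('p)" by (auto simp: ys_def)
  have so: "sorted (map (\<lambda>k. - d k) ys)" by (simp add: ys_def)
  have nth: "bij_betw (\<lambda>n. ys ! n) {..<CARD('p)} UNIV"
    using bij_betw_nth[of ys "{..<CARD('p)}" UNIV] ys by simp
  then have "bij (\<lambda>k::'p. ys ! rank_of k)"
    using bij_betw_trans[OF bij_rank_of[where 'p='p] nth] by (simp add: o_def)
  moreover have "d (ys ! rank_of j) \<le> d (ys ! rank_of i)" if "i < j" for i j :: 'p
    using sorted_nth_mono[OF so, of "rank_of i" "rank_of j"] rank_of_strict_mono[OF that]
      rank_of_less_CARD[of i] rank_of_less_CARD[of j] ys(3)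
    by simp
  ultimately show ?thesis by blast
qed

lemma hermitian_spectral_decomposition:
  fixes S :: "('p::{finite,linorder},'p) cmat"
  assumes S: "conj_transpose S = S"
  shows "\<exists>U l. unitary U \<and> (\<forall>i j. i < j \<longrightarrow> l $ j \<le> l $ i) \<and> S = U ** real_diag l ** conj_transpose U"
proof -
  obtain u and d :: "'p \<Rightarrow> real" where u: "\<And>k. S *v u k = d k *\<^sub>R u k"
    and orth: "\<And>i j. cdot (u i) (u j) = (if i = j then 1 else 0)"
    using hermitian_orthonormal_eigenvectors[OF S, of UNIV] by auto
  obtain \<sigma> :: "'p \<Rightarrow> 'p" where \<sigma>: "bij \<sigma>" "\<And>i j. i < j \<Longrightarrow> d (\<sigma> j) \<le> d (\<sigma> i)"
    using ex_sorting_permutation[of d] by blast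
  define U :: "('p,'p) cmat" where "U = (\<chi> i k. u (\<sigma> k) $ i)"
  define l :: "'p rvec" where "l = (\<chi> k. d (\<sigma> k))"
  have 1: "conj_transpose U ** U = mat 1"
    using orth \<sigma>(1)
    by (simp add: vec_eq_iff mat_def matrix_mult_nth conj_transpose_nth U_def cdot_def[symmetric] bij_is_inj inj_eq)
  then have 2: "U ** conj_transpose U = mat 1" by (simp add: matrix_left_right_inverse)
  have "(S ** U) $ i $ k = (U ** real_diag l) $ i $ k" for i k
  proof -
    have "(S ** U) $ i $ k = (S *v u (\<sigma> k)) $ i"
      by (simp add: matrix_mult_nth matrix_vector_mult_def U_def)
    also have "\<dots> = (U ** real_diag l) $ i $ k"
      unfolding u mult_real_diag_nth by (simp add: U_def l_def) (simp add: scaleR_conv_of_real mult.commute)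
    finally show ?thesis .
  qed
  then have "S ** U = U ** real_diag l" by (simp add: vec_eq_iff)
  then have "S = U ** real_diag l ** conj_transpose U"
    using 2 by (metis matrix_mul_assoc matrix_mul_rid)
  then show ?thesis using 1 2 \<sigma>(2) by (intro exI[of _ U] exI[of _ l]) (simp add: unitary_def l_def)
qed

section \<open>Uniqueness and continuity of spectral resolutions\<close>

lemma resolutionD:
  assumes "resolution S l P"
  shows "conj_transpose (P $ k) = P $ k" "P $ i ** P $ j = (if i = j then P $ i else 0)"
    "(\<Sum>k\<in>UNIV. P $ k) = mat 1" "trace (P $ k) = 1" "S = (\<Sum>k\<in>UNIV. l $ k *\<^sub>R P $ k)"
  using assms by (auto simp: resolution_def)

lemma resolution_eigen:
  assumes "resolution S l P"
  shows "S ** P $ k = l $ k *\<^sub>R P $ k" "P $ k ** S = l $ k *\<^sub>R P $ k"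
proof -
  show "S ** P $ k = l $ k *\<^sub>R P $ k"
    by (simp add: resolutionD(5)[OF assms] matrix_mult.sum_left matrix_mult.scaleR_left
        resolutionD(2)[OF assms] if_distrib cong: if_cong)
  show "P $ k ** S = l $ k *\<^sub>R P $ k"
    by (simp add: resolutionD(5)[OF assms] matrix_mult.sum_right matrix_mult.scaleR_right
        resolutionD(2)[OF assms] if_distrib cong: if_cong)
qed

lemma resolution_eigenvalue: "resolution S l P \<Longrightarrow> l $ k = P $ k \<bullet> S"
  by (simp add: inner_eq_trace resolutionD resolution_eigen trace_scaleR)

lemma norm_resolution: "resolution S l P \<Longrightarrow> norm (P $ k) = 1"
proof -
  assume P: "resolution S l P"
  have "(norm (P $ k))\<^sup>2 = 1" unfolding norm_power2_eq_trace resolutionD(1)[OF P] resolutionD(2)[OF P]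
    by (simp add: resolutionD(4)[OF P])
  then show ?thesis by (simp add: power2_eq_1_iff) (smt (verit) norm_ge_zero)
qed

lemma strict_mono_bij_eq_id:
  fixes \<sigma> :: "'p::{finite,linorder} \<Rightarrow> 'p"
  assumes "bij \<sigma>" "\<And>i j. i < j \<Longrightarrow> \<sigma> i < \<sigma> j"
  shows "\<sigma> k = k"
proof -
  have "{j. j < \<sigma> k} = \<sigma> ` {j. j < k}"
  proof safe
    fix j assume j: "j < \<sigma> k"
    obtain i where i: "j = \<sigma> i" using assms(1) by (metis bij_pointE)
    then have "i < k" using assms(2) j by (metis less_asym less_irrefl linorder_less_linear)
    then show "j \<in> \<sigma> ` {j. j < k}" using i by blast
  qed (use assms(2) in auto)
  then have "rank_of (\<sigma> k) = rank_of k"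
    unfolding rank_of_def using card_image[OF inj_on_subset[OF bij_is_inj[OF assms(1)] subset_UNIV]] by metis
  then show ?thesis by (rule injD[OF inj_rank_of])
qed

text \<open>Since $(l_j - l'_k)P_jQ_k = 0$, each $Q_k$ meets exactly one $P_j$, and $j = \sigma(k)$ defines a
permutation with $l' = l \circ \sigma$. As $l$ is strictly and $l'$ weakly decreasing, $\sigma$ is
monotone and therefore the identity. The weak monotonicity of $l'$ is what limits of
strictly decreasing spectra provide.\<close>

lemma resolution_unique:
  fixes l l' :: "'p::{finite,linorder} rvec"
  assumes P: "resolution S l P" and Q: "resolution S l' Q"
    and l: "\<And>i j. i < j \<Longrightarrow> l $ j < l $ i" and l': "\<And>i j. i < j \<Longrightarrow> l' $ j \<le> l' $ i"
  shows "l' = l" "Q = P"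
proof -
  have PQ: "l $ j *\<^sub>R (P $ j ** Q $ k) = l' $ k *\<^sub>R (P $ j ** Q $ k)" for j k
  proof -
    have "l $ j *\<^sub>R (P $ j ** Q $ k) = (P $ j ** S) ** Q $ k"
      by (simp add: resolution_eigen(2)[OF P] matrix_mult.scaleR_left)
    also have "\<dots> = P $ j ** (S ** Q $ k)" by (simp add: matrix_mul_assoc)
    also have "\<dots> = l' $ k *\<^sub>R (P $ j ** Q $ k)"
      by (simp add: resolution_eigen(1)[OF Q] matrix_mult.scaleR_right)
    finally show ?thesis .
  qed
  have Qsum: "Q $ k = (\<Sum>j\<in>UNIV. P $ j ** Q $ k)" for k
    using resolutionD(3)[OF P] by (simp flip: matrix_mult.sum_left)
  have Psum: "P $ j = (\<Sum>k\<in>UNIV. P $ j ** Q $ k)" for j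
    using resolutionD(3)[OF Q] by (simp flip: matrix_mult.sum_right)
  have nz: "P $ k \<noteq> 0" "Q $ k \<noteq> 0" for k
    using norm_resolution[OF P, of k] norm_resolution[OF Q, of k] by auto
  have "\<exists>j. P $ j ** Q $ k \<noteq> 0" for k
    using Qsum[of k] nz(2)[of k] by (metis sum.neutral)
  then obtain \<sigma> where \<sigma>: "\<And>k. P $ \<sigma> k ** Q $ k \<noteq> 0" by metis
  have ev: "l $ \<sigma> k = l' $ k" for k
    using PQ[of "\<sigma> k" k] \<sigma>[of k] by simp
  have inj_l: "l $ i = l $ j \<Longrightarrow> i = j" for i j
    using l[of i j] l[of j i] by (cases i j rule: linorder_cases) auto
  have zero: "P $ j ** Q $ k = 0" if "j \<noteq> \<sigma> k" for j k
    using PQ[of j k] ev[of k] inj_l[of j "\<sigma> k"] that by auto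
  have "\<exists>k. j = \<sigma> k" for j
    using Psum[of j] nz(1)[of j] zero[of j] by (metis sum.neutral)
  then have bij: "bij \<sigma>" by (metis finite_UNIV_surj_inj finite bij_def surjI surj_def)
  have "\<sigma> i < \<sigma> j" if "i < j" for i j
  proof -
    have "l $ \<sigma> j \<le> l $ \<sigma> i" using l'[OF that] ev by simp
    then have "\<not> \<sigma> j < \<sigma> i" using l[of "\<sigma> j" "\<sigma> i"] by auto
    moreover have "\<sigma> i \<noteq> \<sigma> j" using bij that by (metis bij_is_inj injD less_irrefl)
    ultimately show ?thesis by simp
  qed
  then have id: "\<sigma> k = k" for k using strict_mono_bij_eq_id[OF bij] by blast
  show "l' = l" using ev id by (simp add: vec_eq_iff)
  have "Q $ k = P $ k" for k
  proof -
    have "Q $ k = (\<Sum>j\<in>UNIV. if j = k then P $ k ** Q $ k else 0)"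
      by (subst Qsum) (intro sum.cong, auto simp: zero id)
    moreover have "P $ k = (\<Sum>j\<in>UNIV. if j = k then P $ k ** Q $ k else 0)"
      by (subst Psum) (intro sum.cong, auto simp: zero id)
    ultimately show ?thesis by simp
  qed
  then show "Q = P" by (simp add: vec_eq_iff)
qed

lemma norm_vec_le_sum: "norm (x :: 'a::real_normed_vector^'n) \<le> (\<Sum>i\<in>UNIV. norm (x $ i))"
  unfolding norm_vec_def by (rule L2_set_le_sum) auto

lemma tendsto_matrix_mult [tendsto_intros]:
  fixes f :: "_ \<Rightarrow> complex^'n^'m" and g :: "_ \<Rightarrow> complex^'k^'n"
  shows "(f \<longlongrightarrow> a) F \<Longrightarrow> (g \<longlongrightarrow> b) F \<Longrightarrow> ((\<lambda>x. f x ** g x) \<longlongrightarrow> a ** b) F"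
  by (rule matrix_mult.tendsto)

lemma tendsto_conj_transpose [tendsto_intros]:
  "(f \<longlongrightarrow> a) F \<Longrightarrow> ((\<lambda>x. conj_transpose (f x)) \<longlongrightarrow> conj_transpose a) F"
  by (rule bounded_linear.tendsto[OF bounded_linear_conj_transpose])

lemma tendsto_trace [tendsto_intros]:
  fixes f :: "_ \<Rightarrow> complex^'n^'n"
  shows "(f \<longlongrightarrow> a) F \<Longrightarrow> ((\<lambda>x. trace (f x)) \<longlongrightarrow> trace a) F"
  by (rule bounded_linear.tendsto[OF bounded_linear_trace])

text \<open>Eigenvalues are bounded by the norm of the matrix and projections have norm 1, and all
defining equations pass to the limit.\<close>

lemma resolution_compact:
  fixes S :: "nat \<Rightarrow> complex^'p^'p"
  assumes S: "S \<longlonglongrightarrow> S0" and P: "\<And>n. resolution (S n) (l n) (P n)"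
  shows "\<exists>r l0 P0. strict_mono r \<and> (\<lambda>n. l (r n)) \<longlonglongrightarrow> l0 \<and> (\<lambda>n. P (r n)) \<longlonglongrightarrow> P0 \<and> resolution S0 l0 P0"
proof -
  have "Bseq S" using S by (simp add: convergent_imp_Bseq convergentI)
  then obtain B where B: "\<And>n. norm (S n) \<le> B" by (auto simp: Bseq_def)
  have "norm (l n) \<le> real CARD('p) * B" for n
  proof -
    have "norm (l n) \<le> (\<Sum>k\<in>UNIV. norm (l n $ k))" by (rule norm_vec_le_sum)
    also have "\<dots> \<le> (\<Sum>k\<in>(UNIV::'p set). B)"
    proof (intro sum_mono)
      fix k
      have "norm (l n $ k) \<le> norm (P n $ k) * norm (S n)"
        unfolding resolution_eigenvalue[OF P] real_norm_def by (rule Cauchy_Schwarz_ineq2)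
      also have "\<dots> \<le> B" using B[of n] by (simp add: norm_resolution[OF P])
      finally show "norm (l n $ k) \<le> B" .
    qed
    finally show ?thesis by simp
  qed
  moreover have "norm (P n) \<le> real CARD('p)" for n
    using norm_vec_le_sum[of "P n"] by (simp add: norm_resolution[OF P])
  ultimately have "norm (l n, P n) \<le> real CARD('p) * B + real CARD('p)" for n
    using norm_Pair_le[of "l n" "P n"] by (meson add_mono order_trans)
  then have "bounded (range (\<lambda>n. (l n, P n)))" unfolding bounded_iff by blast
  then obtain lP r where r: "strict_mono r" "((\<lambda>n. (l n, P n)) \<circ> r) \<longlonglongrightarrow> lP"
    using bounded_imp_convergent_subsequence by blast
  define l0 P0 where "l0 = fst lP" and "P0 = snd lP"
  have l0: "(\<lambda>n. l (r n)) \<longlonglongrightarrow> l0" and P0: "(\<lambda>n. P (r n)) \<longlonglongrightarrow> P0"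
    using tendsto_fst[OF r(2)] tendsto_snd[OF r(2)] by (simp_all add: o_def l0_def P0_def)
  have S0: "(\<lambda>n. S (r n)) \<longlonglongrightarrow> S0" using LIMSEQ_subseq_LIMSEQ[OF S r(1)] by (simp add: o_def)
  have "resolution S0 l0 P0"
    unfolding resolution_def
  proof (intro conjI allI)
    fix i j k
    show "conj_transpose (P0 $ k) = P0 $ k"
      by (rule LIMSEQ_unique[of "\<lambda>n. conj_transpose (P (r n) $ k)"])
         (intro tendsto_intros P0, use tendsto_vec_nth[OF P0, of k] in \<open>simp add: resolutionD(1)[OF P]\<close>)
    have "(\<lambda>n. P (r n) $ i ** P (r n) $ j) \<longlonglongrightarrow> P0 $ i ** P0 $ j"
      by (intro tendsto_intros P0)
    then show "P0 $ i ** P0 $ j = (if i = j then P0 $ i else 0)"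
      by (rule LIMSEQ_unique) (use tendsto_vec_nth[OF P0, of i] in \<open>cases "i = j"; simp add: resolutionD(2)[OF P]\<close>)
    have "(\<lambda>n. \<Sum>k\<in>UNIV. P (r n) $ k) \<longlonglongrightarrow> (\<Sum>k\<in>UNIV. P0 $ k)"
      by (intro tendsto_intros P0)
    then show "(\<Sum>k\<in>UNIV. P0 $ k) = mat 1"
      by (rule LIMSEQ_unique) (simp add: resolutionD(3)[OF P])
    have "(\<lambda>n. trace (P (r n) $ k)) \<longlonglongrightarrow> trace (P0 $ k)"
      by (intro tendsto_intros P0)
    then show "trace (P0 $ k) = 1"
      by (rule LIMSEQ_unique) (simp add: resolutionD(4)[OF P])
    have "(\<lambda>n. \<Sum>k\<in>UNIV. l (r n) $ k *\<^sub>R P (r n) $ k) \<longlonglongrightarrow> (\<Sum>k\<in>UNIV. l0 $ k *\<^sub>R P0 $ k)"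
      by (intro tendsto_intros P0 l0)
    then show "S0 = (\<Sum>k\<in>UNIV. l0 $ k *\<^sub>R P0 $ k)"
      by (subst LIMSEQ_unique[OF S0]) (auto simp flip: resolutionD(5)[OF P])
  qed
  with r(1) l0 P0 show ?thesis by blast
qed

definition gram :: "complex^'p^'m \<Rightarrow> complex^'p^'p" where
  "gram z = conj_transpose z ** z"

lemma hermitian_gram: "conj_transpose (gram z) = gram z"
  by (simp add: gram_def conj_transpose_mult)

text \<open>Weakly decreasing eigenvalues and projections are chosen for every matrix, so that they are defined
near every point at which continuity and differentiability are to be shown. Where the eigenvalues are
distinct, \<open>resolution_unique\<close> makes the choice canonical.\<close>

definition eigendata :: "('p::{finite,linorder},'m::finite) cmat \<Rightarrow> ('p rvec) \<times> ((('p,'p) cmat,'p) vec)" where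
  "eigendata z = (SOME (l, P). (\<forall>i j. i < j \<longrightarrow> l $ j \<le> l $ i) \<and> resolution (gram z) l P)"

definition eigenvalues :: "('p::{finite,linorder},'m::finite) cmat \<Rightarrow> 'p rvec" where
  "eigenvalues z = fst (eigendata z)"

definition projections :: "('p::{finite,linorder},'m::finite) cmat \<Rightarrow> (('p,'p) cmat,'p) vec" where
  "projections z = snd (eigendata z)"

lemma eigenvalues_decreasing: "i < j \<Longrightarrow> eigenvalues z $ j \<le> eigenvalues z $ i"
  and resolution_gram: "resolution (gram z) (eigenvalues z) (projections z)"
proof -
  obtain U l where "unitary U" "\<forall>i j. i < j \<longrightarrow> l $ j \<le> l $ i" "gram z = U ** real_diag l ** conj_transpose U"
    using hermitian_spectral_decomposition[OF hermitian_gram, of z] by blast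
  then have "\<exists>lP. (case lP of (l, P) \<Rightarrow> (\<forall>i j. i < j \<longrightarrow> l $ j \<le> l $ i) \<and> resolution (gram z) l P)"
    using resolution_column_projections by fastforce
  from someI_ex[OF this] have *: "case eigendata z of (l, P) \<Rightarrow> (\<forall>i j. i < j \<longrightarrow> l $ j \<le> l $ i) \<and> resolution (gram z) l P"
    by (simp add: eigendata_def)
  then show "i < j \<Longrightarrow> eigenvalues z $ j \<le> eigenvalues z $ i"
    and "resolution (gram z) (eigenvalues z) (projections z)"
    by (auto simp: eigenvalues_def projections_def split: prod.splits)
qed

definition regular :: "(('p::{finite,linorder},'m::finite) cmat) set" where
  "regular = {z. eigenvalues z \<in> decreasing_positive}"

lemma eigendata_unique:
  assumes "resolution (gram z) l P" "l \<in> decreasing_positive"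
  shows "eigenvalues z = l" "projections z = P" "z \<in> regular"
  using resolution_unique[OF assms(1) resolution_gram[of z]] assms(2) eigenvalues_decreasing[of _ _ z]
  by (auto simp: decreasing_positive_def regular_def)

lemma is_spectral_decompD:
  assumes "is_spectral_decomp z U l"
  shows "eigenvalues z = l" "projections z = column_projections U" "z \<in> regular"
proof -
  have "resolution (gram z) l (column_projections U)"
    using assms by (intro resolution_column_projections) (auto simp: is_spectral_decomp_def gram_def)
  then show "eigenvalues z = l" "projections z = column_projections U" "z \<in> regular"
    using eigendata_unique[of z l] assms by (auto simp: is_spectral_decomp_def)
qed

lemma regular_iff: "z \<in> regular \<longleftrightarrow> (\<exists>U l. is_spectral_decomp z U l)"
proof
  assume z: "z \<in> regular"
  obtain U l where U: "unitary U" "\<forall>i j. i < j \<longrightarrow> l $ j \<le> l $ i" "gram z = U ** real_diag l ** conj_transpose U"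
    using hermitian_spectral_decomposition[OF hermitian_gram, of z] by blast
  have "l = eigenvalues z"
    using resolution_unique(1)[OF resolution_gram resolution_column_projections[OF U(1,3)]] z U(2)
    by (auto simp: regular_def decreasing_positive_def)
  then show "\<exists>U l. is_spectral_decomp z U l"
    using U z by (auto simp: is_spectral_decomp_def regular_def gram_def)
qed (use is_spectral_decompD in blast)

lemma open_decreasing_positive: "open (decreasing_positive :: ('p::{finite,linorder} rvec) set)"
proof -
  have eq: "(decreasing_positive :: ('p rvec) set)
      = (\<Inter>i. \<Inter>j. {l. i < j \<longrightarrow> l $ j < l $ i}) \<inter> (\<Inter>i. {l. 0 < l $ i})"
    by (auto simp: decreasing_positive_def)
  have "open {l :: 'p rvec. i < j \<longrightarrow> l $ j < l $ i}" for i j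
    by (cases "i < j") (auto intro!: open_Collect_less continuous_intros)
  moreover have "open {l :: 'p rvec. 0 < l $ i}" for i
    by (intro open_Collect_less continuous_intros)
  ultimately show ?thesis unfolding eq by (intro open_Int open_INT finite ballI)
qed

lemma tendsto_gram:
  fixes z :: "complex^'p^'m"
  shows "(f \<longlongrightarrow> z) F \<Longrightarrow> ((\<lambda>x. gram (f x)) \<longlongrightarrow> gram z) F"
  unfolding gram_def by (intro tendsto_intros)

text \<open>By compactness, every sequence tending to $z$ has a subsequence along which the data converge to
some resolution of the Gram matrix of $z$; by uniqueness the limit is the resolution at $z$.\<close>

lemma eigendata_continuous:
  assumes z: "z \<in> regular"
  shows "isCont (\<lambda>z. (eigenvalues z, projections z)) z"
  unfolding isCont_def tendsto_at_iff_sequentially o_def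
proof (intro allI impI)
  fix X assume "\<forall>i. X i \<in> UNIV - {z}" "X \<longlonglongrightarrow> z"
  show "(\<lambda>n. (eigenvalues (X n), projections (X n))) \<longlonglongrightarrow> (eigenvalues z, projections z)"
  proof (rule ccontr)
    assume "\<not> (\<lambda>n. (eigenvalues (X n), projections (X n))) \<longlonglongrightarrow> (eigenvalues z, projections z)"
    then obtain e where e: "e > 0" "\<exists>\<^sub>F n in sequentially. dist (eigenvalues (X n), projections (X n)) (eigenvalues z, projections z) \<ge> e"
      by (auto simp: tendsto_iff not_eventually not_less)
    then have "infinite {n. dist (eigenvalues (X n), projections (X n)) (eigenvalues z, projections z) \<ge> e}"
      by (simp add: INFM_iff_infinite cofinite_eq_sequentially[symmetric])
    then obtain s :: "nat \<Rightarrow> nat" where s: "strict_mono s"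
      "\<And>n. dist (eigenvalues (X (s n)), projections (X (s n))) (eigenvalues z, projections z) \<ge> e"
      by (metis (mono_tags, lifting) infinite_enumerate mem_Collect_eq)
    have "(\<lambda>n. gram (X (s n))) \<longlonglongrightarrow> gram z"
      using LIMSEQ_subseq_LIMSEQ[OF \<open>X \<longlonglongrightarrow> z\<close> s(1)] by (intro tendsto_gram) (simp add: o_def)
    from resolution_compact[OF this resolution_gram] obtain r l0 P0 where r: "strict_mono r"
      "(\<lambda>n. eigenvalues (X (s (r n)))) \<longlonglongrightarrow> l0" "(\<lambda>n. projections (X (s (r n)))) \<longlonglongrightarrow> P0" "resolution (gram z) l0 P0"
      by auto
    have "l0 $ j \<le> l0 $ i" if "i < j" for i j
      by (rule LIMSEQ_le[OF tendsto_vec_nth[OF r(2)] tendsto_vec_nth[OF r(2)]])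
         (auto intro: eigenvalues_decreasing that)
    then have eq: "l0 = eigenvalues z" "P0 = projections z"
      using resolution_unique[OF resolution_gram r(4)] z by (auto simp: regular_def decreasing_positive_def)
    have "(\<lambda>n. dist (eigenvalues (X (s (r n))), projections (X (s (r n)))) (eigenvalues z, projections z)) \<longlonglongrightarrow> dist (l0, P0) (eigenvalues z, projections z)"
      by (intro tendsto_intros r)
    then have "e \<le> dist (l0, P0) (eigenvalues z, projections z)"
      by (rule LIMSEQ_le_const) (use s in auto)
    then show False using e eq by simp
  qed
qed

lemma isCont_eigenvalues: "z \<in> regular \<Longrightarrow> isCont eigenvalues z"
  and isCont_projections: "z \<in> regular \<Longrightarrow> isCont projections z"
  using isCont_fst[OF eigendata_continuous, of z] isCont_snd[OF eigendata_continuous, of z] by simp_all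

lemma open_regular: "open (regular :: (('p::{finite,linorder},'m::finite) cmat) set)"
proof (subst open_subopen, intro ballI)
  fix z :: "('p,'m) cmat" assume z: "z \<in> regular"
  have "\<forall>\<^sub>F y in nhds z. eigenvalues y \<in> decreasing_positive"
    using isCont_eigenvalues[OF z] open_decreasing_positive z
    by (intro topological_tendstoD[of eigenvalues "eigenvalues z"]) (auto simp: regular_def isCont_def filterlim_at_within_not_equal tendsto_at_iff_tendsto_nhds)
  then show "\<exists>T. open T \<and> z \<in> T \<and> T \<subseteq> regular"
    unfolding eventually_nhds regular_def by blast
qed

section \<open>Derivatives of eigenvalues and spectral projections\<close>

text \<open>A product rule in which one factor vanishes at $x$, so that the other factor is only required to be
continuous. It turns the exact increment formulas for eigenvalues and projections into derivatives.\<close>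

lemma has_derivative_bilinear_increment:
  assumes B: "bounded_bilinear B" and u: "(u has_derivative u') (at x)" and c: "isCont c x"
  shows "((\<lambda>y. B (u y - u x) (c y)) has_derivative (\<lambda>h. B (u' h) (c x))) (at x)"
  unfolding has_derivative_within_alt2
proof (intro conjI allI impI)
  interpret B: bounded_bilinear B by fact
  have u'_bl: "bounded_linear u'" using u by (rule has_derivative_bounded_linear)
  then show "bounded_linear (\<lambda>h. B (u' h) (c x))"
    by (rule bounded_linear_compose[OF B.bounded_linear_left])
  obtain K where K: "K > 0" "\<And>a b. norm (B a b) \<le> norm a * norm b * K"
    using B.pos_bounded by blast
  obtain M where M: "M > 0" "\<And>h. norm (u' h) \<le> norm h * M"
    using bounded_linear.pos_bounded[OF u'_bl] by blast
  fix e :: real assume e: "0 < e"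
  \<comment> \<open>The radii are chosen such that each of the two error terms below is at most half of the allowed one.\<close>
  define C where "C = norm (c x)"
  define d where "d = min 1 (e / (2 * K * (C + 1)))"
  define d' where "d' = min 1 (e / (2 * K * (M + 1)))"
  have C: "0 \<le> C" by (simp add: C_def)
  have d: "0 < d" "0 < d'" using e K M C by (auto simp: d_def d'_def intro!: divide_pos_pos mult_pos_pos)
  have ev1: "\<forall>\<^sub>F y in at x. norm (u y - u x - u' (y - x)) \<le> d * norm (y - x)"
    using u d unfolding has_derivative_within_alt2 by blast
  have "((\<lambda>y. norm (c y - c x)) \<longlongrightarrow> 0) (at x)"
    using c by (simp add: isCont_def tendsto_norm_zero_iff LIM_zero_iff)
  then have ev2: "\<forall>\<^sub>F y in at x. norm (c y - c x) < d'"
    using d(2) by (rule order_tendstoD)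
  show "\<forall>\<^sub>F y in at x. norm (B (u y - u x) (c y) - B (u x - u x) (c x) - B (u' (y - x)) (c x)) \<le> e * norm (y - x)"
    using ev1 ev2
  proof eventually_elim
    case (elim y)
    let ?n = "norm (y - x)"
    have "norm (u y - u x) \<le> norm (u y - u x - u' (y - x)) + norm (u' (y - x))"
      by (metis diff_add_cancel norm_triangle_ineq)
    also have "\<dots> \<le> d * ?n + ?n * M" using elim(1) M(2) by (intro add_mono)
    also have "\<dots> \<le> 1 * ?n + ?n * M" using M(1) by (intro add_mono mult_right_mono order_refl) (simp_all add: d_def)
    also have "\<dots> = (M + 1) * ?n" by (simp add: algebra_simps)
    finally have 1: "norm (u y - u x) \<le> (M + 1) * ?n" .
    have "B (u y - u x) (c y) - B (u x - u x) (c x) - B (u' (y - x)) (c x)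
        = B (u y - u x) (c y - c x) + B (u y - u x - u' (y - x)) (c x)"
      by (simp add: B.diff_left B.diff_right B.zero_left)
    also have "norm \<dots> \<le> norm (u y - u x) * norm (c y - c x) * K + norm (u y - u x - u' (y - x)) * C * K"
      unfolding C_def by (intro norm_triangle_le add_mono K)
    also have "\<dots> \<le> ((M + 1) * ?n) * d' * K + (d * ?n) * C * K"
      using 1 elim K M C by (intro add_mono mult_right_mono mult_mono) auto
    also have "\<dots> \<le> (e / 2) * ?n + (e / 2) * ?n"
    proof (rule add_mono)
      have "d' * (2 * K * (M + 1)) \<le> e" using K M by (simp add: d'_def min_le_iff_disj pos_le_divide_eq[symmetric])
      then have "(M + 1) * d' * K \<le> e / 2" by (simp add: algebra_simps)
      then have "((M + 1) * d' * K) * ?n \<le> e / 2 * ?n" by (rule mult_right_mono) simp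
      then show "((M + 1) * ?n) * d' * K \<le> (e / 2) * ?n" by (simp only: mult_ac)
      have "d * (2 * K * (C + 1)) \<le> e" using K C by (simp add: d_def min_le_iff_disj pos_le_divide_eq[symmetric])
      moreover have "d * (2 * K * C) \<le> d * (2 * K * (C + 1))" using d K C by (intro mult_left_mono) auto
      ultimately have "d * C * K \<le> e / 2" by (simp add: algebra_simps)
      then have "(d * C * K) * ?n \<le> e / 2 * ?n" by (rule mult_right_mono) simp
      then show "(d * ?n) * C * K \<le> (e / 2) * ?n" by (simp only: mult_ac)
    qed
    finally show ?case by simp
  qed
qed

definition gram_deriv :: "complex^'p^'m \<Rightarrow> complex^'p^'m \<Rightarrow> complex^'p^'p" where
  "gram_deriv z h = conj_transpose h ** z + conj_transpose z ** h"

lemma has_derivative_gram: "(gram has_derivative gram_deriv z) (at z)"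
proof -
  have "((\<lambda>z::complex^'a^'b. conj_transpose z ** z) has_derivative
      (\<lambda>h. conj_transpose z ** h + conj_transpose h ** z)) (at z)"
    by (intro bounded_bilinear.FDERIV[OF bounded_bilinear_matrix_mult] has_derivative_ident
        bounded_linear.has_derivative[OF bounded_linear_conj_transpose])
  then show ?thesis unfolding gram_def[abs_def] gram_deriv_def[abs_def] by (simp add: add.commute)
qed

lemma bounded_bilinear_left_mult:
  "bounded_bilinear (\<lambda>X Y. (P :: complex^'p^'p) ** X ** (Y :: complex^'p^'p))"
  using bounded_bilinear.comp1[OF bounded_bilinear_matrix_mult matrix_mult.bounded_linear_right[of P]] .

lemma resolution_cross:
  assumes "resolution S l P" "resolution S' l' P'"
  shows "P $ j ** (S' - S) ** P' $ k = (l' $ k - l $ j) *\<^sub>R (P $ j ** P' $ k)"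
proof -
  have "P $ j ** (S' - S) ** P' $ k = P $ j ** (S' ** P' $ k) - (P $ j ** S) ** P' $ k"
    by (simp add: matrix_mult.diff_right matrix_mult.diff_left matrix_mul_assoc)
  also have "\<dots> = (l' $ k - l $ j) *\<^sub>R (P $ j ** P' $ k)"
    by (simp add: resolution_eigen[OF assms(1)] resolution_eigen[OF assms(2)] scaleR_diff_left
        matrix_mult.scaleR_left matrix_mult.scaleR_right)
  finally show ?thesis .
qed

text \<open>$P'_k - P_k = \sum_j (P_jP'_k - P_kP'_j)$, and by \<open>resolution_cross\<close> the products on the right are
$S'-S$ times bounded factors.\<close>

lemma resolution_increment:
  assumes P: "resolution S l P" and P': "resolution S' l' P'"
    and ne: "\<And>j. j \<noteq> k \<Longrightarrow> l' $ k \<noteq> l $ j" "\<And>j. j \<noteq> k \<Longrightarrow> l' $ j \<noteq> l $ k"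
  shows "P' $ k - P $ k = (\<Sum>j\<in>UNIV - {k}.
      P $ j ** (S' - S) ** (P' $ k /\<^sub>R (l' $ k - l $ j)) - P $ k ** (S' - S) ** (P' $ j /\<^sub>R (l' $ j - l $ k)))"
proof -
  have "(\<Sum>j\<in>UNIV - {k}.
      P $ j ** (S' - S) ** (P' $ k /\<^sub>R (l' $ k - l $ j)) - P $ k ** (S' - S) ** (P' $ j /\<^sub>R (l' $ j - l $ k)))
    = (\<Sum>j\<in>UNIV - {k}. P $ j ** P' $ k - P $ k ** P' $ j)"
    using ne by (intro sum.cong refl) (simp add: matrix_mult.scaleR_right resolution_cross[OF P P'])
  also have "\<dots> = (\<Sum>j\<in>UNIV. P $ j ** P' $ k - P $ k ** P' $ j)"
    by (subst (2) sum.remove[of _ k]) auto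
  also have "\<dots> = (\<Sum>j\<in>UNIV. P $ j) ** P' $ k - P $ k ** (\<Sum>j\<in>UNIV. P' $ j)"
    by (simp add: sum_subtractf matrix_mult.sum_left matrix_mult.sum_right)
  also have "\<dots> = P' $ k - P $ k"
    by (simp add: resolutionD(3)[OF P] resolutionD(3)[OF P'])
  finally show ?thesis ..
qed

lemma decreasing_positive_inj: "l \<in> decreasing_positive \<Longrightarrow> l $ i = l $ j \<longleftrightarrow> i = j"
  by (cases i j rule: linorder_cases) (force simp: decreasing_positive_def)+

lemma isCont_eigenvalue: "z \<in> regular \<Longrightarrow> isCont (\<lambda>y. eigenvalues y $ k) z"
  using isCont_eigenvalues unfolding isCont_def by (rule tendsto_vec_nth)

lemma isCont_projection: "z \<in> regular \<Longrightarrow> isCont (\<lambda>y. projections y $ k) z"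
  using isCont_projections unfolding isCont_def by (rule tendsto_vec_nth)

text \<open>Taking traces in \<open>resolution_cross\<close> for $j = k$ gives
$\ell'_k - \ell_k = \mathrm{tr}(P_k(S'-S)P'_k)/\mathrm{tr}(P_kP'_k)$, where the denominator tends
to 1.\<close>

lemma has_derivative_eigenvalue:
  fixes z :: "('p::{finite,linorder},'m::finite) cmat"
  assumes z: "z \<in> regular"
  shows "((\<lambda>y. eigenvalues y $ k) has_derivative (\<lambda>h. projections z $ k \<bullet> gram_deriv z h)) (at z)"
proof -
  define P where "P = projections z $ k"
  define t where "t (y :: ('p,'m) cmat) = Re (trace (P ** projections y $ k))" for y
  note res = resolutionD(1-4)[OF resolution_gram]
  have bl: "bounded_linear (\<lambda>X::('p,'p) cmat. Re (trace X))"
    by (rule bounded_linear_compose[OF bounded_linear_Re bounded_linear_trace])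
  have tz: "t z = 1" unfolding t_def P_def by (simp add: res)
  have ct: "isCont t z" unfolding t_def
    by (intro bounded_linear.isCont[OF bl] bounded_bilinear.isCont[OF bounded_bilinear_matrix_mult] isCont_projection z continuous_const)
  have "((\<lambda>y. Re (trace (P ** (gram y - gram z) ** (projections y $ k /\<^sub>R t y)))) has_derivative
     (\<lambda>h. Re (trace (P ** gram_deriv z h ** (projections z $ k /\<^sub>R t z))))) (at z)"
    using tz ct by (intro bounded_linear.has_derivative[OF bl] has_derivative_bilinear_increment[OF bounded_bilinear_left_mult]
        has_derivative_gram continuous_intros isCont_projection z) auto
  then have "((\<lambda>y. eigenvalues z $ k + Re (trace (P ** (gram y - gram z) ** (projections y $ k /\<^sub>R t y)))) has_derivative
     (\<lambda>h. Re (trace (P ** gram_deriv z h ** (projections z $ k /\<^sub>R t z))))) (at z)"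
    by (intro has_derivative_eq_rhs[OF has_derivative_add[OF has_derivative_const]]) auto
  moreover have "Re (trace (P ** gram_deriv z h ** (projections z $ k /\<^sub>R t z))) = projections z $ k \<bullet> gram_deriv z h" for h
  proof -
    have "trace (P ** gram_deriv z h ** P) = trace (P ** (P ** gram_deriv z h))"
      by (rule trace_mul_sym)
    also have "\<dots> = trace (P ** gram_deriv z h)" by (simp add: matrix_mul_assoc P_def res(2))
    finally show ?thesis by (simp add: tz P_def inner_eq_trace res(1))
  qed
  ultimately have D: "((\<lambda>y. eigenvalues z $ k + Re (trace (P ** (gram y - gram z) ** (projections y $ k /\<^sub>R t y)))) has_derivative
     (\<lambda>h. projections z $ k \<bullet> gram_deriv z h)) (at z)" by simp
  show ?thesis
  proof (rule has_derivative_transform_eventually[OF D])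
    have eq: "eigenvalues z $ k + Re (trace (P ** (gram y - gram z) ** (projections y $ k /\<^sub>R t y))) = eigenvalues y $ k"
      if "t y \<noteq> 0" for y
    proof -
      have "P ** (gram y - gram z) ** (projections y $ k /\<^sub>R t y)
          = (inverse (t y) * (eigenvalues y $ k - eigenvalues z $ k)) *\<^sub>R (P ** projections y $ k)"
        unfolding P_def by (simp add: matrix_mult.scaleR_right resolution_cross[OF resolution_gram resolution_gram])
      then have "Re (trace (P ** (gram y - gram z) ** (projections y $ k /\<^sub>R t y)))
          = (inverse (t y) * (eigenvalues y $ k - eigenvalues z $ k)) * t y"
        by (simp add: trace_scaleR t_def)
      moreover have "inverse c * x * c = x" if "c \<noteq> 0" for c x :: real using that by simp
      ultimately show ?thesis using \<open>t y \<noteq> 0\<close> by simp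
    qed
    have "(t \<longlongrightarrow> 1) (at z)" using ct tz by (simp add: isCont_def)
    then have "\<forall>\<^sub>F y in at z. t y \<noteq> 0" by (rule tendsto_imp_eventually_ne) simp
    then show "\<forall>\<^sub>F y in at z. eigenvalues z $ k + Re (trace (P ** (gram y - gram z) ** (projections y $ k /\<^sub>R t y))) = eigenvalues y $ k"
      by eventually_elim (rule eq)
    show "eigenvalues z $ k + Re (trace (P ** (gram z - gram z) ** (projections z $ k /\<^sub>R t z))) = eigenvalues z $ k"
      by (rule eq) (simp add: tz)
  qed simp
qed

definition eigenvalues_deriv :: "('p::{finite,linorder},'m::finite) cmat \<Rightarrow> ('p,'m) cmat \<Rightarrow> 'p rvec" where
  "eigenvalues_deriv z h = (\<chi> k. projections z $ k \<bullet> gram_deriv z h)"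

lemma vec_eq_sum_axis: "x = (\<Sum>k\<in>UNIV. x $ k *\<^sub>R axis k (1::real))"
  by (simp add: vec_eq_iff axis_def if_distrib cong: if_cong)

lemma has_derivative_eigenvalues:
  fixes z :: "('p::{finite,linorder},'m::finite) cmat"
  assumes z: "z \<in> regular"
  shows "(eigenvalues has_derivative eigenvalues_deriv z) (at z)"
proof -
  have "((\<lambda>y. \<Sum>k\<in>UNIV. (eigenvalues y $ k) *\<^sub>R axis k (1::real)) has_derivative
     (\<lambda>h. \<Sum>k\<in>UNIV. (projections z $ k \<bullet> gram_deriv z h) *\<^sub>R axis k 1)) (at z)"
    by (intro has_derivative_sum has_derivative_scaleR_left has_derivative_eigenvalue z)
  moreover have "(\<Sum>k\<in>UNIV. (projections z $ k \<bullet> gram_deriv z h) *\<^sub>R axis k (1::real)) = eigenvalues_deriv z h" for h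
    by (subst vec_eq_sum_axis[of "eigenvalues_deriv z h"]) (simp add: eigenvalues_deriv_def)
  ultimately show ?thesis by (simp flip: vec_eq_sum_axis)
qed

definition projection_deriv :: "('p::{finite,linorder},'m::finite) cmat \<Rightarrow> 'p \<Rightarrow> ('p,'m) cmat \<Rightarrow> ('p,'p) cmat" where
  "projection_deriv z k h = (let P = projections z; l = eigenvalues z in
     \<Sum>j\<in>UNIV - {k}. (P $ j ** gram_deriv z h ** P $ k + P $ k ** gram_deriv z h ** P $ j) /\<^sub>R (l $ k - l $ j))"

lemma has_derivative_projection:
  fixes z :: "('p::{finite,linorder},'m::finite) cmat"
  assumes z: "z \<in> regular"
  shows "((\<lambda>y. projections y $ k) has_derivative projection_deriv z k) (at z)"
proof -
  define P where "P = projections z"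
  define l where "l = eigenvalues z"
  have inj: "l $ i = l $ j \<longleftrightarrow> i = j" for i j
    using z unfolding l_def by (intro decreasing_positive_inj) (simp add: regular_def)
  define F where "F (y :: ('p,'m) cmat) = (\<Sum>j\<in>UNIV - {k}.
      P $ j ** (gram y - gram z) ** (projections y $ k /\<^sub>R (eigenvalues y $ k - l $ j))
      - P $ k ** (gram y - gram z) ** (projections y $ j /\<^sub>R (eigenvalues y $ j - l $ k)))" for y
  have "(F has_derivative (\<lambda>h. \<Sum>j\<in>UNIV - {k}.
      P $ j ** gram_deriv z h ** (projections z $ k /\<^sub>R (eigenvalues z $ k - l $ j))
      - P $ k ** gram_deriv z h ** (projections z $ j /\<^sub>R (eigenvalues z $ j - l $ k)))) (at z)"
    unfolding F_def
    by (intro has_derivative_sum has_derivative_diff has_derivative_bilinear_increment[OF bounded_bilinear_left_mult]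
        has_derivative_gram continuous_intros isCont_projection isCont_eigenvalue z)
       (auto simp: inj simp flip: l_def)
  also have "(\<lambda>h. \<Sum>j\<in>UNIV - {k}.
      P $ j ** gram_deriv z h ** (projections z $ k /\<^sub>R (eigenvalues z $ k - l $ j))
      - P $ k ** gram_deriv z h ** (projections z $ j /\<^sub>R (eigenvalues z $ j - l $ k))) = projection_deriv z k"
  proof (rule ext)
    fix h
    have "- inverse (l $ j - l $ k) = inverse (l $ k - l $ j)" for j
      by (metis inverse_minus_eq minus_diff_eq)
    then have "P $ j ** gram_deriv z h ** (P $ k /\<^sub>R (l $ k - l $ j)) - P $ k ** gram_deriv z h ** (P $ j /\<^sub>R (l $ j - l $ k))
        = (P $ j ** gram_deriv z h ** P $ k + P $ k ** gram_deriv z h ** P $ j) /\<^sub>R (l $ k - l $ j)" for j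
      by (simp add: matrix_mult.scaleR_right scaleR_add_right flip: scaleR_minus_left)
    then show "(\<Sum>j\<in>UNIV - {k}.
      P $ j ** gram_deriv z h ** (projections z $ k /\<^sub>R (eigenvalues z $ k - l $ j))
      - P $ k ** gram_deriv z h ** (projections z $ j /\<^sub>R (eigenvalues z $ j - l $ k))) = projection_deriv z k h"
      by (simp add: projection_deriv_def Let_def P_def l_def)
  qed
  finally have "((\<lambda>y. P $ k + F y) has_derivative projection_deriv z k) (at z)"
    by (intro has_derivative_eq_rhs[OF has_derivative_add[OF has_derivative_const]]) auto
  then show ?thesis
  proof (rule has_derivative_transform_eventually)
    have eq: "P $ k + F y = projections y $ k"
      if "\<And>j. j \<noteq> k \<Longrightarrow> eigenvalues y $ k \<noteq> l $ j \<and> eigenvalues y $ j \<noteq> l $ k" for y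
      using resolution_increment[OF resolution_gram resolution_gram, of k y z] that
      by (simp add: F_def P_def l_def algebra_simps)
    have "\<forall>\<^sub>F y in at z. eigenvalues y $ i \<noteq> l $ j" if "i \<noteq> j" for i j
      using isCont_eigenvalue[OF z, of i] that unfolding isCont_def
      by (intro tendsto_imp_eventually_ne) (auto simp: inj simp flip: l_def)
    then have "\<forall>\<^sub>F y in at z. \<forall>j\<in>UNIV - {k}. eigenvalues y $ k \<noteq> l $ j \<and> eigenvalues y $ j \<noteq> l $ k"
      by (intro eventually_ball_finite eventually_conj ballI) auto
    then show "\<forall>\<^sub>F y in at z. P $ k + F y = projections y $ k"
      by eventually_elim (intro eq, auto)
    show "P $ k + F z = projections z $ k" by (intro eq) (auto simp: inj simp flip: l_def)
  qed simp
qed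

section \<open>The divergence of spectral vector fields\<close>

lemma sum_Basis_vec:
  "(\<Sum>b\<in>(Basis :: ('a::euclidean_space^'n) set). f b) = (\<Sum>i\<in>UNIV. \<Sum>u\<in>Basis. f (axis i u))"
proof -
  have inj: "inj_on (\<lambda>(i, u). axis i u :: 'a^'n) (UNIV \<times> Basis)"
    by (auto simp: inj_on_def axis_eq_axis)
  have B: "(Basis :: ('a^'n) set) = (\<lambda>(i, u). axis i u) ` (UNIV \<times> Basis)"
    by (auto simp: Basis_vec_def)
  have "(\<Sum>b\<in>(Basis :: ('a^'n) set). f b) = (\<Sum>(i, u)\<in>UNIV \<times> Basis. f (axis i u))"
    by (subst B, subst sum.reindex[OF inj]) (simp add: o_def case_prod_unfold)
  then show ?thesis by (simp add: sum.cartesian_product)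
qed

lemma sum_Basis_complex_matrix:
  "(\<Sum>e\<in>(Basis :: (complex^'p^'m) set). f e)
    = (\<Sum>i\<in>UNIV. \<Sum>j\<in>UNIV. f (axis i (axis j 1)) + f (axis i (axis j \<i>)))"
  by (simp add: sum_Basis_vec Basis_complex_def complex_eq_iff)

lemma matrix_mult_axis:
  fixes A :: "complex^'m^'k" and B :: "complex^'q^'p"
  shows "(A ** axis i (axis j u) ** B) $ a $ b = A $ a $ i * u * B $ j $ b"
proof -
  have "(A ** axis i (axis j u)) $ a $ c = (if c = j then A $ a $ i * u else 0)" for c
  proof -
    have "(A ** axis i (axis j u)) $ a $ c = (\<Sum>k\<in>UNIV. if k = i then (if c = j then A $ a $ i * u else 0) else 0)"
      unfolding matrix_mult_nth by (intro sum.cong) (auto simp: axis_def)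
    then show ?thesis by simp
  qed
  then have "(A ** axis i (axis j u) ** B) $ a $ b = (\<Sum>c\<in>UNIV. if c = j then A $ a $ i * u * B $ j $ b else 0)"
    unfolding matrix_mult_nth[of _ B] by (intro sum.cong) auto
  then show ?thesis by simp
qed

lemma conj_transpose_axis:
  "conj_transpose (axis i (axis j u)) = axis j (axis i (cnj u))"
  by (auto simp: vec_eq_iff conj_transpose_nth axis_def)

lemma inner_axis_axis_matrix: "(X :: complex^'p^'m) \<bullet> axis i (axis j u) = X $ i $ j \<bullet> u"
  by (simp add: inner_axis)

lemma trace_zero [simp]: "trace (0 :: complex^'n^'n) = 0"
  by (simp add: trace_def)

text \<open>A divergence is the trace of the derivative as a real linear map. The next three lemmas compute this
trace for the kinds of maps that occur: the complex linear $H \mapsto AHB$, the conjugate linear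
$H \mapsto AH^*B$, and maps of rank one.\<close>

lemma real_trace_sandwich:
  fixes A :: "complex^'m^'m" and B :: "complex^'p^'p"
  shows "(\<Sum>e\<in>(Basis :: (complex^'p^'m) set). (A ** e ** B) \<bullet> e) = 2 * Re (trace A * trace B)"
proof -
  have "(\<Sum>e\<in>(Basis :: (complex^'p^'m) set). (A ** e ** B) \<bullet> e) = (\<Sum>i\<in>UNIV. \<Sum>j\<in>UNIV. 2 * Re (A $ i $ i * B $ j $ j))"
    by (simp add: sum_Basis_complex_matrix inner_axis_axis_matrix matrix_mult_axis inner_complex_def)
  also have "\<dots> = 2 * Re (trace A * trace B)"
  proof -
    have "Re (trace A * trace B) = (\<Sum>i\<in>UNIV. \<Sum>j\<in>UNIV. Re (A $ i $ i * B $ j $ j))"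
      by (simp only: trace_def sum_product Re_sum)
    then show ?thesis by (simp only: sum_distrib_left)
  qed
  finally show ?thesis .
qed

lemma real_trace_conj_sandwich:
  fixes A B :: "complex^'p^'m"
  shows "(\<Sum>e\<in>(Basis :: (complex^'p^'m) set). (A ** conj_transpose e ** B) \<bullet> e) = 0"
  by (simp add: sum_Basis_complex_matrix inner_axis_axis_matrix matrix_mult_axis inner_complex_def conj_transpose_axis)

lemma real_trace_rank_one:
  fixes V :: "'a::euclidean_space"
  assumes "linear \<alpha>"
  shows "(\<Sum>e\<in>Basis. (\<alpha> e *\<^sub>R V) \<bullet> e) = \<alpha> V"
proof -
  have "\<alpha> V = \<alpha> (\<Sum>e\<in>Basis. (V \<bullet> e) *\<^sub>R e)" by (simp add: euclidean_representation)
  also have "\<dots> = (\<Sum>e\<in>Basis. (\<alpha> e *\<^sub>R V) \<bullet> e)"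
    by (simp add: linear_sum[OF assms] linear_cmul[OF assms] mult.commute)
  finally show ?thesis ..
qed

definition spectral_field :: "('p::{finite,linorder} \<Rightarrow> 'p rvec \<Rightarrow> real) \<Rightarrow> ('p,'m::finite) cmat \<Rightarrow> ('p,'m) cmat" where
  "spectral_field h z = (\<Sum>k\<in>UNIV. h k (eigenvalues z) *\<^sub>R (z ** projections z $ k))"

text \<open>By the product rule, for $h'_k$ the derivative of $h_k$.\<close>

definition spectral_field_deriv :: "('p::{finite,linorder} \<Rightarrow> 'p rvec \<Rightarrow> real) \<Rightarrow> ('p \<Rightarrow> 'p rvec \<Rightarrow> 'p rvec \<Rightarrow> real) \<Rightarrow> ('p,'m::finite) cmat \<Rightarrow> ('p,'m) cmat \<Rightarrow> ('p,'m) cmat" where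
  "spectral_field_deriv h h' z e = (\<Sum>k\<in>UNIV.
     h k (eigenvalues z) *\<^sub>R (z ** projection_deriv z k e + e ** projections z $ k)
     + h' k (eigenvalues z) (eigenvalues_deriv z e) *\<^sub>R (z ** projections z $ k))"

lemma has_derivative_spectral_field:
  fixes z :: "('p::{finite,linorder},'m::finite) cmat"
  assumes z: "z \<in> regular" and h: "\<And>k. (h k has_derivative h' k (eigenvalues z)) (at (eigenvalues z))"
  shows "(spectral_field h has_derivative spectral_field_deriv h h' z) (at z)"
proof -
  have "((\<lambda>y. h k (eigenvalues y)) has_derivative (\<lambda>e. h' k (eigenvalues z) (eigenvalues_deriv z e))) (at z)" for k
    by (rule has_derivative_compose[OF has_derivative_eigenvalues[OF z] h])
  moreover have "((\<lambda>y. y ** projections y $ k) has_derivative (\<lambda>e. z ** projection_deriv z k e + e ** projections z $ k)) (at z)" for k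
    by (rule bounded_bilinear.FDERIV[OF bounded_bilinear_matrix_mult has_derivative_ident has_derivative_projection[OF z]])
  ultimately show ?thesis
    unfolding spectral_field_def[abs_def] spectral_field_deriv_def[abs_def]
    by (intro has_derivative_sum has_derivative_scaleR)
qed

lemma trace_projection_gram: "trace (z ** projections z $ k ** conj_transpose z) = of_real (eigenvalues z $ k)"
proof -
  have "trace (z ** projections z $ k ** conj_transpose z) = trace (conj_transpose z ** (z ** projections z $ k))"
    by (rule trace_mul_sym)
  also have "\<dots> = trace (gram z ** projections z $ k)" by (simp add: gram_def matrix_mul_assoc)
  also have "\<dots> = of_real (eigenvalues z $ k)"
    by (simp add: resolution_eigen[OF resolution_gram] trace_scaleR resolutionD(4)[OF resolution_gram])
       (simp add: scaleR_conv_of_real)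
  finally show ?thesis .
qed

text \<open>With $K = H^*z + z^*H$, the derivative of $P_k$ in direction $H$ is
$\sum_{j\ne k}(P_jKP_k + P_kKP_j)/(\ell_k-\ell_j)$. The part of each summand with $H^*$ is conjugate
linear and has trace zero; the part with $H$ contributes $2\ell_j$ and $2\ell_k$.\<close>

lemma real_trace_projection_deriv:
  fixes z :: "('p::{finite,linorder},'m::finite) cmat"
  shows "(\<Sum>e\<in>Basis. (z ** projection_deriv z k e) \<bullet> e)
     = (\<Sum>j\<in>UNIV - {k}. 2 * (eigenvalues z $ j + eigenvalues z $ k) / (eigenvalues z $ k - eigenvalues z $ j))"
proof -
  define P l where "P = projections z" and "l = eigenvalues z"
  have sandwich: "z ** (P $ j ** gram_deriv z e ** P $ k) = (z ** P $ j) ** conj_transpose e ** (z ** P $ k)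
      + (z ** P $ j ** conj_transpose z) ** e ** P $ k" for j k e
    by (simp add: gram_deriv_def matrix_mult.add_right matrix_mult.add_left matrix_mul_assoc)
  have tr: "(\<Sum>e\<in>Basis. (z ** (P $ j ** gram_deriv z e ** P $ k)) \<bullet> e) = 2 * l $ j" for j k
    unfolding sandwich inner_add_left sum.distrib real_trace_conj_sandwich real_trace_sandwich
    by (simp add: P_def l_def trace_projection_gram resolutionD(4)[OF resolution_gram])
  have "(\<Sum>e\<in>Basis. (z ** projection_deriv z k e) \<bullet> e)
     = (\<Sum>e\<in>Basis. \<Sum>j\<in>UNIV - {k}. inverse (l $ k - l $ j) *
         ((z ** (P $ j ** gram_deriv z e ** P $ k)) \<bullet> e + (z ** (P $ k ** gram_deriv z e ** P $ j)) \<bullet> e))"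
    by (simp add: projection_deriv_def Let_def P_def l_def matrix_mult.sum_right matrix_mult.scaleR_right
        matrix_mult.add_right inner_sum_left inner_add_left)
  also have "\<dots> = (\<Sum>j\<in>UNIV - {k}. inverse (l $ k - l $ j) *
         ((\<Sum>e\<in>Basis. (z ** (P $ j ** gram_deriv z e ** P $ k)) \<bullet> e) + (\<Sum>e\<in>Basis. (z ** (P $ k ** gram_deriv z e ** P $ j)) \<bullet> e)))"
    by (subst sum.swap) (simp only: sum_distrib_left[symmetric] sum.distrib)
  also have "\<dots> = (\<Sum>j\<in>UNIV - {k}. 2 * (l $ j + l $ k) / (l $ k - l $ j))"
    unfolding tr by (simp add: divide_inverse mult.commute distrib_left)
  finally show ?thesis by (simp add: l_def)
qed

text \<open>Moving $z$ in the direction $zP_k$ scales the $k$-th singular value and leaves the others unchanged.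
This is why only the derivatives $\partial h_k/\partial\ell_k$ enter the divergence.\<close>

lemma eigenvalues_deriv_projection:
  "eigenvalues_deriv z (z ** projections z $ k) = (2 * eigenvalues z $ k) *\<^sub>R axis k 1"
proof -
  note res = resolutionD(1-4)[OF resolution_gram] resolution_eigen[OF resolution_gram]
  have "gram_deriv z (z ** projections z $ k) = (2 * eigenvalues z $ k) *\<^sub>R projections z $ k"
  proof -
    have "gram_deriv z (z ** projections z $ k) = projections z $ k ** gram z + gram z ** projections z $ k"
      by (simp add: gram_deriv_def conj_transpose_mult gram_def matrix_mul_assoc res(1))
    then show ?thesis unfolding res by (simp flip: scaleR_left_distrib)
  qed
  then have "eigenvalues_deriv z (z ** projections z $ k) $ j = (if j = k then 2 * eigenvalues z $ k else 0)" for j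
    by (simp add: eigenvalues_deriv_def inner_eq_trace res matrix_mult.scaleR_right trace_scaleR)
  then show ?thesis by (simp add: vec_eq_iff axis_def)
qed

lemma linear_eigenvalues_deriv: "linear (eigenvalues_deriv z)"
  by (intro linearI)
     (simp_all add: eigenvalues_deriv_def vec_eq_iff gram_deriv_def matrix_mult.add_left matrix_mult.add_right
      matrix_mult.scaleR_left matrix_mult.scaleR_right inner_add_right distrib_left)

lemma divergence_spectral_field:
  fixes z :: "('p::{finite,linorder},'m::finite) cmat"
  assumes h': "\<And>k. linear (h' k (eigenvalues z))"
  defines "l \<equiv> eigenvalues z"
  shows "(\<Sum>e\<in>Basis. spectral_field_deriv h h' z e \<bullet> e)
     = (\<Sum>k\<in>UNIV. 2 * real CARD('m) * h k l + 2 * l $ k * h' k l (axis k 1)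
          + h k l * (\<Sum>j\<in>UNIV - {k}. 2 * (l $ j + l $ k) / (l $ k - l $ j)))"
proof -
  have 1: "(\<Sum>e\<in>(Basis :: (('p,'m) cmat) set). (e ** projections z $ k) \<bullet> e) = 2 * real CARD('m)" for k
    using real_trace_sandwich[of "mat 1 :: complex^'m^'m" "projections z $ k"]
    by (simp add: trace_I resolutionD(4)[OF resolution_gram])
  have 2: "(\<Sum>e\<in>Basis. (h' k l (eigenvalues_deriv z e) *\<^sub>R (z ** projections z $ k)) \<bullet> e) = 2 * l $ k * h' k l (axis k 1)" for k
  proof -
    have "linear (\<lambda>e. h' k l (eigenvalues_deriv z e))"
      using linear_compose[OF linear_eigenvalues_deriv h'] by (simp add: o_def l_def)
    from real_trace_rank_one[OF this] show ?thesis
      using linear_cmul[OF h'] by (simp add: eigenvalues_deriv_projection l_def)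
  qed
  have "(\<Sum>e\<in>Basis. spectral_field_deriv h h' z e \<bullet> e)
     = (\<Sum>e\<in>Basis. \<Sum>k\<in>UNIV. h k l * ((z ** projection_deriv z k e) \<bullet> e) + h k l * ((e ** projections z $ k) \<bullet> e)
          + (h' k l (eigenvalues_deriv z e) *\<^sub>R (z ** projections z $ k)) \<bullet> e)"
    by (simp add: spectral_field_deriv_def inner_sum_left inner_add_left distrib_left l_def)
  also have "\<dots> = (\<Sum>k\<in>UNIV. h k l * (\<Sum>e\<in>Basis. (z ** projection_deriv z k e) \<bullet> e) + h k l * (\<Sum>e\<in>(Basis :: (('p,'m) cmat) set). (e ** projections z $ k) \<bullet> e)
          + (\<Sum>e\<in>Basis. (h' k l (eigenvalues_deriv z e) *\<^sub>R (z ** projections z $ k)) \<bullet> e))"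
    by (subst sum.swap) (simp add: sum.distrib sum_distrib_left)
  also have "\<dots> = (\<Sum>k\<in>UNIV. 2 * real CARD('m) * h k l + 2 * l $ k * h' k l (axis k 1)
          + h k l * (\<Sum>j\<in>UNIV - {k}. 2 * (l $ j + l $ k) / (l $ k - l $ j)))"
    unfolding 1 2 real_trace_projection_deriv by (simp add: l_def algebra_simps)
  finally show ?thesis .
qed

lemma norm_spectral_field:
  "(norm (spectral_field h z))\<^sup>2 = (\<Sum>k\<in>UNIV. (h k (eigenvalues z))\<^sup>2 * eigenvalues z $ k)"
proof -
  define P l where "P = projections z" and "l = eigenvalues z"
  note res = resolutionD(1-4)[OF resolution_gram] resolution_eigen[OF resolution_gram]
  have ip: "(z ** P $ i) \<bullet> (z ** P $ j) = (if i = j then l $ i else 0)" for i j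
  proof -
    have "(z ** P $ i) \<bullet> (z ** P $ j) = Re (trace (P $ i ** (gram z ** P $ j)))"
      by (simp add: inner_eq_trace conj_transpose_mult P_def res(1) gram_def matrix_mul_assoc)
    then show ?thesis by (simp add: P_def l_def res matrix_mult.scaleR_right trace_scaleR)
  qed
  have "(norm (spectral_field h z))\<^sup>2 = (\<Sum>i\<in>UNIV. \<Sum>j\<in>UNIV. h j l * (h i l * ((z ** P $ i) \<bullet> (z ** P $ j))))"
    by (simp add: power2_norm_eq_inner spectral_field_def inner_sum_left inner_sum_right l_def P_def
        sum_distrib_left inner_commute)
  then show ?thesis by (simp add: ip l_def power2_eq_square if_distrib mult.assoc cong: if_cong)
qed

text \<open>For $h_k = g_k/\ell_k$ the interaction terms are
$\frac{g_k}{\ell_k}\cdot\frac{2(\ell_j+\ell_k)}{\ell_k-\ell_j} = \frac{4g_k}{\ell_k-\ell_j} - \frac{2g_k}{\ell_k}$.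
The second part turns the coefficient $2M$ into $2(M-p)$. The first part, symmetrised in $j$ and $k$,
is a sum of the difference quotients $(g_k-g_j)/(\ell_k-\ell_j) \ge 0$.\<close>

lemma spectral_divergence_lower_bound:
  fixes l :: "'p::{finite,linorder} rvec" and g :: "'p \<Rightarrow> real"
  assumes l: "l \<in> decreasing_positive" and g: "\<And>i j. i < j \<Longrightarrow> g j \<le> g i"
  shows "2 * (M - real CARD('p)) * (\<Sum>k\<in>UNIV. g k / l $ k)
    \<le> (\<Sum>k\<in>UNIV. 2 * M * (g k / l $ k) - 2 * (g k / l $ k)
          + g k / l $ k * (\<Sum>j\<in>UNIV - {k}. 2 * (l $ j + l $ k) / (l $ k - l $ j)))"
proof -
  have pos: "0 < l $ k" for k using l by (simp add: decreasing_positive_def)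
  define T where "T = (\<Sum>k\<in>UNIV. \<Sum>j\<in>UNIV. g k / (l $ k - l $ j))"
  \<comment> \<open>The diagonal terms vanish because division by zero yields zero.\<close>
  have "2 * T = (\<Sum>k\<in>UNIV. \<Sum>j\<in>UNIV. g k / (l $ k - l $ j)) + (\<Sum>k\<in>UNIV. \<Sum>j\<in>UNIV. g j / (l $ j - l $ k))"
    unfolding T_def by (subst (3) sum.swap) simp
  also have "\<dots> = (\<Sum>k\<in>UNIV. \<Sum>j\<in>UNIV. (g k - g j) / (l $ k - l $ j))"
  proof -
    have "(g k - g j) / (l $ k - l $ j) = g k / (l $ k - l $ j) + g j / (l $ j - l $ k)" for j k
      by (metis add_uminus_conv_diff diff_divide_distrib divide_minus_right minus_diff_eq)
    then show ?thesis by (simp add: sum.distrib)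
  qed
  also have "\<dots> \<ge> 0"
  proof (intro sum_nonneg)
    fix k j
    show "0 \<le> (g k - g j) / (l $ k - l $ j)"
    proof (cases k j rule: linorder_cases)
      case less
      then show ?thesis using g[OF less] l by (intro divide_nonneg_pos) (auto simp: decreasing_positive_def)
    next
      case greater
      then show ?thesis using g[OF greater] l by (intro divide_nonpos_neg) (auto simp: decreasing_positive_def)
    qed simp
  qed
  finally have T: "0 \<le> T" by simp
  have inner: "g k / l $ k * (\<Sum>j\<in>UNIV - {k}. 2 * (l $ j + l $ k) / (l $ k - l $ j))
      = 4 * (\<Sum>j\<in>UNIV. g k / (l $ k - l $ j)) - 2 * (real CARD('p) - 1) * (g k / l $ k)" for k
  proof -
    have "g k / l $ k * (2 * (l $ j + l $ k) / (l $ k - l $ j)) = 4 * (g k / (l $ k - l $ j)) - 2 * (g k / l $ k)"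
      if "j \<noteq> k" for j
    proof -
      have "l $ k - l $ j \<noteq> 0" using that decreasing_positive_inj[OF l] by auto
      then show ?thesis using pos[of k] by (simp add: field_simps)
    qed
    then have "g k / l $ k * (\<Sum>j\<in>UNIV - {k}. 2 * (l $ j + l $ k) / (l $ k - l $ j))
      = (\<Sum>j\<in>UNIV - {k}. 4 * (g k / (l $ k - l $ j)) - 2 * (g k / l $ k))"
      by (simp add: sum_distrib_left)
    also have "\<dots> = 4 * (\<Sum>j\<in>UNIV - {k}. g k / (l $ k - l $ j)) - real (CARD('p) - 1) * (2 * (g k / l $ k))"
      by (simp add: sum_subtractf sum_distrib_left)
    also have "(\<Sum>j\<in>UNIV - {k}. g k / (l $ k - l $ j)) = (\<Sum>j\<in>UNIV. g k / (l $ k - l $ j))"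
      by (subst (2) sum.remove[of _ k]) auto
    also have "real (CARD('p) - 1) = real CARD('p) - 1" by (simp add: of_nat_diff)
    finally show ?thesis by simp
  qed
  have "(\<Sum>k\<in>UNIV. 2 * M * (g k / l $ k) - 2 * (g k / l $ k)
          + g k / l $ k * (\<Sum>j\<in>UNIV - {k}. 2 * (l $ j + l $ k) / (l $ k - l $ j)))
     = (\<Sum>k\<in>UNIV. 2 * (M - real CARD('p)) * (g k / l $ k) + 4 * (\<Sum>j\<in>UNIV. g k / (l $ k - l $ j)))"
    unfolding inner by (simp add: algebra_simps)
  also have "\<dots> = 2 * (M - real CARD('p)) * (\<Sum>k\<in>UNIV. g k / l $ k) + 4 * T"
    by (simp add: sum.distrib sum_distrib_left T_def)
  finally show ?thesis using T by simp
qed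

section \<open>Risk of shrinkage with smooth, compactly supported weights\<close>

lemma norm_eq_sum_eigenvalues: "(norm z)\<^sup>2 = (\<Sum>k\<in>UNIV. eigenvalues z $ k)"
proof -
  have "(norm z)\<^sup>2 = Re (trace (gram z))" by (simp add: norm_power2_eq_trace gram_def)
  also have "\<dots> = (\<Sum>k\<in>UNIV. eigenvalues z $ k)"
    by (subst resolutionD(5)[OF resolution_gram])
       (simp add: trace_sum trace_scaleR resolutionD(4)[OF resolution_gram])
  finally show ?thesis .
qed

text \<open>A limit of matrices with spectra in $K$ has a resolution with spectrum in $K$; since $K$ lies in the
open cone, the limit is again regular.\<close>

lemma closed_eigenvalues_vimage:
  fixes K :: "('p::{finite,linorder} rvec) set"
  assumes K: "closed K" "K \<subseteq> decreasing_positive"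
  shows "closed {z :: ('p,'m::finite) cmat. z \<in> regular \<and> eigenvalues z \<in> K}"
  unfolding closed_sequential_limits
proof (intro allI impI, elim conjE)
  fix X and z :: "('p,'m) cmat"
  assume X: "\<forall>n. X n \<in> {z. z \<in> regular \<and> eigenvalues z \<in> K}" "X \<longlonglongrightarrow> z"
  from resolution_compact[OF tendsto_gram[OF X(2)] resolution_gram] obtain r l P
    where r: "strict_mono r" "(\<lambda>n. eigenvalues (X (r n))) \<longlonglongrightarrow> l" "resolution (gram z) l P" by auto
  have "l \<in> K" by (rule closed_sequentially[OF K(1) _ r(2)]) (use X(1) in auto)
  then show "z \<in> {z. z \<in> regular \<and> eigenvalues z \<in> K}"
    using eigendata_unique[OF r(3)] K(2) by auto
qed

lemma continuous_on_eigenvalues: "continuous_on regular eigenvalues"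
  and continuous_on_projections: "continuous_on regular projections"
  by (simp_all add: continuous_at_imp_continuous_on isCont_eigenvalues isCont_projections)

lemma continuous_on_gram_deriv: "continuous_on A (\<lambda>z. gram_deriv z e)"
  unfolding gram_deriv_def
  by (intro continuous_intros matrix_mult.continuous_on bounded_linear.continuous_on[OF bounded_linear_conj_transpose])

lemma continuous_on_eigenvalues_deriv:
  "continuous_on (regular :: (('p::{finite,linorder},'m::finite) cmat) set) (\<lambda>z. eigenvalues_deriv z e $ k)"
  unfolding eigenvalues_deriv_def vec_lambda_beta
  by (intro continuous_intros continuous_on_projections continuous_on_gram_deriv)

lemma continuous_on_projection_deriv:
  "continuous_on (regular :: (('p::{finite,linorder},'m::finite) cmat) set) (\<lambda>z. projection_deriv z k e)"
proof -
  show ?thesis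
    unfolding projection_deriv_def Let_def
    by (intro continuous_intros matrix_mult.continuous_on continuous_on_projections continuous_on_eigenvalues continuous_on_gram_deriv)
       (auto simp: regular_def decreasing_positive_inj)
qed

lemma has_derivative_0_if_zero_on_open:
  assumes "(f has_derivative f') (at x)" "open A" "x \<in> A" "\<And>y. y \<in> A \<Longrightarrow> f y = 0"
  shows "f' = (\<lambda>_. 0)"
proof -
  have "((\<lambda>_. 0) has_derivative f') (at x)"
    using assms by (intro has_derivative_transform_within_open[OF assms(1-3)]) auto
  then show ?thesis using has_derivative_const has_derivative_unique by blast
qed

definition shrinkage_field :: "('p::{finite,linorder} \<Rightarrow> 'p rvec \<Rightarrow> real) \<Rightarrow> ('p,'m::finite) cmat \<Rightarrow> ('p,'m) cmat" where
  "shrinkage_field g z = (if z \<in> regular then spectral_field (\<lambda>k l. g k l / l $ k) z else 0)"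

text \<open>Compact support inside the open cone makes the field, extended by zero, continuously differentiable
on the whole space, so Stein's bound applies. The constant $c$ allows for the cutoff at infinity,
which makes $\sum_k\partial g_k/\partial\ell_k$ slightly negative.\<close>

lemma shrinkage_field_risk:
  fixes g :: "'p::{finite,linorder} \<Rightarrow> 'p rvec \<Rightarrow> real"
    and \<xi> :: "('p,'m::finite) cmat"
  assumes K: "compact K" "K \<subseteq> decreasing_positive"
    and g: "\<And>k l. l \<in> decreasing_positive \<Longrightarrow> (g k has_derivative g' k l) (at l)"
    and g'_cont: "\<And>k v. continuous_on decreasing_positive (\<lambda>l. g' k l v)"
    and supp: "\<And>k l. l \<in> decreasing_positive \<Longrightarrow> l \<notin> K \<Longrightarrow> g k l = 0"
    and bounds: "\<And>k l. l \<in> decreasing_positive \<Longrightarrow> 0 \<le> g k l \<and> g k l \<le> 2 * (real CARD('m) - real CARD('p))"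
    and ord: "\<And>i j l. l \<in> decreasing_positive \<Longrightarrow> i < j \<Longrightarrow> g j l \<le> g i l"
    and div: "\<And>l. l \<in> decreasing_positive \<Longrightarrow> - c \<le> (\<Sum>k\<in>UNIV. g' k l (axis k 1))"
    and c: "0 \<le> c"
  shows "gaussian_risk (\<lambda>z. z - shrinkage_field g z) \<xi>
       \<le> ennreal ((real (CARD('m) * CARD('p)) + 2 * c) * pi ^ (CARD('m) * CARD('p)))"
proof -
  let ?D = "decreasing_positive :: ('p rvec) set"
  let ?R = "regular :: (('p,'m) cmat) set"
  define h where "h k l = g k l / l $ k" for k l
  define h' where "h' k l v = g' k l v / l $ k - g k l * v $ k / (l $ k)\<^sup>2" for k l v
  define W where "W = (shrinkage_field g :: ('p,'m) cmat \<Rightarrow> ('p,'m) cmat)"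
  define W' where "W' z e = (if z \<in> ?R then spectral_field_deriv h h' z e else 0)" for z e
  define K' where "K' = {z \<in> ?R. eigenvalues z \<in> K}"
  have W_eq: "W z = (if z \<in> ?R then spectral_field h z else 0)" for z
    by (simp add: W_def shrinkage_field_def h_def[abs_def])
  have pos: "l \<in> ?D \<Longrightarrow> 0 < l $ k" for l k by (simp add: decreasing_positive_def)
  have eD: "z \<in> ?R \<Longrightarrow> eigenvalues z \<in> ?D" for z by (simp add: regular_def)
  have h: "(h k has_derivative h' k l) (at l)" if "l \<in> ?D" for k l
    unfolding h_def[abs_def] h'_def
    using pos[OF that, of k]
    by (auto intro!: derivative_eq_intros g that bounded_linear.has_derivative[OF bounded_linear_vec_nth]
        simp: fun_eq_iff field_simps power2_eq_square)
  have lin: "linear (h' k l)" if "l \<in> ?D" for k l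
    using has_derivative_linear[OF h[OF that]] .
  have g'0: "g' k l = (\<lambda>_. 0)" if "l \<in> ?D" "l \<notin> K" for k l
    by (rule has_derivative_0_if_zero_on_open[OF g[OF that(1)], of "?D - K"])
       (use that supp K in \<open>auto intro!: open_Diff open_decreasing_positive compact_imp_closed\<close>)
  have closedK': "closed K'"
    unfolding K'_def using closed_eigenvalues_vimage[OF compact_imp_closed[OF K(1)] K(2)] by simp
  obtain B where B: "\<And>l. l \<in> K \<Longrightarrow> norm l \<le> B"
    using compact_imp_bounded[OF K(1)] unfolding bounded_iff by blast
  have W_0: "W z = 0" if "z \<notin> K'" for z
    using that supp eD by (auto simp: W_eq K'_def spectral_field_def h_def)
  have W'_0: "W' z e = 0" if "z \<notin> K'" for z e
    using that supp eD g'0 by (auto simp: W'_def K'_def spectral_field_deriv_def h_def h'_def)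
  have K'_sub: "K' \<subseteq> ?R" by (auto simp: K'_def)
  have norm_K': "(norm z)\<^sup>2 \<le> real CARD('p) * B" if "z \<in> K'" for z
  proof -
    have "(norm z)\<^sup>2 \<le> (\<Sum>k\<in>(UNIV::'p set). B)"
      unfolding norm_eq_sum_eigenvalues
    proof (rule sum_mono)
      fix k
      have "eigenvalues z $ k \<le> norm (eigenvalues z)"
        using component_le_norm_cart[of "eigenvalues z" k] by simp
      also have "\<dots> \<le> B" using that B by (simp add: K'_def)
      finally show "eigenvalues z $ k \<le> B" .
    qed
    then show ?thesis by simp
  qed
  have W_supp: "W z = 0" if "sqrt (\<bar>real CARD('p) * B\<bar>) < norm z" for z
  proof -
    have "\<bar>real CARD('p) * B\<bar> < (norm z)\<^sup>2"
      using that real_less_lsqrt by (smt (verit) norm_ge_zero real_le_rsqrt real_sqrt_abs)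
    then show ?thesis using norm_K'[of z] W_0[of z] by fastforce
  qed
  have deriv: "(W has_derivative W' z) (at z)" for z
  proof (cases "z \<in> ?R")
    case True
    have "(W has_derivative spectral_field_deriv h h' z) (at z)"
      by (rule has_derivative_transform_within_open[OF has_derivative_spectral_field[OF True, where h = h and h' = h', OF h[OF eD[OF True]]] open_regular True])
         (simp add: W_eq)
    moreover have "W' z = spectral_field_deriv h h' z" using True by (simp add: W'_def fun_eq_iff)
    ultimately show ?thesis by simp
  next
    case False
    then have "z \<in> - K'" using K'_sub by blast
    have "(W has_derivative (\<lambda>_. 0)) (at z)"
      by (rule has_derivative_transform_within_open[OF has_derivative_const open_Compl[OF closedK'] \<open>z \<in> - K'\<close>])
         (simp add: W_0)
    moreover have "W' z = (\<lambda>_. 0)" using False by (simp add: W'_def fun_eq_iff)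
    ultimately show ?thesis by simp
  qed
  have cont: "continuous_on UNIV (\<lambda>z. W' z e)" for e
  proof -
    have ce: "continuous_on ?R (\<lambda>z. eigenvalues z $ k)" for k
      by (intro continuous_intros continuous_on_eigenvalues)
    have cg: "continuous_on ?R (\<lambda>z. g k (eigenvalues z))" for k
    proof (rule continuous_on_compose2[of ?D "g k"])
      show "continuous_on ?D (g k)"
      proof (intro continuous_at_imp_continuous_on ballI)
        fix l :: "'p rvec" assume "l \<in> ?D"
        then show "isCont (g k) l" by (rule has_derivative_continuous[OF g])
      qed
    qed (use eD continuous_on_eigenvalues in auto)
    have cg': "continuous_on ?R (\<lambda>z. g' k (eigenvalues z) v)" for k v
      by (rule continuous_on_compose2[OF g'_cont continuous_on_eigenvalues]) (use eD in auto)
    have nz: "\<forall>z\<in>?R. eigenvalues z $ k \<noteq> 0" for k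
      using pos eD by (metis less_irrefl)
    have ch: "continuous_on ?R (\<lambda>z. h k (eigenvalues z))" for k
      unfolding h_def by (intro continuous_on_divide cg ce nz)
    have ch': "continuous_on ?R (\<lambda>z. h' k (eigenvalues z) v)" for k v
      unfolding h'_def
      by (intro continuous_on_diff continuous_on_divide continuous_on_mult continuous_on_power continuous_on_const cg cg' ce)
         (use nz in auto)
    have "continuous_on ?R (\<lambda>z. \<Sum>j\<in>UNIV. eigenvalues_deriv z e $ j * h' k (eigenvalues z) (axis j 1))" for k
      by (intro continuous_intros ch' continuous_on_eigenvalues_deriv)
    moreover have "(\<Sum>j\<in>UNIV. eigenvalues_deriv z e $ j * h' k (eigenvalues z) (axis j 1))
        = h' k (eigenvalues z) (eigenvalues_deriv z e)" if "z \<in> ?R" for z k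
      using lin[OF eD[OF that]]
      by (subst (2) vec_eq_sum_axis[of "eigenvalues_deriv z e"]) (simp add: linear_sum linear_cmul)
    ultimately have cl: "continuous_on ?R (\<lambda>z. h' k (eigenvalues z) (eigenvalues_deriv z e))" for k
      by (subst continuous_on_cong[OF refl, symmetric]) auto
    have "continuous_on ?R (\<lambda>z. spectral_field_deriv h h' z e)"
      unfolding spectral_field_deriv_def
      by (intro continuous_intros matrix_mult.continuous_on ch cl continuous_on_projections continuous_on_projection_deriv)
    then have 1: "continuous_on ?R (\<lambda>z. W' z e)"
      by (rule continuous_on_eq) (simp add: W'_def)
    have 2: "continuous_on (- K') (\<lambda>z. W' z e)"
      by (rule continuous_on_eq[OF continuous_on_const[of _ 0]]) (simp add: W'_0)
    have "continuous_on (?R \<union> - K') (\<lambda>z. W' z e)"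
      by (intro continuous_on_open_Un open_regular open_Compl closedK' 1 2)
    moreover have "?R \<union> - K' = UNIV" using K'_sub by blast
    ultimately show ?thesis by simp
  qed
  have dv: "(norm (W z))\<^sup>2 \<le> (\<Sum>e\<in>Basis. W' z e \<bullet> e) + 2 * c" for z
  proof (cases "z \<in> ?R")
    case False
    then show ?thesis using c by (simp add: W_eq W'_def)
  next
    case True
    define l where "l = eigenvalues z"
    have l: "l \<in> ?D" using eD[OF True] by (simp add: l_def)
    have summand: "2 * real CARD('m) * h k l + 2 * l $ k * h' k l (axis k 1) + h k l * X
       = 2 * g' k l (axis k 1) + (2 * real CARD('m) * (g k l / l $ k) - 2 * (g k l / l $ k) + g k l / l $ k * X)" for k X
      using pos[OF l, of k] by (simp add: h_def h'_def axis_def power2_eq_square field_simps)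
    have "(norm (W z))\<^sup>2 = (\<Sum>k\<in>UNIV. (g k l / l $ k)\<^sup>2 * l $ k)"
      using True by (simp add: W_eq norm_spectral_field h_def l_def)
    also have "\<dots> \<le> (\<Sum>k\<in>UNIV. 2 * (real CARD('m) - real CARD('p)) * (g k l / l $ k))"
    proof (rule sum_mono)
      fix k
      have "(g k l / l $ k)\<^sup>2 * l $ k = g k l * (g k l / l $ k)"
        using pos[OF l, of k] by (simp add: power2_eq_square)
      also have "\<dots> \<le> 2 * (real CARD('m) - real CARD('p)) * (g k l / l $ k)"
        using bounds[OF l, of k] pos[OF l, of k] by (intro mult_right_mono) auto
      finally show "(g k l / l $ k)\<^sup>2 * l $ k \<le> 2 * (real CARD('m) - real CARD('p)) * (g k l / l $ k)" .
    qed
    also have "\<dots> = 2 * (real CARD('m) - real CARD('p)) * (\<Sum>k\<in>UNIV. g k l / l $ k)"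
      by (simp add: sum_distrib_left)
    also have "\<dots> \<le> (\<Sum>k\<in>UNIV. 2 * real CARD('m) * (g k l / l $ k) - 2 * (g k l / l $ k)
          + g k l / l $ k * (\<Sum>j\<in>UNIV - {k}. 2 * (l $ j + l $ k) / (l $ k - l $ j)))"
      by (rule spectral_divergence_lower_bound[OF l ord[OF l]])
    also have "\<dots> \<le> 2 * (\<Sum>k\<in>UNIV. g' k l (axis k 1)) + 2 * c + \<dots>"
      using div[OF l] by simp
    also have "\<dots> = (\<Sum>e\<in>Basis. spectral_field_deriv h h' z e \<bullet> e) + 2 * c"
      using divergence_spectral_field[of h' z h] lin[OF l] unfolding l_def[symmetric] summand
      by (simp add: sum.distrib sum_distrib_left)
    finally show ?thesis using True by (simp add: W'_def)
  qed
  have "gaussian_risk (\<lambda>z. z - W z) \<xi>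
      \<le> ennreal ((DIM(('p,'m) cmat) / 2 + 2 * c) * sqrt pi ^ DIM(('p,'m) cmat))"
    by (rule stein_risk_bound[OF deriv cont W_supp dv]) (use c in auto)
  moreover have "sqrt pi ^ DIM(('p,'m) cmat) = pi ^ (CARD('m) * CARD('p))"
    by (simp add: power_mult mult.assoc[symmetric] mult.commute[of _ 2])
  ultimately show ?thesis by (simp add: W_def mult.commute)
qed

section \<open>Mollification\<close>

text \<open>A function with Lipschitz derivative that vanishes on the negative half-line: the simplest source of
$C^1$ bumps and steps.\<close>

definition pos_sq :: "real \<Rightarrow> real" where
  "pos_sq x = (max 0 x)\<^sup>2"

lemma pos_sq_second_order: "\<bar>pos_sq b - pos_sq a - 2 * max 0 a * (b - a)\<bar> \<le> (b - a)\<^sup>2"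
proof -
  consider "a \<le> 0" "b \<le> 0" | "a \<le> 0" "0 < b" | "0 < a" "0 < b" | "0 < a" "b \<le> 0" by linarith
  then show ?thesis
  proof cases
    case 1 then show ?thesis by (simp add: pos_sq_def)
  next
    case 2
    then have "b\<^sup>2 \<le> (b - a)\<^sup>2" by (intro power_mono) auto
    with 2 show ?thesis by (simp add: pos_sq_def)
  next
    case 3
    then have "pos_sq b - pos_sq a - 2 * max 0 a * (b - a) = (b - a)\<^sup>2"
      by (simp add: pos_sq_def power2_eq_square algebra_simps)
    then show ?thesis by simp
  next
    case 4
    have "pos_sq b - pos_sq a - 2 * max 0 a * (b - a) = a * (a - 2 * b)"
      using 4 by (simp add: pos_sq_def power2_eq_square algebra_simps)
    moreover have "(b - a)\<^sup>2 = a * (a - 2 * b) + b\<^sup>2" by (simp add: power2_eq_square algebra_simps)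
    moreover have "0 \<le> a * (a - 2 * b)" using 4 by (intro mult_nonneg_nonneg) auto
    ultimately show ?thesis by simp
  qed
qed

lemma DERIV_pos_sq: "(pos_sq has_real_derivative 2 * max 0 x) (at x)"
  unfolding has_field_derivative_def has_derivative_within_alt2
proof (intro conjI allI impI)
  show "bounded_linear ((*) (2 * max 0 x))" by (rule bounded_linear_mult_right)
  fix e :: real assume e: "0 < e"
  then have "\<forall>\<^sub>F y in at x. dist y x < e" by (auto simp: eventually_at)
  then show "\<forall>\<^sub>F y in at x. norm (pos_sq y - pos_sq x - 2 * max 0 x * (y - x)) \<le> e * norm (y - x)"
  proof eventually_elim
    case (elim y)
    have "norm (pos_sq y - pos_sq x - 2 * max 0 x * (y - x)) \<le> \<bar>y - x\<bar> * \<bar>y - x\<bar>"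
      using pos_sq_second_order[of y x] by (simp add: power2_eq_square)
    also have "\<dots> \<le> e * \<bar>y - x\<bar>" using elim by (intro mult_right_mono) (auto simp: dist_real_def)
    finally show ?case by simp
  qed
qed

lemma continuous_on_pos_sq [continuous_intros]: "continuous_on A f \<Longrightarrow> continuous_on A (\<lambda>x. pos_sq (f x))"
  unfolding pos_sq_def by (intro continuous_intros)

definition bump :: "'a::euclidean_space \<Rightarrow> real" where
  "bump x = pos_sq (1 - (norm x)\<^sup>2)"

definition mollify :: "('a::euclidean_space \<Rightarrow> real) \<Rightarrow> 'a \<Rightarrow> real" where
  "mollify f w = (\<integral>y. f y * bump (y - w) \<partial>lborel)"

definition mollify_grad :: "('a::euclidean_space \<Rightarrow> real) \<Rightarrow> 'a \<Rightarrow> 'a" where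
  "mollify_grad f w = (\<integral>y. (4 * f y * max 0 (1 - (norm (y - w))\<^sup>2)) *\<^sub>R (y - w) \<partial>lborel)"

lemma bump_nonneg: "0 \<le> bump x" and bump_le_1: "bump x \<le> 1"
  and bump_eq_0: "1 \<le> norm x \<Longrightarrow> bump x = 0"
proof -
  show "0 \<le> bump x" by (simp add: bump_def pos_sq_def)
  have "max 0 (1 - (norm x)\<^sup>2) ^ 2 \<le> 1 ^ 2" by (intro power_mono) auto
  then show "bump x \<le> 1" by (simp add: bump_def pos_sq_def)
  assume "1 \<le> norm x"
  then have "1 \<le> (norm x)\<^sup>2" by simp
  then show "bump x = 0" by (simp add: bump_def pos_sq_def max_def)
qed

lemma borel_measurable_bump [measurable]: "bump \<in> borel_measurable borel"
  unfolding bump_def pos_sq_def by measurable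

lemma integrable_bounded_support:
  fixes g :: "'a::euclidean_space \<Rightarrow> 'b::{banach, second_countable_topology}"
  assumes "g \<in> borel_measurable borel" "\<And>y. norm (g y) \<le> C * indicator (cball w r) y"
  shows "integrable lborel g"
proof (rule Bochner_Integration.integrable_bound)
  show "integrable lborel (\<lambda>y. C * indicator (cball w r) y :: real)"
    using emeasure_lborel_cball_finite[of w r]
    by (intro integrable_mult_right) (simp add: integrable_indicator_iff)
  show "AE y in lborel. norm (g y) \<le> norm (C * indicator (cball w r) y)"
    using order_trans[OF assms(2) abs_ge_self] by (intro AE_I2) (simp only: real_norm_def)
qed (use assms(1) in simp)

lemma integrable_mollify:
  assumes [measurable]: "f \<in> borel_measurable borel" and B: "\<And>y. \<bar>f y\<bar> \<le> B"
  shows "integrable lborel (\<lambda>y. f y * bump (y - w))"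
    and "integrable lborel (\<lambda>y. (4 * f y * max 0 (1 - (norm (y - w))\<^sup>2)) *\<^sub>R (y - w))"
proof -
  have B0: "0 \<le> B" using B[of undefined] by linarith
  show "integrable lborel (\<lambda>y. f y * bump (y - w))"
  proof (rule integrable_bounded_support[where C = B and w = w and r = 1])
    fix y show "norm (f y * bump (y - w)) \<le> B * indicator (cball w 1) y"
    proof (cases "y \<in> cball w 1")
      case True
      have "\<bar>f y\<bar> * bump (y - w) \<le> B * 1" using B B0 bump_le_1 bump_nonneg by (intro mult_mono)
      then show ?thesis using True by (simp add: abs_mult bump_nonneg)
    next
      case False
      then show ?thesis by (simp add: bump_eq_0 dist_norm norm_minus_commute)
    qed
  qed measurable
  show "integrable lborel (\<lambda>y. (4 * f y * max 0 (1 - (norm (y - w))\<^sup>2)) *\<^sub>R (y - w))"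
  proof (rule integrable_bounded_support[where C = "4 * B" and w = w and r = 1])
    fix y show "norm ((4 * f y * max 0 (1 - (norm (y - w))\<^sup>2)) *\<^sub>R (y - w)) \<le> 4 * B * indicator (cball w 1) y"
    proof (cases "y \<in> cball w 1")
      case True
      then have "norm (y - w) \<le> 1" by (simp add: dist_norm norm_minus_commute)
      moreover have "\<bar>max 0 (1 - (norm (y - w))\<^sup>2)\<bar> \<le> 1" by auto
      ultimately have "(4 * \<bar>f y\<bar> * \<bar>max 0 (1 - (norm (y - w))\<^sup>2)\<bar>) * norm (y - w) \<le> (4 * B * 1) * 1"
        using B B0 by (intro mult_mono) auto
      then show ?thesis using True by (simp add: abs_mult)
    next
      case False
      then have "1 \<le> (norm (y - w))\<^sup>2" by (simp add: dist_norm norm_minus_commute)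
      then show ?thesis using False by (simp add: max_def)
    qed
  qed measurable
qed

text \<open>A second-order remainder that is uniform in $x$ and vanishes outside a fixed ball can be integrated,
which gives the derivative of a convolution without further regularity of the other factor.\<close>

lemma bump_second_order:
  assumes h: "norm h \<le> 1"
  shows "\<bar>bump (x - h) - bump x - 4 * max 0 (1 - (norm x)\<^sup>2) * (x \<bullet> h)\<bar> \<le> 27 * (norm h)\<^sup>2 * indicator (cball 0 2) x"
proof (cases "norm x \<le> 2")
  case False
  then have "1 \<le> norm (x - h)" using h norm_triangle_ineq2[of x h] by simp
  moreover have n: "1 < norm x" using False by simp
  moreover have "max 0 (1 - (norm x)\<^sup>2) = 0"
    using one_less_power[OF n, of 2] by (intro max_absorb1) simp
  ultimately show ?thesis using False by (simp add: bump_eq_0)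
next
  case True
  define a b where "a = 1 - (norm x)\<^sup>2" and "b = 1 - (norm (x - h))\<^sup>2"
  have ba: "b - a = 2 * (x \<bullet> h) - (norm h)\<^sup>2"
    by (simp add: a_def b_def power2_norm_eq_inner inner_diff_left inner_diff_right inner_commute)
  \<comment> \<open>The constant is $27 = 5^2 + 2$, from $|b - a| \le 5|h|$ and the term $2\max(0,a)|h|^2$.\<close>
  have "\<bar>x \<bullet> h\<bar> \<le> 2 * norm h"
    using Cauchy_Schwarz_ineq2[of x h] True by (meson mult_right_mono norm_ge_zero order_trans)
  moreover have "(norm h)\<^sup>2 \<le> norm h" using h by (simp add: power2_eq_square mult_left_le_one_le)
  ultimately have "\<bar>b - a\<bar> \<le> 5 * norm h" unfolding ba by (smt (verit) norm_ge_zero zero_le_power2)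
  then have "(b - a)\<^sup>2 \<le> (5 * norm h)\<^sup>2" by (metis abs_ge_zero power2_abs power_mono)
  then have 1: "\<bar>pos_sq b - pos_sq a - 2 * max 0 a * (b - a)\<bar> \<le> 25 * (norm h)\<^sup>2"
    using pos_sq_second_order[of b a] by (simp add: power_mult_distrib)
  have "max 0 a * (norm h)\<^sup>2 \<le> 1 * (norm h)\<^sup>2" by (intro mult_right_mono) (auto simp: a_def)
  moreover have "0 \<le> max 0 a * (norm h)\<^sup>2" by simp
  moreover have "2 * max 0 a * (b - a) = 4 * max 0 a * (x \<bullet> h) - 2 * (max 0 a * (norm h)\<^sup>2)"
    unfolding ba by (simp add: algebra_simps)
  ultimately have "\<bar>pos_sq b - pos_sq a - 4 * max 0 a * (x \<bullet> h)\<bar> \<le> 27 * (norm h)\<^sup>2"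
    using 1 by linarith
  then show ?thesis using True by (simp add: a_def b_def bump_def)
qed

lemma has_derivative_mollify:
  fixes f :: "'a::euclidean_space \<Rightarrow> real"
  assumes f: "f \<in> borel_measurable borel" and B: "\<And>y. \<bar>f y\<bar> \<le> B"
  shows "(mollify f has_derivative (\<lambda>h. mollify_grad f w \<bullet> h)) (at w)"
  unfolding has_derivative_within_alt2
proof (intro conjI allI impI)
  show "bounded_linear (\<lambda>h. mollify_grad f w \<bullet> h)" by (rule bounded_linear_inner_right)
  note [measurable] = f
  have B0: "0 \<le> B" using B[of undefined] by linarith
  define M where "M = 27 * B * measure lborel (cball w 2)"
  have M: "0 \<le> M" using B0 by (simp add: M_def)
  have quad: "\<bar>mollify f (w + h) - mollify f w - mollify_grad f w \<bullet> h\<bar> \<le> M * (norm h)\<^sup>2" if h: "norm h \<le> 1" for h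
  proof -
    let ?r = "\<lambda>y. f y * (bump (y - w - h) - bump (y - w) - 4 * max 0 (1 - (norm (y - w))\<^sup>2) * ((y - w) \<bullet> h))"
    have "mollify f (w + h) - mollify f w - mollify_grad f w \<bullet> h
       = (\<integral>y. f y * bump (y - (w + h)) - f y * bump (y - w) - (4 * f y * max 0 (1 - (norm (y - w))\<^sup>2)) *\<^sub>R (y - w) \<bullet> h \<partial>lborel)"
    proof -
      note i = integrable_mollify[OF f B]
      have "(\<integral>y. (4 * f y * max 0 (1 - (norm (y - w))\<^sup>2)) *\<^sub>R (y - w) \<bullet> h \<partial>lborel) = mollify_grad f w \<bullet> h"
        unfolding mollify_grad_def by (rule integral_inner_left) (rule i(2))
      moreover have "integrable lborel (\<lambda>y. (4 * f y * max 0 (1 - (norm (y - w))\<^sup>2)) *\<^sub>R (y - w) \<bullet> h)"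
        by (rule integrable_inner_left) (rule i(2))
      ultimately show ?thesis
        unfolding mollify_def
        by (simp only: Bochner_Integration.integral_diff Bochner_Integration.integrable_diff i(1))
    qed
    also have "\<dots> = (\<integral>y. ?r y \<partial>lborel)"
      by (intro Bochner_Integration.integral_cong refl) (simp add: algebra_simps)
    also have "\<bar>\<dots>\<bar> \<le> (\<integral>y. B * (27 * (norm h)\<^sup>2) * indicator (cball w 2) y \<partial>lborel)"
    proof -
      have bnd: "norm (?r y) \<le> B * (27 * (norm h)\<^sup>2) * indicator (cball w 2) y" for y
      proof -
        have "norm (?r y) \<le> B * (27 * (norm h)\<^sup>2 * indicator (cball 0 2) (y - w))"
          unfolding real_norm_def abs_mult using B bump_second_order[OF h, of "y - w"] B0 by (intro mult_mono) auto
        also have "indicator (cball 0 2) (y - w) = (indicator (cball w 2) y :: real)"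
          by (simp add: indicator_def dist_norm norm_minus_commute)
        finally show ?thesis by simp
      qed
      have int: "integrable lborel (\<lambda>y. B * (27 * (norm h)\<^sup>2) * indicator (cball w 2) y)"
        using emeasure_lborel_cball_finite[of w 2]
        by (intro integrable_mult_right) (simp add: integrable_indicator_iff)
      have "integrable lborel ?r"
        by (rule integrable_bounded_support[OF _ bnd]) measurable
      then have "norm (\<integral>y. ?r y \<partial>lborel) \<le> (\<integral>y. B * (27 * (norm h)\<^sup>2) * indicator (cball w 2) y \<partial>lborel)"
        by (rule Bochner_Integration.integral_norm_bound_integral[OF _ int]) (rule bnd)
      then show ?thesis by simp
    qed
    also have "\<dots> = M * (norm h)\<^sup>2" by (simp add: M_def)
    finally show ?thesis .
  qed
  fix e :: real assume e: "0 < e"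
  have "\<forall>\<^sub>F y in at w. dist y w < min 1 (e / (M + 1))"
    using e M by (intro eventually_at_in_open'[of "ball w (min 1 (e / (M + 1)))", THEN eventually_mono]) (auto simp: dist_commute)
  then show "\<forall>\<^sub>F y in at w. norm (mollify f y - mollify f w - mollify_grad f w \<bullet> (y - w)) \<le> e * norm (y - w)"
  proof eventually_elim
    case (elim y)
    have y: "norm (y - w) \<le> 1" "norm (y - w) \<le> e / (M + 1)" using elim by (auto simp: dist_norm)
    have "norm (mollify f y - mollify f w - mollify_grad f w \<bullet> (y - w)) \<le> M * (norm (y - w))\<^sup>2"
      using quad[OF y(1)] by simp
    also have "\<dots> \<le> (M * (e / (M + 1))) * norm (y - w)"
    proof -
      have "(M * norm (y - w)) * norm (y - w) \<le> (M * (e / (M + 1))) * norm (y - w)"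
        using y(2) M by (intro mult_right_mono mult_left_mono) auto
      then show ?thesis by (simp only: power2_eq_square mult.assoc)
    qed
    also have "\<dots> \<le> e * norm (y - w)"
    proof (rule mult_right_mono)
      have "M * e \<le> e * (M + 1)" using e by (simp add: algebra_simps)
      then show "M * (e / (M + 1)) \<le> e" using M by (simp add: divide_le_eq)
    qed simp
    finally show ?case .
  qed
qed

lemma continuous_on_mollify_grad:
  fixes f :: "'a::euclidean_space \<Rightarrow> real"
  assumes f [measurable]: "f \<in> borel_measurable borel" and B: "\<And>y. \<bar>f y\<bar> \<le> B"
  shows "continuous_on UNIV (mollify_grad f)"
  unfolding continuous_on_sequentially o_def
proof (intro allI ballI impI, elim conjE)
  fix x :: "nat \<Rightarrow> 'a" and w assume x: "x \<longlonglongrightarrow> w"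
  have B0: "0 \<le> B" using B[of undefined] by linarith
  obtain R where R: "\<And>n. norm (x n) \<le> R"
    using convergent_imp_Bseq[OF convergentI[OF x]] by (auto simp: Bseq_def)
  show "(\<lambda>n. mollify_grad f (x n)) \<longlonglongrightarrow> mollify_grad f w"
    unfolding mollify_grad_def
  proof (rule integral_dominated_convergence[where w = "\<lambda>y. 4 * B * indicator (cball 0 (R + 1)) y"])
    show "integrable lborel (\<lambda>y::'a. 4 * B * indicator (cball 0 (R + 1)) y :: real)"
      using emeasure_lborel_cball_finite[of "0::'a" "R + 1"]
      by (intro integrable_mult_right) (simp add: integrable_indicator_iff)
    show "AE y in lborel. (\<lambda>n. (4 * f y * max 0 (1 - (norm (y - x n))\<^sup>2)) *\<^sub>R (y - x n))
        \<longlonglongrightarrow> (4 * f y * max 0 (1 - (norm (y - w))\<^sup>2)) *\<^sub>R (y - w)"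
      by (intro AE_I2 tendsto_intros x)
    show "AE y in lborel. norm ((4 * f y * max 0 (1 - (norm (y - x n))\<^sup>2)) *\<^sub>R (y - x n)) \<le> 4 * B * indicator (cball 0 (R + 1)) y" for n
    proof (rule AE_I2)
      fix y
      show "norm ((4 * f y * max 0 (1 - (norm (y - x n))\<^sup>2)) *\<^sub>R (y - x n)) \<le> 4 * B * indicator (cball 0 (R + 1)) y"
      proof (cases "norm (y - x n) \<le> 1")
        case True
        then have "norm y \<le> R + 1" using R[of n] norm_triangle_ineq2[of y "x n"] by linarith
        moreover have "(4 * \<bar>f y\<bar> * \<bar>max 0 (1 - (norm (y - x n))\<^sup>2)\<bar>) * norm (y - x n) \<le> (4 * B * 1) * 1"
          using B B0 True by (intro mult_mono) auto
        ultimately show ?thesis by (simp add: abs_mult)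
      next
        case False
        then have "1 \<le> (norm (y - x n))\<^sup>2" by simp
        then show ?thesis using B0 by (simp add: max_def)
      qed
    qed
  qed measurable
qed

lemma integrable_bump: "integrable lborel bump"
  using integrable_mollify(1)[of "\<lambda>_. 1" 1 0] by simp

lemma integral_bump_pos: "0 < (\<integral>x. bump (x::'a::euclidean_space) \<partial>lborel)"
proof -
  have "9 / 16 * indicator (ball 0 (1 / 2)) x \<le> bump (x::'a)" for x
  proof (cases "x \<in> ball 0 (1 / 2)")
    case True
    then have "(norm x)\<^sup>2 \<le> (1 / 2)\<^sup>2" by (intro power_mono) auto
    then have "(3 / 4)\<^sup>2 \<le> (max 0 (1 - (norm x)\<^sup>2))\<^sup>2" by (intro power_mono) (auto simp: power2_eq_square)
    then show ?thesis using True by (simp add: bump_def pos_sq_def power2_eq_square)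
  qed (simp add: bump_nonneg)
  then have le: "(\<integral>x. 9 / 16 * indicator (ball 0 (1 / 2)) (x::'a) \<partial>lborel) \<le> (\<integral>x. bump (x::'a) \<partial>lborel)"
    using emeasure_lborel_ball_finite[of "0::'a" "1 / 2"]
    by (intro integral_mono integrable_bump integrable_mult_right) (auto simp: integrable_indicator_iff)
  have "0 < 9 / 16 * measure lborel (ball (0::'a) (1 / 2))"
    using content_ball_pos[of "1 / 2" "0::'a"] by simp
  also have "\<dots> = (\<integral>x. 9 / 16 * indicator (ball 0 (1 / 2)) (x::'a) \<partial>lborel)" by simp
  finally show ?thesis using le by (rule less_le_trans)
qed

lemma mollify_translate:
  fixes f :: "'a::euclidean_space \<Rightarrow> real"
  assumes [measurable]: "f \<in> borel_measurable borel"
  shows "mollify f w = (\<integral>u. f (w + u) * bump u \<partial>lborel)"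
proof -
  have "mollify f w = (\<integral>y. f y * bump (y - w) \<partial>distr lborel borel ((+) w))"
    by (simp add: mollify_def lborel_distr_plus)
  also have "\<dots> = (\<integral>u. f (w + u) * bump u \<partial>lborel)"
    by (subst integral_distr) auto
  finally show ?thesis .
qed

section \<open>Continuously differentiable functions and cutoffs\<close>

text \<open>The derivative is required to be continuous in each fixed direction, which in finite dimension is
the usual notion and avoids the space of linear maps.\<close>

definition C1_on :: "'a::real_normed_vector set \<Rightarrow> ('a \<Rightarrow> real) \<Rightarrow> bool" where
  "C1_on A f \<longleftrightarrow> (\<exists>f'. (\<forall>x\<in>A. (f has_derivative f' x) (at x)) \<and> (\<forall>v. continuous_on A (\<lambda>x. f' x v)))"

lemma C1_onI:
  "(\<And>x. x \<in> A \<Longrightarrow> (f has_derivative f' x) (at x)) \<Longrightarrow> (\<And>v. continuous_on A (\<lambda>x. f' x v)) \<Longrightarrow> C1_on A f"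
  by (auto simp: C1_on_def)

lemma C1_on_continuous: "C1_on A f \<Longrightarrow> continuous_on A f"
  by (auto simp: C1_on_def intro!: continuous_at_imp_continuous_on intro: has_derivative_continuous)

lemma C1_on_frechet:
  assumes "C1_on A f"
  shows "x \<in> A \<Longrightarrow> (f has_derivative frechet_derivative f (at x)) (at x)"
    and "continuous_on A (\<lambda>x. frechet_derivative f (at x) v)"
proof -
  obtain f' where f': "\<And>x. x \<in> A \<Longrightarrow> (f has_derivative f' x) (at x)" "\<And>v. continuous_on A (\<lambda>x. f' x v)"
    using assms by (auto simp: C1_on_def)
  have eq: "frechet_derivative f (at x) = f' x" if "x \<in> A" for x
    using frechet_derivative_at[OF f'(1)[OF that]] ..
  show "x \<in> A \<Longrightarrow> (f has_derivative frechet_derivative f (at x)) (at x)" using f' eq by simp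
  show "continuous_on A (\<lambda>x. frechet_derivative f (at x) v)"
    by (rule continuous_on_eq[OF f'(2)]) (simp add: eq)
qed

lemma C1_on_const: "C1_on A (\<lambda>_. c)"
  by (rule C1_onI[where f' = "\<lambda>_ _. 0"]) auto

lemma C1_on_bounded_linear: "bounded_linear f \<Longrightarrow> C1_on A f"
  by (rule C1_onI[where f' = "\<lambda>_. f"]) (auto intro: bounded_linear_imp_has_derivative)

lemma C1_on_mult:
  assumes "C1_on A f" "C1_on A g"
  shows "C1_on A (\<lambda>x. f x * g x)"
proof (rule C1_onI)
  fix x assume "x \<in> A"
  then show "((\<lambda>x. f x * g x) has_derivative (\<lambda>v. f x * frechet_derivative g (at x) v + frechet_derivative f (at x) v * g x)) (at x)"
    by (intro has_derivative_mult C1_on_frechet(1)[OF assms(1)] C1_on_frechet(1)[OF assms(2)])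
next
  fix v show "continuous_on A (\<lambda>x. f x * frechet_derivative g (at x) v + frechet_derivative f (at x) v * g x)"
    by (intro continuous_intros C1_on_continuous C1_on_frechet assms)
qed

lemma C1_on_prod: "(\<And>i. i \<in> I \<Longrightarrow> C1_on A (f i)) \<Longrightarrow> C1_on A (\<lambda>x. \<Prod>i\<in>I. f i x)"
  by (induction I rule: infinite_finite_induct) (auto intro: C1_on_const C1_on_mult)

lemma C1_on_real_compose:
  assumes f: "C1_on A f" and \<phi>: "\<And>x. (\<phi> has_real_derivative \<phi>' x) (at x)" "continuous_on UNIV \<phi>'"
  shows "C1_on A (\<lambda>x. \<phi> (f x))"
proof (rule C1_onI)
  fix x assume "x \<in> A"
  then show "((\<lambda>x. \<phi> (f x)) has_derivative (\<lambda>v. \<phi>' (f x) * frechet_derivative f (at x) v)) (at x)"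
    by (intro has_derivative_compose[OF C1_on_frechet(1)[OF f] \<phi>(1)[unfolded has_field_derivative_def]])
next
  fix v show "continuous_on A (\<lambda>x. \<phi>' (f x) * frechet_derivative f (at x) v)"
    by (intro continuous_intros continuous_on_compose2[OF \<phi>(2)] C1_on_continuous C1_on_frechet f) auto
qed

lemma C1_on_affine_compose:
  assumes "C1_on UNIV f"
  shows "C1_on A (\<lambda>x. f (c *\<^sub>R x + b))"
proof (rule C1_onI)
  fix x
  show "((\<lambda>x. f (c *\<^sub>R x + b)) has_derivative (\<lambda>v. frechet_derivative f (at (c *\<^sub>R x + b)) (c *\<^sub>R v))) (at x)"
    by (rule has_derivative_compose[OF _ C1_on_frechet(1)[OF assms]]) (auto intro!: derivative_eq_intros)
next
  fix v show "continuous_on A (\<lambda>x. frechet_derivative f (at (c *\<^sub>R x + b)) (c *\<^sub>R v))"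
    by (rule continuous_on_compose2[OF C1_on_frechet(2)[OF assms]]) (auto intro!: continuous_intros)
qed

text \<open>Monotonicity along a ray is easier to see than the sign of a derivative: it is how both the product
of the gaps and the mollified shrinkage functions are handled.\<close>

lemma has_derivative_nonneg_direction:
  fixes F :: "'a::real_normed_vector \<Rightarrow> real"
  assumes F: "(F has_derivative F') (at x)" and e: "0 < e"
    and mono: "\<And>t. 0 < t \<Longrightarrow> t < e \<Longrightarrow> F x \<le> F (x + t *\<^sub>R v)"
  shows "0 \<le> F' v"
proof (rule ccontr)
  assume "\<not> 0 \<le> F' v"
  then have neg: "F' v < 0" by simp
  have "((\<lambda>t. x + t *\<^sub>R v) has_derivative (\<lambda>t. t *\<^sub>R v)) (at 0)"
    by (auto intro!: derivative_eq_intros)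
  moreover have "(F has_derivative F') (at (x + 0 *\<^sub>R v))" using F by simp
  ultimately have "((\<lambda>t. F (x + t *\<^sub>R v)) has_derivative (\<lambda>t. F' (t *\<^sub>R v))) (at 0)"
    by (rule has_derivative_compose)
  then have "((\<lambda>t. F (x + t *\<^sub>R v)) has_real_derivative F' v) (at 0)"
    using linear_cmul[OF has_derivative_linear[OF F]] by (simp add: has_field_derivative_def mult.commute[of _ "F' v"])
  from DERIV_neg_dec_right[OF this neg] obtain d where d: "d > 0" "\<And>h. 0 < h \<Longrightarrow> h < d \<Longrightarrow> F (x + h *\<^sub>R v) < F x"
    by auto
  define t where "t = min d e / 2"
  have "0 < t" "t < d" "t < e" using d(1) e by (auto simp: t_def)
  then show False using d(2) mono by fastforce
qed

text \<open>A $C^1$ transition from 1 on the negative half-line to 0 on $[1,\infty)$, with derivative between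
$-4$ and 0.\<close>

definition step :: "real \<Rightarrow> real" where
  "step x = pos_sq (1 - pos_sq x)"

definition step_deriv :: "real \<Rightarrow> real" where
  "step_deriv x = - 4 * max 0 (1 - pos_sq x) * max 0 x"

lemma pos_sq_nonneg: "0 \<le> pos_sq x" and pos_sq_mono: "x \<le> y \<Longrightarrow> pos_sq x \<le> pos_sq y"
  by (auto simp: pos_sq_def intro!: power_mono)

lemma DERIV_step: "(step has_real_derivative step_deriv x) (at x)"
  unfolding step_def[abs_def] step_deriv_def
  by (rule DERIV_cong[OF DERIV_chain2[OF DERIV_pos_sq DERIV_diff[OF DERIV_const DERIV_pos_sq]]]) simp

lemma step_0: "x \<le> 0 \<Longrightarrow> step x = 1" and step_1: "1 \<le> x \<Longrightarrow> step x = 0"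
  and step_nonneg: "0 \<le> step x" and step_le_1: "step x \<le> 1"
  and step_antimono: "x \<le> y \<Longrightarrow> step y \<le> step x"
proof -
  show "x \<le> 0 \<Longrightarrow> step x = 1" by (simp add: step_def pos_sq_def)
  show "0 \<le> step x" by (simp add: step_def pos_sq_nonneg)
  show "x \<le> y \<Longrightarrow> step y \<le> step x" unfolding step_def by (intro pos_sq_mono diff_left_mono) 
  have "pos_sq (1 - pos_sq x) \<le> pos_sq 1" by (intro pos_sq_mono) (simp add: pos_sq_nonneg)
  then show "step x \<le> 1" by (simp add: step_def pos_sq_def)
  assume "1 \<le> x"
  then have "pos_sq 1 \<le> pos_sq x" by (rule pos_sq_mono)
  then have "max 0 (1 - pos_sq x) = 0" by (simp add: pos_sq_def)
  then show "step x = 0" by (simp add: step_def pos_sq_def)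
qed

lemma continuous_on_step_deriv: "continuous_on A step_deriv"
  unfolding step_deriv_def by (intro continuous_intros)

lemma step_deriv_bounds: "- 4 \<le> step_deriv x" "step_deriv x \<le> 0"
proof -
  have "max 0 (1 - pos_sq x) * max 0 x \<le> 1"
  proof (cases "x \<le> 1")
    case True
    then have "max 0 (1 - pos_sq x) * max 0 x \<le> 1 * 1"
      by (intro mult_mono) (auto simp: pos_sq_nonneg)
    then show ?thesis by simp
  next
    case False
    then have "pos_sq 1 \<le> pos_sq x" by (intro pos_sq_mono) simp
    then have "max 0 (1 - pos_sq x) = 0" by (simp add: pos_sq_def)
    then show ?thesis by simp
  qed
  then show "- 4 \<le> step_deriv x" by (simp add: step_deriv_def)
  show "step_deriv x \<le> 0" by (simp add: step_deriv_def mult_nonneg_nonneg)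
qed

text \<open>On the closed cone this vanishes exactly at the boundary, so one function detects all walls, and
\<open>wall_product_mono\<close> shows that it grows in every nonnegative decreasing direction.\<close>

definition wall_product :: "'p::{finite,linorder} rvec \<Rightarrow> real" where
  "wall_product l = (\<Prod>(i, j)\<in>{(i, j). i < j}. l $ i - l $ j) * (\<Prod>i\<in>UNIV. l $ i)"

text \<open>The first factor is 0 where \<open>wall_product\<close> is at most $1/n$ and 1 where it is at least $2/n$; the
second decreases from 1 to 0 while $\sum_k\ell_k$ grows from $n$ to $2n$.\<close>

definition cutoff :: "real \<Rightarrow> 'p::{finite,linorder} rvec \<Rightarrow> real" where
  "cutoff n l = (1 - step (n * wall_product l - 1)) * step ((\<Sum>k\<in>UNIV. l $ k) / n - 1)"

lemma C1_on_1_minus: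
  assumes "C1_on A f" shows "C1_on A (\<lambda>x. 1 - f x)"
  by (rule C1_on_real_compose[OF assms, where \<phi>' = "\<lambda>_. - 1"]) (auto intro!: derivative_eq_intros)

lemma C1_wall_product: "C1_on A wall_product"
  unfolding wall_product_def[abs_def] case_prod_unfold
  by (intro C1_on_mult C1_on_prod C1_on_bounded_linear bounded_linear_sub bounded_linear_vec_nth)

lemma DERIV_step_affine:
  "((\<lambda>x. step (a * x - 1)) has_real_derivative a * step_deriv (a * x - 1)) (at x)"
proof -
  have "((\<lambda>x. a * x - 1) has_real_derivative a) (at x)" by (auto intro!: derivative_eq_intros)
  from DERIV_chain2[OF DERIV_step this] show ?thesis by (simp add: mult.commute)
qed

lemma C1_wall_factor: "C1_on A (\<lambda>l. 1 - step (n * wall_product l - 1))"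
  by (intro C1_on_1_minus C1_on_real_compose[OF C1_wall_product DERIV_step_affine])
     (intro continuous_intros continuous_on_compose2[OF continuous_on_step_deriv], auto)

lemma wall_product_mono:
  assumes l: "l \<in> decreasing_positive"
    and v: "\<And>i. 0 \<le> v $ i" "\<And>i j. i < j \<Longrightarrow> v $ j \<le> v $ i"
  shows "wall_product l \<le> wall_product (l + v)"
proof -
  have 1: "0 \<le> l $ i - l $ j" "l $ i - l $ j \<le> (l + v) $ i - (l + v) $ j" if "i < j" for i j
    using that l v(2)[OF that] by (auto simp: decreasing_positive_def less_imp_le)
  have 3: "l $ j + v $ j \<le> l $ i + v $ i" if "i < j" for i j
    using 1(1)[OF that] v(2)[OF that] by simp
  have 2: "0 \<le> l $ i" "l $ i \<le> (l + v) $ i" for i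
    using l v(1)[of i] by (auto simp: decreasing_positive_def less_imp_le)
  show ?thesis
    unfolding wall_product_def
    by (intro mult_mono prod_mono prod_nonneg) (use 1 2 3 in \<open>auto intro: order_trans\<close>)
qed

lemma wall_product_pos: "l \<in> decreasing_positive \<Longrightarrow> 0 < wall_product l"
  unfolding wall_product_def by (intro mult_pos_pos prod_pos) (auto simp: decreasing_positive_def)

lemma cutoff_bounds: "0 \<le> cutoff n l" "cutoff n l \<le> 1"
  using step_nonneg step_le_1 by (auto simp: cutoff_def intro!: mult_nonneg_nonneg mult_le_one)

lemma C1_cutoff: "C1_on A (cutoff n)"
proof -
  have "bounded_linear (\<lambda>l. \<Sum>k\<in>UNIV. l $ k :: real)"
    by (intro bounded_linear_sum bounded_linear_vec_nth)
  note lin = this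
  have "continuous_on UNIV (\<lambda>x. (1 / n) * step_deriv ((1 / n) * x - 1))"
    by (intro continuous_intros continuous_on_compose2[OF continuous_on_step_deriv[of UNIV]]) auto
  from C1_on_real_compose[OF C1_on_bounded_linear[OF lin] DERIV_step_affine this]
  have "C1_on A (\<lambda>l. step ((1 / n) * (\<Sum>k\<in>UNIV. l $ k) - 1))" .
  then show ?thesis
    unfolding cutoff_def[abs_def] by (intro C1_on_mult C1_wall_factor) simp
qed

text \<open>Along a nonnegative decreasing vector the factor near the walls increases, so only the factor at
infinity can contribute negatively, and its derivative is at least $-4/n$.\<close>

lemma cutoff_directional:
  fixes l v :: "'p::{finite,linorder} rvec"
  assumes l: "l \<in> decreasing_positive" and n: "0 < n"
    and v: "\<And>i. 0 \<le> v $ i" "\<And>i j. i < j \<Longrightarrow> v $ j \<le> v $ i"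
    and D: "(cutoff n has_derivative D) (at l)"
  shows "- 4 / n * (\<Sum>k\<in>UNIV. v $ k) \<le> D v"
proof -
  define a where "a l = 1 - step (n * wall_product l - 1)" for l :: "'p rvec"
  define b where "b l = step ((\<Sum>k\<in>UNIV. l $ k) / n - 1)" for l :: "'p rvec"
  have a: "(a has_derivative frechet_derivative a (at l)) (at l)"
    using C1_on_frechet(1)[OF C1_wall_factor[of UNIV n]] by (simp add: a_def[abs_def])
  have "((\<lambda>l. (1 / n) * (\<Sum>k\<in>UNIV. l $ k) - 1) has_derivative (\<lambda>v. (1 / n) * (\<Sum>k\<in>UNIV. v $ k))) (at l)"
    using n by (auto intro!: derivative_eq_intros bounded_linear.has_derivative[OF bounded_linear_vec_nth])
  from has_derivative_compose[OF this DERIV_step[unfolded has_field_derivative_def]]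
  have b: "(b has_derivative (\<lambda>v. step_deriv ((\<Sum>k\<in>UNIV. l $ k) / n - 1) * ((1 / n) * (\<Sum>k\<in>UNIV. v $ k)))) (at l)"
    by (simp add: b_def[abs_def])
  have "((\<lambda>l. a l * b l) has_derivative
     (\<lambda>v. a l * (step_deriv ((\<Sum>k\<in>UNIV. l $ k) / n - 1) * ((1 / n) * (\<Sum>k\<in>UNIV. v $ k))) + frechet_derivative a (at l) v * b l)) (at l)"
    by (rule has_derivative_mult[OF a b])
  then have D_eq: "D = (\<lambda>v. a l * (step_deriv ((\<Sum>k\<in>UNIV. l $ k) / n - 1) * ((1 / n) * (\<Sum>k\<in>UNIV. v $ k))) + frechet_derivative a (at l) v * b l)"
    using D by (intro has_derivative_unique[of "cutoff n"]) (simp_all add: cutoff_def[abs_def] a_def[abs_def] b_def[abs_def])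
  have "0 \<le> frechet_derivative a (at l) v"
  proof (rule has_derivative_nonneg_direction[OF a zero_less_one])
    fix t :: real assume t: "0 < t"
    have "wall_product l \<le> wall_product (l + t *\<^sub>R v)"
      using t v by (intro wall_product_mono l) (auto intro: mult_left_mono)
    then show "a l \<le> a (l + t *\<^sub>R v)"
      unfolding a_def using n by (intro diff_left_mono step_antimono) simp
  qed
  then have "0 \<le> frechet_derivative a (at l) v * b l"
    by (simp add: b_def step_nonneg)
  moreover have "- (4 / n * (\<Sum>k\<in>UNIV. v $ k)) \<le> a l * (step_deriv ((\<Sum>k\<in>UNIV. l $ k) / n - 1) * ((1 / n) * (\<Sum>k\<in>UNIV. v $ k)))"
  proof -
    define s where "s = (1 / n) * (\<Sum>k\<in>UNIV. v $ k)"
    have s: "0 \<le> s" unfolding s_def using v n by (intro mult_nonneg_nonneg sum_nonneg) auto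
    define d where "d = step_deriv ((\<Sum>k\<in>UNIV. l $ k) / n - 1)"
    have "- d \<le> 4" "0 \<le> - d"
      using step_deriv_bounds[of "(\<Sum>k\<in>UNIV. l $ k) / n - 1"] by (simp_all add: d_def)
    then have "a l * (- d) \<le> 1 * 4"
      using step_nonneg by (intro mult_mono) (auto simp: a_def)
    then have "(a l * (- d)) * s \<le> 4 * s" using s by (intro mult_right_mono) auto
    then show ?thesis unfolding d_def[symmetric] s_def[symmetric] by (simp add: s_def algebra_simps)
  qed
  ultimately show ?thesis unfolding D_eq by simp
qed

lemma cutoff_support:
  assumes n: "0 < n"
  obtains K where "compact K" "K \<subseteq> (decreasing_positive :: ('p::{finite,linorder} rvec) set)"
    "\<And>l. l \<in> decreasing_positive \<Longrightarrow> l \<notin> K \<Longrightarrow> cutoff n l = 0"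
proof -
  define C where "C = {l :: 'p rvec. (\<forall>i j. i < j \<longrightarrow> l $ j \<le> l $ i) \<and> (\<forall>i. 0 \<le> l $ i)}"
  define K where "K = {l \<in> C. 1 / n \<le> wall_product l \<and> (\<Sum>k\<in>UNIV. l $ k) \<le> 2 * n}"
  have cw: "continuous_on UNIV (wall_product :: 'p rvec \<Rightarrow> real)"
    by (rule C1_on_continuous[OF C1_wall_product])
  have "closed C"
  proof -
    have "C = (\<Inter>i. \<Inter>j. {l. i < j \<longrightarrow> l $ j \<le> l $ i}) \<inter> (\<Inter>i. {l. 0 \<le> l $ i})"
      by (auto simp: C_def)
    moreover have "closed {l :: 'p rvec. i < j \<longrightarrow> l $ j \<le> l $ i}" for i j
      by (cases "i < j") (auto intro!: closed_Collect_le continuous_intros)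
    moreover have "closed {l :: 'p rvec. 0 \<le> l $ i}" for i
      by (intro closed_Collect_le continuous_intros)
    ultimately show ?thesis by (simp add: closed_INT closed_Int)
  qed
  moreover have "K = C \<inter> {l. 1 / n \<le> wall_product l} \<inter> {l. (\<Sum>k\<in>UNIV. l $ k) \<le> 2 * n}" by (auto simp: K_def)
  ultimately have "closed K"
    by (auto intro!: closed_Int closed_Collect_le continuous_intros cw)
  moreover have "norm l \<le> 2 * n" if "l \<in> K" for l
  proof -
    have "norm l \<le> (\<Sum>k\<in>UNIV. norm (l $ k))" by (rule norm_vec_le_sum)
    also have "\<dots> = (\<Sum>k\<in>UNIV. l $ k)" using that by (intro sum.cong) (auto simp: K_def C_def)
    also have "\<dots> \<le> 2 * n" using that by (simp add: K_def)
    finally show ?thesis .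
  qed
  then have "bounded K" by (auto simp: bounded_iff)
  ultimately have "compact K" by (simp add: compact_eq_bounded_closed)
  moreover have "K \<subseteq> decreasing_positive"
  proof
    fix l assume l: "l \<in> K"
    then have "0 < 1 / n" "1 / n \<le> wall_product l" using n by (auto simp: K_def)
    then have "wall_product l \<noteq> 0" by linarith
    then have "(\<Prod>(i, j)\<in>{(i, j). i < j}. l $ i - l $ j) \<noteq> 0" "(\<Prod>i\<in>UNIV. l $ i) \<noteq> 0"
      by (auto simp: wall_product_def)
    then have nz: "i < j \<Longrightarrow> l $ i - l $ j \<noteq> 0" "l $ i \<noteq> 0" for i j
      by (auto simp: prod_zero_iff)
    have "l $ j < l $ i" if "i < j" for i j
      using nz(1)[OF that] l that by (auto simp: K_def C_def less_le)
    moreover have "0 < l $ i" for i using nz(2)[of i] l by (auto simp: K_def C_def less_le)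
    ultimately show "l \<in> decreasing_positive" by (auto simp: decreasing_positive_def)
  qed
  moreover have "cutoff n l = 0" if "l \<in> decreasing_positive" "l \<notin> K" for l
  proof -
    have "l \<in> C" using that(1) by (auto simp: C_def decreasing_positive_def less_imp_le)
    then have "\<not> (1 / n \<le> wall_product l \<and> (\<Sum>k\<in>UNIV. l $ k) \<le> 2 * n)"
      using that(2) by (simp add: K_def)
    then consider "wall_product l < 1 / n" | "2 * n < (\<Sum>k\<in>UNIV. l $ k)" by linarith
    then show ?thesis
    proof cases
      case 1
      then have "n * wall_product l - 1 \<le> 0" using n by (simp add: field_simps)
      then show ?thesis by (simp add: cutoff_def step_0)
    next
      case 2
      then have "1 \<le> (\<Sum>k\<in>UNIV. l $ k) / n - 1" using n by (simp add: field_simps)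
      then show ?thesis by (simp add: cutoff_def step_1)
    qed
  qed
  ultimately show thesis by (rule that)
qed

lemma cutoff_tendsto_1:
  assumes l: "l \<in> decreasing_positive"
  shows "(\<lambda>n. cutoff (real (Suc n)) l) \<longlonglongrightarrow> 1"
proof (rule tendsto_eventually)
  have "\<forall>\<^sub>F n in sequentially. 2 / wall_product l \<le> real (Suc n)"
    by (rule eventually_sequentiallyI[of "nat \<lceil>2 / wall_product l\<rceil>"]) linarith
  moreover have "\<forall>\<^sub>F n in sequentially. (\<Sum>k\<in>UNIV. l $ k) \<le> real (Suc n)"
    by (rule eventually_sequentiallyI[of "nat \<lceil>\<Sum>k\<in>UNIV. l $ k\<rceil>"]) linarith
  ultimately show "\<forall>\<^sub>F n in sequentially. cutoff (real (Suc n)) l = 1"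
  proof eventually_elim
    case (elim n)
    have "1 \<le> real (Suc n) * wall_product l - 1"
      using elim(1) wall_product_pos[OF l] by (simp add: field_simps)
    moreover have "(\<Sum>k\<in>UNIV. l $ k) / real (Suc n) - 1 \<le> 0" using elim(2) by (simp add: divide_le_eq)
    ultimately show ?case by (simp add: cutoff_def step_0 step_1)
  qed
qed

section \<open>Smoothing the shrinkage functions\<close>

lemma decreasing_positive_scaleR: "0 < c \<Longrightarrow> c *\<^sub>R l \<in> decreasing_positive \<longleftrightarrow> l \<in> decreasing_positive"
  by (simp add: decreasing_positive_def zero_less_mult_iff)

lemma integrable_mollify_translate:
  fixes f :: "'a::euclidean_space \<Rightarrow> real"
  assumes [measurable]: "f \<in> borel_measurable borel" and B: "\<And>y. \<bar>f y\<bar> \<le> B"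
  shows "integrable lborel (\<lambda>u. f (w + u) * bump u)"
  using integrable_mollify(1)[of "\<lambda>u. f (w + u)" B 0] B by simp

text \<open>All order properties of the mollified functions follow from this comparison, in which only values of
$f$ and $g$ in the unit balls around $w$ and $w'$ matter.\<close>

lemma mollify_mono:
  fixes f g :: "'a::euclidean_space \<Rightarrow> real"
  assumes f: "f \<in> borel_measurable borel" "\<And>y. \<bar>f y\<bar> \<le> B"
    and g: "g \<in> borel_measurable borel" "\<And>y. \<bar>g y\<bar> \<le> C"
    and le: "\<And>u. norm u \<le> 1 \<Longrightarrow> f (w + u) \<le> g (w' + u)"
  shows "mollify f w \<le> mollify g w'"
  unfolding mollify_translate[OF f(1)] mollify_translate[OF g(1)]
proof (rule integral_mono)
  fix u
  show "f (w + u) * bump u \<le> g (w' + u) * bump u"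
    using le[of u] bump_nonneg[of u] bump_eq_0[of u] by (cases "norm u \<le> 1") (auto intro: mult_right_mono)
qed (use integrable_mollify_translate f g in blast)+

lemma mollify_const: "mollify (\<lambda>_. c) (w::'a::euclidean_space) = c * (\<integral>x. bump (x::'a) \<partial>lborel)"
  by (simp add: mollify_translate)

text \<open>Conditions (i)--(iii), with an arbitrary upper bound $b$.\<close>

locale monotone_shrinkage =
  fixes \<gamma> :: "'p::{finite,linorder} \<Rightarrow> 'p rvec \<Rightarrow> real" and b :: real
  assumes diff: "\<And>k. \<gamma> k differentiable_on decreasing_positive"
    and bounds: "\<And>k l. l \<in> decreasing_positive \<Longrightarrow> 0 \<le> \<gamma> k l \<and> \<gamma> k l \<le> b"
    and monotone_in_own: "\<And>k l. l \<in> decreasing_positive \<Longrightarrow> 0 \<le> partial_deriv (\<gamma> k) k l"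
    and ordered: "\<And>i j l. l \<in> decreasing_positive \<Longrightarrow> i \<le> j \<Longrightarrow> \<gamma> j l \<le> \<gamma> i l"
begin

lemma continuous_on_\<gamma>: "continuous_on decreasing_positive (\<gamma> k)"
  by (rule differentiable_imp_continuous_on[OF diff])

text \<open>The segment stays in the cone by convexity, and the derivative along it is the partial derivative of
condition (ii).\<close>

lemma \<gamma>_mono:
  assumes l: "l \<in> decreasing_positive" "l + t *\<^sub>R axis k 1 \<in> decreasing_positive" and t: "0 \<le> t"
  shows "\<gamma> k l \<le> \<gamma> k (l + t *\<^sub>R axis k 1)"
proof -
  have seg: "l + s *\<^sub>R axis k 1 \<in> decreasing_positive" if "0 \<le> s" "s \<le> t" for s
  proof -
    have "0 < (l + s *\<^sub>R axis k 1) $ i" for i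
      using l(1) that by (auto simp: decreasing_positive_def axis_def add_pos_nonneg)
    moreover have "(l + s *\<^sub>R axis k 1) $ j < (l + s *\<^sub>R axis k 1) $ i" if "i < j" for i j
    proof -
      have "l $ j < l $ i" "(l + t *\<^sub>R axis k 1) $ j < (l + t *\<^sub>R axis k 1) $ i"
        using l that by (auto simp: decreasing_positive_def)
      then show ?thesis using \<open>0 \<le> s\<close> \<open>s \<le> t\<close> that by (auto simp: axis_def split: if_splits)
    qed
    ultimately show ?thesis by (simp add: decreasing_positive_def)
  qed
  have "\<exists>y. ((\<lambda>s. \<gamma> k (l + s *\<^sub>R axis k 1)) has_real_derivative y) (at s) \<and> 0 \<le> y" if "0 \<le> s" "s \<le> t" for s
  proof -
    define m where "m = l + s *\<^sub>R axis k 1"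
    have m: "m \<in> decreasing_positive" using seg[OF that] by (simp add: m_def)
    then obtain D where D: "(\<gamma> k has_derivative D) (at m)"
      using diff[of k] at_within_open[OF m open_decreasing_positive]
      unfolding differentiable_on_def differentiable_def by metis
    have line: "((\<lambda>x. \<gamma> k (m + (x - c) *\<^sub>R axis k 1)) has_real_derivative D (axis k 1)) (at c)" for c
    proof -
      have "((\<lambda>x. m + (x - c) *\<^sub>R axis k 1) has_derivative (\<lambda>h. h *\<^sub>R axis k 1)) (at c)"
        by (auto intro!: derivative_eq_intros)
      moreover have "(\<gamma> k has_derivative D) (at (m + (c - c) *\<^sub>R axis k 1))" using D by simp
      ultimately have "((\<lambda>x. \<gamma> k (m + (x - c) *\<^sub>R axis k 1)) has_derivative (\<lambda>h. D (h *\<^sub>R axis k 1))) (at c)"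
        by (rule has_derivative_compose)
      then show ?thesis
        using linear_cmul[OF has_derivative_linear[OF D]]
        by (simp add: has_field_derivative_def mult.commute[of _ "D (axis k 1)"])
    qed
    have "(\<chi> j. if j = k then x else m $ j) = m + (x - m $ k) *\<^sub>R axis k 1" for x
      by (simp add: vec_eq_iff axis_def)
    then have "partial_deriv (\<gamma> k) k m = D (axis k 1)"
      unfolding partial_deriv_def using DERIV_imp_deriv[OF line[of "m $ k"]] by simp
    then have "0 \<le> D (axis k 1)" using monotone_in_own[OF m, of k] by simp
    moreover have "((\<lambda>x. \<gamma> k (l + x *\<^sub>R axis k 1)) has_real_derivative D (axis k 1)) (at s)"
      using line[of s] by (simp add: m_def scaleR_left_diff_distrib)
    ultimately show ?thesis by blast
  qed
  then have "\<gamma> k (l + 0 *\<^sub>R axis k 1) \<le> \<gamma> k (l + t *\<^sub>R axis k 1)"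
    by (intro DERIV_nonneg_imp_nondecreasing[OF t]) blast
  then show ?thesis by simp
qed

text \<open>Rescaling the argument replaces mollification at scale $1/n$ by mollification at scale 1; since the
cone is invariant under scaling, its indicator does not change.\<close>

definition extended :: "real \<Rightarrow> 'p::{finite,linorder} \<Rightarrow> 'p rvec \<Rightarrow> real" where
  "extended n k y = indicator decreasing_positive y *\<^sub>R \<gamma> k (y /\<^sub>R n)"

text \<open>The unit ball around this point lies in the cone, because all its gaps are at least 3. Shifting by
it moves the averaging region into the cone: at $l$, the value \<open>smoothed n k l\<close> averages $\gamma_k$
over the points $l + (\mathrm{base} + u)/n$ with $|u| \le 1$.\<close>

definition base :: "'p::{finite,linorder} rvec" where
  "base = (\<chi> k. 3 * (real CARD('p) - real (rank_of k)))"

definition smoothed :: "real \<Rightarrow> 'p::{finite,linorder} \<Rightarrow> 'p rvec \<Rightarrow> real" where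
  "smoothed n k l = mollify (extended n k) (n *\<^sub>R l + base) * inverse (\<integral>x. bump (x :: 'p rvec) \<partial>lborel)"

lemma base_shift:
  assumes l: "l \<in> decreasing_positive" and n: "0 < n" and u: "norm u \<le> 1"
  shows "n *\<^sub>R l + base + u \<in> decreasing_positive"
proof -
  have c: "\<bar>u $ i\<bar> \<le> 1" for i using component_le_norm_cart[of u i] u by linarith
  have "0 < (n *\<^sub>R l + base + u) $ i" for i
  proof -
    have "0 < n * l $ i" using l n by (simp add: decreasing_positive_def)
    moreover have "3 \<le> base $ i" using rank_of_less_CARD[of i] by (simp add: base_def)
    ultimately show ?thesis using c[of i] by simp
  qed
  moreover have "(n *\<^sub>R l + base + u) $ j < (n *\<^sub>R l + base + u) $ i" if "i < j" for i j
  proof -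
    have "n * l $ j < n * l $ i" using l n that by (simp add: decreasing_positive_def)
    moreover have "base $ j + 3 \<le> base $ i" using rank_of_strict_mono[OF that] by (simp add: base_def)
    ultimately show ?thesis using c[of i] c[of j] by simp
  qed
  ultimately show ?thesis by (simp add: decreasing_positive_def)
qed

context
  fixes n :: real
  assumes n: "0 < n"
begin

lemma b_nonneg: "0 \<le> b"
proof -
  have "(base :: 'p::{finite,linorder} rvec) \<in> decreasing_positive"
    using rank_of_less_CARD by (auto simp: decreasing_positive_def base_def rank_of_strict_mono)
  then show ?thesis using bounds by (meson order_trans)
qed

lemma extended_bounds: "0 \<le> extended n k y" "extended n k y \<le> b"
  using bounds[of "y /\<^sub>R n" k] decreasing_positive_scaleR[of "inverse n" y] n b_nonneg
  by (auto simp: extended_def indicator_def)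

lemma extended_measurable: "extended n k \<in> borel_measurable borel"
  unfolding extended_def[abs_def]
proof (rule borel_measurable_continuous_on_indicator)
  show "continuous_on decreasing_positive (\<lambda>y. \<gamma> k (y /\<^sub>R n))"
    by (rule continuous_on_compose2[OF continuous_on_\<gamma>])
       (use n decreasing_positive_scaleR[of "inverse n"] in \<open>auto intro!: continuous_intros\<close>)
qed (rule borel_open[OF open_decreasing_positive])

lemma extended_abs: "\<bar>extended n k y\<bar> \<le> b"
  using extended_bounds[of k y] by simp

lemma extended_shift:
  assumes l: "l \<in> decreasing_positive" and u: "norm u \<le> 1"
  shows "extended n k (n *\<^sub>R l + base + u) = \<gamma> k (l + (base + u) /\<^sub>R n)"
    and "l + (base + u) /\<^sub>R n \<in> decreasing_positive"
proof -
  have eq: "(n *\<^sub>R l + base + u) /\<^sub>R n = l + (base + u) /\<^sub>R n"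
    using n by (simp add: scaleR_add_right)
  show "extended n k (n *\<^sub>R l + base + u) = \<gamma> k (l + (base + u) /\<^sub>R n)"
    using base_shift[OF l n u] by (simp only: extended_def eq indicator_simps scaleR_one)
  show "l + (base + u) /\<^sub>R n \<in> decreasing_positive"
    using base_shift[OF l n u] n by (simp add: decreasing_positive_scaleR flip: eq)
qed

lemma bump_integral: "0 < inverse (\<integral>x. bump (x :: 'p::{finite,linorder} rvec) \<partial>lborel)"
  "c * (\<integral>x. bump (x :: 'p rvec) \<partial>lborel) * inverse (\<integral>x. bump (x :: 'p rvec) \<partial>lborel) = c"
  using integral_bump_pos[where 'a = "'p rvec"] by auto

lemma smoothed_le:
  assumes l: "l \<in> decreasing_positive" and le: "\<And>u. norm u \<le> 1 \<Longrightarrow> \<gamma> k (l + (base + u) /\<^sub>R n) \<le> c"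
  shows "smoothed n k l \<le> c"
proof -
  have "mollify (extended n k) (n *\<^sub>R l + base) \<le> mollify (\<lambda>_. c) (0 :: 'p::{finite,linorder} rvec)"
    by (rule mollify_mono[where B = b and C = "\<bar>c\<bar>"])
       (use extended_measurable extended_abs extended_shift[OF l] le in auto)
  then have "smoothed n k l \<le> mollify (\<lambda>_. c) (0 :: 'p rvec) * inverse (\<integral>x. bump (x :: 'p rvec) \<partial>lborel)"
    unfolding smoothed_def by (rule mult_right_mono) (rule less_imp_le[OF bump_integral(1)])
  then show ?thesis by (simp only: mollify_const bump_integral(2))
qed

lemma smoothed_ge:
  assumes l: "l \<in> decreasing_positive" and le: "\<And>u. norm u \<le> 1 \<Longrightarrow> c \<le> \<gamma> k (l + (base + u) /\<^sub>R n)"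
  shows "c \<le> smoothed n k l"
proof -
  have "mollify (\<lambda>_. c) (0 :: 'p::{finite,linorder} rvec) \<le> mollify (extended n k) (n *\<^sub>R l + base)"
    by (rule mollify_mono[where B = "\<bar>c\<bar>" and C = b])
       (use extended_measurable extended_abs extended_shift[OF l] le in auto)
  then have "mollify (\<lambda>_. c) (0 :: 'p rvec) * inverse (\<integral>x. bump (x :: 'p rvec) \<partial>lborel) \<le> smoothed n k l"
    unfolding smoothed_def by (rule mult_right_mono) (rule less_imp_le[OF bump_integral(1)])
  then show ?thesis by (simp only: mollify_const bump_integral(2))
qed

lemma smoothed_bounds:
  assumes l: "l \<in> decreasing_positive"
  shows "0 \<le> smoothed n k l" "smoothed n k l \<le> b"
  using bounds extended_shift(2)[OF l] by (auto intro!: smoothed_ge smoothed_le l)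

lemma smoothed_ordered:
  assumes l: "l \<in> decreasing_positive" and "i < j"
  shows "smoothed n j l \<le> smoothed n i l"
proof -
  have "mollify (extended n j) (n *\<^sub>R l + base) \<le> mollify (extended n i) (n *\<^sub>R l + base)"
    by (rule mollify_mono[where B = b and C = b])
       (use extended_measurable extended_abs extended_shift[OF l] ordered[of _ i j] \<open>i < j\<close> in auto)
  then show ?thesis unfolding smoothed_def by (rule mult_right_mono) (rule less_imp_le[OF bump_integral(1)])
qed

lemma smoothed_mono:
  assumes l: "l \<in> decreasing_positive" "l + t *\<^sub>R axis k 1 \<in> decreasing_positive" and t: "0 \<le> t"
  shows "smoothed n k l \<le> smoothed n k (l + t *\<^sub>R axis k 1)"
proof -
  have "mollify (extended n k) (n *\<^sub>R l + base) \<le> mollify (extended n k) (n *\<^sub>R (l + t *\<^sub>R axis k 1) + base)"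
  proof (rule mollify_mono[where B = b and C = b])
    fix u :: "'p::{finite,linorder} rvec" assume u: "norm u \<le> 1"
    have eq: "l + t *\<^sub>R axis k 1 + (base + u) /\<^sub>R n = (l + (base + u) /\<^sub>R n) + t *\<^sub>R axis k 1" by simp
    have "\<gamma> k (l + (base + u) /\<^sub>R n) \<le> \<gamma> k (l + t *\<^sub>R axis k 1 + (base + u) /\<^sub>R n)"
      using extended_shift(2)[OF l(1) u] extended_shift(2)[OF l(2) u] t unfolding eq by (rule \<gamma>_mono)
    then show "extended n k (n *\<^sub>R l + base + u) \<le> extended n k (n *\<^sub>R (l + t *\<^sub>R axis k 1) + base + u)"
      by (simp only: extended_shift(1)[OF l(1) u] extended_shift(1)[OF l(2) u])
  qed (use extended_measurable extended_abs in auto)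
  then show ?thesis unfolding smoothed_def by (rule mult_right_mono) (rule less_imp_le[OF bump_integral(1)])
qed

lemma C1_smoothed: "C1_on A (smoothed n k)"
proof -
  have "C1_on UNIV (mollify (extended n k))"
  proof (rule C1_onI)
    fix w show "(mollify (extended n k) has_derivative (\<lambda>h. mollify_grad (extended n k) w \<bullet> h)) (at w)"
      by (rule has_derivative_mollify[OF extended_measurable extended_abs])
    fix v show "continuous_on UNIV (\<lambda>w. mollify_grad (extended n k) w \<bullet> v)"
      by (intro continuous_intros continuous_on_mollify_grad[OF extended_measurable extended_abs])
  qed
  then show ?thesis
    unfolding smoothed_def[abs_def] by (intro C1_on_mult C1_on_const C1_on_affine_compose)
qed

lemma smoothed_own_deriv:
  assumes l: "l \<in> decreasing_positive" and D: "(smoothed n k has_derivative D) (at l)"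
  shows "0 \<le> D (axis k 1)"
proof -
  obtain e where e: "0 < e" "ball l e \<subseteq> decreasing_positive"
    using open_decreasing_positive l by (meson open_contains_ball)
  show ?thesis
  proof (rule has_derivative_nonneg_direction[OF D e(1)])
    fix t :: real assume t: "0 < t" "t < e"
    then have "l + t *\<^sub>R axis k 1 \<in> ball l e" by (simp add: dist_norm norm_axis_1)
    then show "smoothed n k l \<le> smoothed n k (l + t *\<^sub>R axis k 1)"
      using e(2) t l by (intro smoothed_mono) auto
  qed
qed

definition truncated :: "'p::{finite,linorder} \<Rightarrow> 'p rvec \<Rightarrow> real" where
  "truncated k l = cutoff n l * smoothed n k l"

lemma C1_truncated: "C1_on A (truncated k)"
  unfolding truncated_def[abs_def] by (intro C1_on_mult C1_cutoff C1_smoothed)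

text \<open>With $v_k$ the smoothed functions and $\chi$ the cutoff,
$\sum_k\partial(\chi v_k)/\partial\ell_k = \chi\sum_k\partial v_k/\partial\ell_k + D\chi(v)$. The
first term is nonnegative by (ii); the second is bounded below by \<open>cutoff_directional\<close>, which
applies because of (i) and (iii).\<close>

lemma truncated_divergence:
  assumes l: "l \<in> decreasing_positive"
  shows "- (4 * real CARD('p::{finite,linorder}) * b / n) \<le> (\<Sum>k\<in>UNIV. frechet_derivative (truncated k) (at l) (axis k 1))"
proof -
  define D where "D = frechet_derivative (cutoff n :: 'p rvec \<Rightarrow> real) (at l)"
  define E where "E k = frechet_derivative (smoothed n k) (at l)" for k
  have D: "(cutoff n has_derivative D) (at l)"
    unfolding D_def by (rule C1_on_frechet(1)[OF C1_cutoff[of UNIV]]) simp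
  have E: "(smoothed n k has_derivative E k) (at l)" for k
    unfolding E_def by (rule C1_on_frechet(1)[OF C1_smoothed[of UNIV]]) simp
  have "(truncated k has_derivative (\<lambda>v. cutoff n l * E k v + D v * smoothed n k l)) (at l)" for k
    unfolding truncated_def[abs_def] by (rule has_derivative_mult[OF D E])
  then have T: "frechet_derivative (truncated k) (at l) = (\<lambda>v. cutoff n l * E k v + D v * smoothed n k l)" for k
    by (rule frechet_derivative_at[symmetric])
  define v where "v = (\<chi> k. smoothed n k l)"
  have "(\<Sum>k\<in>UNIV. v $ k) \<le> (\<Sum>k\<in>(UNIV :: 'p set). b)"
    by (intro sum_mono) (simp add: v_def smoothed_bounds[OF l])
  then have "4 / n * (\<Sum>k\<in>UNIV. v $ k) \<le> 4 / n * (real CARD('p) * b)"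
    using n by (intro mult_left_mono) auto
  moreover have "- 4 / n * (\<Sum>k\<in>UNIV. v $ k) \<le> D v"
    by (rule cutoff_directional[OF l n _ _ D]) (simp_all add: v_def smoothed_bounds[OF l] smoothed_ordered[OF l])
  ultimately have "- (4 * real CARD('p) * b / n) \<le> D v" by simp
  also have "D v = (\<Sum>k\<in>UNIV. D (axis k 1) * smoothed n k l)"
    using has_derivative_linear[OF D]
    by (subst vec_eq_sum_axis[of v]) (simp add: linear_sum linear_cmul v_def mult.commute)
  also have "\<dots> \<le> (\<Sum>k\<in>UNIV. cutoff n l * E k (axis k 1) + D (axis k 1) * smoothed n k l)"
    by (intro sum_mono) (simp add: cutoff_bounds smoothed_own_deriv[OF l E])
  finally show ?thesis by (simp add: T)
qed

end

lemma truncated_tendsto: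
  assumes l: "l \<in> decreasing_positive"
  shows "(\<lambda>n. truncated (real (Suc n)) k l) \<longlonglongrightarrow> \<gamma> k l"
proof -
  have "(\<lambda>n. smoothed (real (Suc n)) k l) \<longlonglongrightarrow> \<gamma> k l"
  proof (rule LIMSEQ_I)
    fix e :: real assume e: "0 < e"
    have "isCont (\<gamma> k) l"
      using continuous_on_\<gamma>[of k] l continuous_on_eq_continuous_at[OF open_decreasing_positive] by blast
    then obtain d where d: "0 < d" "\<And>y. dist y l < d \<Longrightarrow> dist (\<gamma> k y) (\<gamma> k l) < e / 2"
      unfolding continuous_at_eps_delta using e by (metis half_gt_zero)
    define M where "M = norm (base :: 'p::{finite,linorder} rvec) + 1"
    have M: "0 < M" by (simp add: M_def add_nonneg_pos)
    obtain N :: nat where N: "M / d < real N" using reals_Archimedean2 by blast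
    show "\<exists>N. \<forall>n\<ge>N. norm (smoothed (real (Suc n)) k l - \<gamma> k l) < e"
    proof (intro exI[of _ N] allI impI)
      fix n assume "N \<le> n"
      then have n: "M / d < real (Suc n)" "0 < real (Suc n)" using N by auto
      have close: "\<bar>\<gamma> k (l + (base + u) /\<^sub>R real (Suc n)) - \<gamma> k l\<bar> < e / 2" if u: "norm u \<le> 1" for u
      proof -
        have "norm (base + u) \<le> M" using norm_triangle_ineq[of base u] u by (simp add: M_def)
        then have "norm ((base + u) /\<^sub>R real (Suc n)) \<le> M / real (Suc n)"
          by (simp add: divide_inverse mult.commute mult_right_mono)
        also have "\<dots> < d" using n d(1) by (simp add: field_simps)
        finally have "norm ((base + u) /\<^sub>R real (Suc n)) < d" .
        then show ?thesis using d(2)[of "l + (base + u) /\<^sub>R real (Suc n)"] by (simp add: dist_norm)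
      qed
      have bnd: "\<gamma> k (l + (base + u) /\<^sub>R real (Suc n)) \<le> \<gamma> k l + e / 2"
        "\<gamma> k l - e / 2 \<le> \<gamma> k (l + (base + u) /\<^sub>R real (Suc n))" if "norm u \<le> 1" for u
        using close[OF that] by linarith+
      have "smoothed (real (Suc n)) k l \<le> \<gamma> k l + e / 2"
        by (rule smoothed_le[OF n(2) l bnd(1)])
      moreover have "\<gamma> k l - e / 2 \<le> smoothed (real (Suc n)) k l"
        by (rule smoothed_ge[OF n(2) l bnd(2)])
      ultimately show "norm (smoothed (real (Suc n)) k l - \<gamma> k l) < e" using e by simp
    qed
  qed
  then have "(\<lambda>n. cutoff (real (Suc n)) l * smoothed (real (Suc n)) k l) \<longlonglongrightarrow> 1 * \<gamma> k l"
    by (intro tendsto_mult cutoff_tendsto_1 l)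
  then show ?thesis by (simp add: truncated_def)
qed

end

section \<open>Almost every matrix has distinct positive singular values\<close>

text \<open>The columns are $v, Sv, \ldots, S^{p-1}v$ for the vector $v$ all of whose entries are 1. If this matrix
is invertible then $v$ is cyclic, which excludes multiple eigenvalues; and its determinant is a
polynomial in the entries of $S$, unlike the eigenvalues.\<close>

definition krylov :: "('p::{finite,linorder},'p) cmat \<Rightarrow> ('p,'p) cmat" where
  "krylov S = (\<chi> i j. (((*v) S ^^ rank_of j) 1) $ i)"

lemma det_eq_0_if_kernel:
  fixes A :: "complex^'n^'n"
  assumes "A *v x = 0" "x \<noteq> 0"
  shows "det A = 0"
  using assms by (metis invertible_det_nz invertible_left_inverse matrix_left_invertible_ker)

text \<open>A two-dimensional eigenspace contains a nonzero vector $x$ orthogonal to $v$. Then $x$ is orthogonal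
to every $S^nv$, so its conjugate is in the kernel of the transposed Krylov matrix.\<close>

lemma krylov_det_eq_0_if_double_eigenvalue:
  fixes S :: "('p::{finite,linorder},'p) cmat" and d :: real
  assumes S: "conj_transpose S = S"
    and a: "S *v a = d *\<^sub>R a" and b: "S *v b = d *\<^sub>R b"
    and ab: "cdot a a = 1" "cdot b b = 1" "cdot a b = 0" "cdot b a = 0"
  shows "det (krylov S) = 0"
proof -
  \<comment> \<open>The vector $x = \alpha a + \beta b$ below is orthogonal to $v$; the case distinction only ensures that it is nonzero.\<close>
  define s t where "s = cdot b (1 :: (complex,'p) vec)" and "t = - cdot a (1 :: (complex,'p) vec)"
  define \<alpha> \<beta> where "\<alpha> = (if s = 0 \<and> t = 0 then 1 else cnj s)" and "\<beta> = (if s = 0 \<and> t = 0 then 0 else cnj t)"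
  define x where "x = \<alpha> *s a + \<beta> *s b"
  have cx: "cdot x y = cnj \<alpha> * cdot a y + cnj \<beta> * cdot b y" for y
    by (simp add: x_def cdot_def distrib_right sum.distrib sum_distrib_left mult.assoc)
  have "cdot x a = cnj \<alpha>" "cdot x b = cnj \<beta>" by (simp_all add: cx ab)
  moreover have "\<alpha> \<noteq> 0 \<or> \<beta> \<noteq> 0" by (auto simp: \<alpha>_def \<beta>_def)
  ultimately have x0: "x \<noteq> 0" by (auto simp: cdot_def)
  have Sx: "S *v x = d *\<^sub>R x"
    using a b by (simp add: x_def matrix_vector_right_distrib vector_scalar_commute scaleR_add_right vec_eq_iff)
  have "cdot x (((*v) S ^^ n) 1) = 0" for n
  proof (induction n)
    case 0
    have "cnj \<alpha> * cdot a 1 + cnj \<beta> * cdot b 1 = 0" by (auto simp: \<alpha>_def \<beta>_def s_def t_def)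
    then show ?case by (simp add: cx)
  next
    case (Suc n)
    have "cdot x (S *v ((*v) S ^^ n) 1) = cdot (S *v x) (((*v) S ^^ n) 1)"
      by (simp only: cdot_matrix_vector S)
    also have "\<dots> = 0" by (simp add: Sx cdot_scaleR Suc)
    finally show ?case by simp
  qed
  then have "transpose (krylov S) *v (\<chi> i. cnj (x $ i)) = 0"
    by (simp add: vec_eq_iff matrix_vector_mult_def transpose_def krylov_def cdot_def mult.commute)
  moreover have "(\<chi> i. cnj (x $ i)) \<noteq> 0" using x0 by (auto simp: vec_eq_iff)
  ultimately have "det (transpose (krylov S)) = 0" by (rule det_eq_0_if_kernel)
  then show ?thesis by (simp add: det_transpose)
qed

lemma regular_if_krylov:
  fixes z :: "('p::{finite,linorder},'m::finite) cmat"
  assumes k: "det (krylov (gram z)) \<noteq> 0" and g: "det (gram z) \<noteq> 0"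
  shows "z \<in> regular"
proof -
  obtain U l where U: "unitary U" and l: "\<And>i j. i < j \<Longrightarrow> l $ j \<le> l $ i"
    and S: "gram z = U ** real_diag l ** conj_transpose U"
    using hermitian_spectral_decomposition[OF hermitian_gram, of z] by blast
  define u where "u k = (\<chi> i. U $ i $ k)" for k
  have "gram z ** U = U ** real_diag l"
    using U unfolding S unitary_def by (metis matrix_mul_assoc matrix_mul_rid)
  then have ev: "gram z *v u k = l $ k *\<^sub>R u k" for k
  proof -
    have "(gram z *v u k) $ i = (l $ k *\<^sub>R u k) $ i" for i
    proof -
      have "(gram z *v u k) $ i = (gram z ** U) $ i $ k"
        by (simp add: u_def matrix_vector_mult_def matrix_mult_nth)
      also have "\<dots> = (l $ k *\<^sub>R u k) $ i"
        unfolding \<open>gram z ** U = U ** real_diag l\<close> mult_real_diag_nth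
        by (simp add: u_def) (simp add: scaleR_conv_of_real mult.commute)
      finally show ?thesis .
    qed
    then show ?thesis by (simp add: vec_eq_iff)
  qed
  have orth: "cdot (u i) (u j) = (if i = j then 1 else 0)" for i j
  proof -
    have "(conj_transpose U ** U) $ i $ j = (if i = j then 1 else 0)"
      using U by (simp add: unitary_def mat_def)
    then show ?thesis by (simp add: cdot_def u_def matrix_mult_nth conj_transpose_nth)
  qed
  have "l $ j < l $ i" if "i < j" for i j
  proof (rule ccontr)
    assume "\<not> l $ j < l $ i"
    then have "l $ j = l $ i" using l[OF that] by simp
    then have "gram z *v u j = l $ i *\<^sub>R u j" using ev[of j] by simp
    then have "det (krylov (gram z)) = 0"
      by (rule krylov_det_eq_0_if_double_eigenvalue[OF hermitian_gram ev[of i]]) (use orth that in auto)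
    then show False using k by simp
  qed
  moreover have "0 < l $ i" for i
  proof -
    have "of_real (l $ i) = cdot (u i) (gram z *v u i)" by (simp add: ev cdot_scaleR orth) (simp add: scaleR_conv_of_real)
    also have "\<dots> = cdot (z *v u i) (z *v u i)"
      by (simp add: gram_def cdot_matrix_vector flip: matrix_vector_mul_assoc)
    also have "\<dots> = of_real ((norm (z *v u i))\<^sup>2)" by (rule cdot_self)
    finally have "l $ i = (norm (z *v u i))\<^sup>2" by (simp only: of_real_eq_iff)
    then have "0 \<le> l $ i" by simp
    moreover have "l $ i \<noteq> 0"
    proof
      assume "l $ i = 0"
      then have "gram z *v u i = 0" using ev[of i] by simp
      moreover have "u i \<noteq> 0" using orth[of i i] by (auto simp: cdot_def)
      ultimately show False using g det_eq_0_if_kernel by blast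
    qed
    ultimately show ?thesis by simp
  qed
  ultimately have "is_spectral_decomp z U l"
    using U S by (simp add: is_spectral_decomp_def decreasing_positive_def gram_def)
  then show ?thesis using regular_iff by blast
qed

lemma matrix_vector_mult_nth: "(A *v x) $ i = (\<Sum>j\<in>UNIV. A $ i $ j * x $ j)"
  by (simp add: matrix_vector_mult_def)

text \<open>The second factor excludes the eigenvalue zero.\<close>

definition generic_poly :: "('p::{finite,linorder},'m::finite) cmat \<Rightarrow> complex" where
  "generic_poly z = det (krylov (gram z)) * det (gram z)"

lemma real_diag_funpow: "((*v) (real_diag d) ^^ n) 1 $ i = of_real (d $ i) ^ n"
proof (induction n arbitrary: i)
  case (Suc n)
  have "(real_diag d *v x) $ i = of_real (d $ i) * x $ i" for x
  proof -
    have "(real_diag d *v x) $ i = (\<Sum>j\<in>UNIV. if j = i then of_real (d $ i) * x $ i else 0)"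
      unfolding matrix_vector_mult_def real_diag_def vec_lambda_beta by (intro sum.cong) auto
    then show ?thesis by simp
  qed
  then show ?case by (simp add: Suc)
qed simp

text \<open>A Vandermonde determinant: a vector in the kernel gives the coefficients of a polynomial of degree
less than $p$ with $p$ distinct roots.\<close>

lemma det_krylov_real_diag:
  fixes d :: "'p::{finite,linorder} rvec"
  assumes inj: "\<And>i j. d $ i = d $ j \<Longrightarrow> i = j"
  shows "det (krylov (real_diag d)) \<noteq> 0"
proof
  assume "det (krylov (real_diag d)) = 0"
  then have "\<not> inj ((*v) (krylov (real_diag d)))"
    by (metis invertible_det_nz invertible_left_inverse matrix_left_invertible_injective)
  then obtain c where c: "c \<noteq> 0" "krylov (real_diag d) *v c = 0"
    by (metis (no_types, lifting) injI matrix_vector_mult_diff_distrib right_minus_eq)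
  define q where "q = (\<Sum>j\<in>UNIV. monom (c $ j) (rank_of j))"
  have root: "poly q (of_real (d $ i)) = 0" for i
  proof -
    have "(krylov (real_diag d) *v c) $ i = 0" using c by simp
    then show ?thesis
      by (simp add: matrix_vector_mult_def krylov_def real_diag_funpow q_def poly_sum poly_monom mult.commute)
  qed
  have coeff: "coeff q (rank_of j) = c $ j" for j
    by (simp add: q_def coeff_sum inj_eq[OF inj_rank_of] if_distrib cong: if_cong)
  obtain j where "c $ j \<noteq> 0" using c(1) by (auto simp: vec_eq_iff)
  then have q0: "q \<noteq> 0" using coeff[of j] by auto
  have "degree q < CARD('p)"
  proof -
    have "degree q \<le> CARD('p) - 1"
      unfolding q_def
    proof (rule degree_sum_le)
      fix j :: 'p
      show "degree (monom (c $ j) (rank_of j)) \<le> CARD('p) - 1"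
        using rank_of_less_CARD[of j] degree_monom_le[of "c $ j" "rank_of j"] by linarith
    qed simp
    then show ?thesis using zero_less_card_finite[where 'a='p] by linarith
  qed
  moreover have "CARD('p) \<le> card {x. poly q x = 0}"
  proof -
    have "inj (\<lambda>i::'p. complex_of_real (d $ i))" using inj by (auto simp: inj_def)
    then have "CARD('p) = card (range (\<lambda>i::'p. complex_of_real (d $ i)))" by (simp add: card_image)
    also have "\<dots> \<le> card {x. poly q x = 0}"
      using root by (intro card_mono poly_roots_finite q0) auto
    finally show ?thesis .
  qed
  ultimately show False using card_poly_roots_bound[OF q0] by linarith
qed

text \<open>The columns of the witness are orthogonal with squared lengths $1, \ldots, p$, for which at least
$p$ rows are necessary.\<close>

lemma ex_generic_poly_nonzero:
  assumes "CARD('p::{finite,linorder}) \<le> CARD('m)"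
  shows "\<exists>z :: ('p,'m::finite) cmat. generic_poly z \<noteq> 0"
proof -
  obtain \<iota> :: "'p \<Rightarrow> 'm" where \<iota>: "inj \<iota>"
    using assms by (metis card_le_inj finite finite_class.finite_UNIV inj_on_subset subset_UNIV)
  define d :: "'p rvec" where "d = (\<chi> j. real (rank_of j) + 1)"
  define z :: "('p,'m) cmat" where "z = (\<chi> i j. if i = \<iota> j then of_real (sqrt (d $ j)) else 0)"
  have "gram z $ i $ j = real_diag d $ i $ j" for i j
  proof -
    have "gram z $ i $ j = (\<Sum>k\<in>UNIV. if k = \<iota> i then (if i = j then of_real (d $ i) else 0) else 0)"
      unfolding gram_def matrix_mult_nth
    proof (intro sum.cong refl)
      fix k
      have "complex_of_real (sqrt (d $ i)) * complex_of_real (sqrt (d $ i)) = of_real (d $ i)"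
        by (simp add: d_def flip: of_real_mult)
      then show "conj_transpose z $ i $ k * z $ k $ j = (if k = \<iota> i then (if i = j then of_real (d $ i) else 0) else 0)"
        using \<iota> by (auto simp: conj_transpose_nth z_def inj_eq)
    qed
    then show ?thesis by (simp add: real_diag_def)
  qed
  then have g: "gram z = real_diag d" by (simp add: vec_eq_iff)
  have "det (real_diag d) = (\<Prod>i\<in>UNIV. of_real (d $ i))"
    by (subst det_diagonal) (auto simp: real_diag_def)
  then have "det (gram z) \<noteq> 0" unfolding g by (auto simp: d_def) (metis of_nat_eq_0_iff of_nat_Suc nat.distinct(1) of_real_of_nat_eq of_real_1 of_real_add add.commute)
  moreover have "det (krylov (gram z)) \<noteq> 0"
    unfolding g by (rule det_krylov_real_diag) (simp add: d_def inj_eq[OF inj_rank_of])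
  ultimately show ?thesis unfolding generic_poly_def by (intro exI[of _ z]) simp
qed

text \<open>Conjugation makes \<open>generic_poly\<close> a polynomial only in the real and imaginary parts of the entries;
its restrictions to real lines suffice.\<close>

definition real_polyfun :: "(real \<Rightarrow> complex) \<Rightarrow> bool" where
  "real_polyfun f \<longleftrightarrow> (\<exists>p. \<forall>t. f t = poly p (of_real t))"

lemma real_polyfun_const: "real_polyfun (\<lambda>_. c)"
  unfolding real_polyfun_def by (intro exI[of _ "[:c:]"]) simp

lemma real_polyfun_linear: "real_polyfun (\<lambda>t. a + t *\<^sub>R b)"
  unfolding real_polyfun_def by (intro exI[of _ "[:a, b:]"]) (simp add: scaleR_conv_of_real)

lemma real_polyfun_add: "real_polyfun f \<Longrightarrow> real_polyfun g \<Longrightarrow> real_polyfun (\<lambda>t. f t + g t)"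
  unfolding real_polyfun_def by (metis poly_add)

lemma real_polyfun_mult: "real_polyfun f \<Longrightarrow> real_polyfun g \<Longrightarrow> real_polyfun (\<lambda>t. f t * g t)"
  unfolding real_polyfun_def by (metis poly_mult)

lemma real_polyfun_sum: "(\<And>i. i \<in> I \<Longrightarrow> real_polyfun (f i)) \<Longrightarrow> real_polyfun (\<lambda>t. \<Sum>i\<in>I. f i t)"
  by (induction I rule: infinite_finite_induct) (auto intro: real_polyfun_const real_polyfun_add)

lemma real_polyfun_prod: "(\<And>i. i \<in> I \<Longrightarrow> real_polyfun (f i)) \<Longrightarrow> real_polyfun (\<lambda>t. \<Prod>i\<in>I. f i t)"
  by (induction I rule: infinite_finite_induct) (auto intro: real_polyfun_const real_polyfun_mult)

lemma real_polyfun_det: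
  assumes "\<And>i j. real_polyfun (\<lambda>t. A t $ i $ j)"
  shows "real_polyfun (\<lambda>t. det (A t))"
  unfolding det_def by (intro real_polyfun_sum real_polyfun_mult real_polyfun_const real_polyfun_prod assms)

lemma real_polyfun_generic_poly:
  fixes a b :: "('p::{finite,linorder},'m::finite) cmat"
  shows "real_polyfun (\<lambda>t. generic_poly (a + t *\<^sub>R b))"
proof -
  have z: "real_polyfun (\<lambda>t. (a + t *\<^sub>R b) $ i $ j)" for i j
    by (simp add: real_polyfun_linear)
  have cz: "real_polyfun (\<lambda>t. cnj ((a + t *\<^sub>R b) $ i $ j))" for i j
    using real_polyfun_linear[of "cnj (a $ i $ j)" "cnj (b $ i $ j)"] by simp
  have g: "real_polyfun (\<lambda>t. gram (a + t *\<^sub>R b) $ i $ j)" for i j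
    unfolding gram_def matrix_mult_nth conj_transpose_nth
    by (intro real_polyfun_sum real_polyfun_mult z cz)
  have "real_polyfun (\<lambda>t. ((*v) (gram (a + t *\<^sub>R b)) ^^ n) 1 $ i)" for n i
  proof (induction n arbitrary: i)
    case 0 then show ?case by (simp add: real_polyfun_const)
  next
    case (Suc n)
    have "real_polyfun (\<lambda>t. \<Sum>j\<in>UNIV. gram (a + t *\<^sub>R b) $ i $ j * ((*v) (gram (a + t *\<^sub>R b)) ^^ n) 1 $ j)"
      by (intro real_polyfun_sum real_polyfun_mult g Suc)
    then show ?case by (simp add: matrix_vector_mult_nth)
  qed
  then show ?thesis
    unfolding generic_poly_def
    by (intro real_polyfun_mult real_polyfun_det g) (simp add: krylov_def)
qed

lemma continuous_on_generic_poly: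
  "continuous_on UNIV (generic_poly :: ('p::{finite,linorder},'m::finite) cmat \<Rightarrow> complex)"
proof -
  have g: "continuous_on UNIV (\<lambda>z :: ('p,'m) cmat. gram z $ i $ j)" for i j
    unfolding gram_def matrix_mult_nth conj_transpose_nth by (intro continuous_intros)
  have p: "continuous_on UNIV (\<lambda>z :: ('p,'m) cmat. ((*v) (gram z) ^^ n) 1 $ i)" for n i
  proof (induction n arbitrary: i)
    case (Suc n)
    have "continuous_on UNIV (\<lambda>z :: ('p,'m) cmat. \<Sum>j\<in>UNIV. gram z $ i $ j * ((*v) (gram z) ^^ n) 1 $ j)"
      by (intro continuous_intros g Suc)
    then show ?case by (simp add: matrix_vector_mult_nth)
  qed simp
  show ?thesis
    unfolding generic_poly_def[abs_def] det_def krylov_def vec_lambda_beta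
    by (intro continuous_intros g p)
qed

text \<open>By Tonelli, for almost every $t$ the set of $w$ with $a + tw \in B$ is a null set. For a single such
$t \ne 0$, the set $B$ is its image under an affine bijection.\<close>

lemma null_set_if_finite_on_lines:
  fixes B :: "'a::euclidean_space set"
  assumes B: "closed B" and fin: "\<And>w. finite {t. a + t *\<^sub>R w \<in> B}"
  shows "B \<in> null_sets lborel"
proof -
  have [measurable]: "B \<in> sets borel" using B by simp
  have "(\<integral>\<^sup>+t. (\<integral>\<^sup>+w. indicator B (a + t *\<^sub>R w) \<partial>lborel) \<partial>(lborel :: real measure))
      = (\<integral>\<^sup>+w. (\<integral>\<^sup>+t. indicator B (a + t *\<^sub>R w) \<partial>(lborel :: real measure)) \<partial>lborel)"
    by (rule lborel_pair.Fubini') measurable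
  also have "\<dots> = (\<integral>\<^sup>+w. 0 \<partial>(lborel :: 'a measure))"
  proof (intro nn_integral_cong)
    fix w
    have "(\<integral>\<^sup>+t. indicator B (a + t *\<^sub>R w) \<partial>(lborel :: real measure)) = (\<integral>\<^sup>+t. indicator {t. a + t *\<^sub>R w \<in> B} t \<partial>lborel)"
      by (intro nn_integral_cong) (simp add: indicator_def)
    also have "\<dots> = emeasure lborel {t. a + t *\<^sub>R w \<in> B}"
      using fin[of w] by (intro nn_integral_indicator) (simp add: finite_imp_closed)
    also have "\<dots> = 0" using fin[of w] by (intro emeasure_lborel_countable countable_finite)
    finally show "(\<integral>\<^sup>+t. indicator B (a + t *\<^sub>R w) \<partial>(lborel :: real measure)) = 0" .
  qed
  finally have "(\<integral>\<^sup>+t. (\<integral>\<^sup>+w. indicator B (a + t *\<^sub>R w) \<partial>lborel) \<partial>(lborel :: real measure)) = 0" by simp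
  then have "AE t in (lborel :: real measure). (\<integral>\<^sup>+w. indicator B (a + t *\<^sub>R w) \<partial>lborel) = 0"
    by (subst (asm) nn_integral_0_iff_AE) measurable
  moreover have "AE t in lborel. t \<noteq> (0::real)" by (rule AE_lborel_singleton)
  ultimately have "AE t in lborel. (\<integral>\<^sup>+w. indicator B (a + t *\<^sub>R w) \<partial>lborel) = 0 \<and> t \<noteq> (0::real)"
    by (rule AE_conjI)
  then have "\<exists>t::real. (\<integral>\<^sup>+w. indicator B (a + t *\<^sub>R w) \<partial>lborel) = 0 \<and> t \<noteq> 0"
    by (intro eventually_happens'[of "ae_filter lborel"]) (simp_all add: ae_filter_eq_bot_iff)
  then obtain t :: real where t: "(\<integral>\<^sup>+w. indicator B (a + t *\<^sub>R w) \<partial>lborel) = 0" "t \<noteq> 0" by blast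
  have "emeasure lborel B = (\<integral>\<^sup>+x. indicator B x \<partial>lborel)" by simp
  also have "\<dots> = (\<integral>\<^sup>+x. indicator B x \<partial>density (distr lborel borel (\<lambda>x. a + t *\<^sub>R x)) (\<lambda>_. ennreal (\<bar>t\<bar>^DIM('a))))"
    using lborel_affine[OF t(2), of a] by (simp add: ennreal_power)
  also have "\<dots> = (\<integral>\<^sup>+w. ennreal (\<bar>t\<bar>^DIM('a)) * indicator B (a + t *\<^sub>R w) \<partial>lborel)"
    by (subst nn_integral_density, simp, simp, subst nn_integral_distr) auto
  also have "\<dots> = 0" using t(1) by (simp add: nn_integral_cmult)
  finally show ?thesis by (simp add: null_sets_def)
qed

lemma AE_regular:
  assumes "CARD('p::{finite,linorder}) \<le> CARD('m)"
  shows "AE z in lborel. z \<in> (regular :: (('p,'m::finite) cmat) set)"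
proof -
  obtain a :: "('p,'m) cmat" where a: "generic_poly a \<noteq> 0"
    using ex_generic_poly_nonzero[OF assms] by blast
  define B where "B = {z :: ('p,'m) cmat. generic_poly z = 0}"
  have "closed B" unfolding B_def by (intro closed_Collect_eq continuous_on_generic_poly continuous_on_const)
  moreover have "finite {t. a + t *\<^sub>R w \<in> B}" for w
  proof -
    obtain q where q: "\<And>t. generic_poly (a + t *\<^sub>R w) = poly q (of_real t)"
      using real_polyfun_generic_poly[of a w] by (auto simp: real_polyfun_def)
    have "q \<noteq> 0" using q[of 0] a by auto
    then have "finite {x. poly q x = 0}" by (rule poly_roots_finite)
    then have "finite (of_real -` {x. poly q x = 0} :: real set)"
      by (rule finite_vimageI) (simp add: inj_of_real)
    moreover have "{t. a + t *\<^sub>R w \<in> B} = of_real -` {x. poly q x = 0}" by (auto simp: B_def q)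
    ultimately show ?thesis by simp
  qed
  ultimately have "B \<in> null_sets lborel" by (rule null_set_if_finite_on_lines)
  then have "AE z in lborel. z \<notin> B" by (rule AE_not_in)
  then show ?thesis
    by eventually_elim (auto simp: B_def generic_poly_def intro: regular_if_krylov)
qed

section \<open>Minimaxity\<close>

lemma continuous_on_spectral_field:
  assumes "\<And>k. continuous_on decreasing_positive (h k)"
  shows "continuous_on regular (spectral_field h :: ('p::{finite,linorder},'m::finite) cmat \<Rightarrow> ('p,'m) cmat)"
proof -
  have "continuous_on regular (\<lambda>z :: ('p,'m) cmat. h k (eigenvalues z))" for k
    by (rule continuous_on_compose2[OF assms continuous_on_eigenvalues]) (auto simp: regular_def)
  then show ?thesis
    unfolding spectral_field_def[abs_def]
    by (intro continuous_intros matrix_mult.continuous_on continuous_on_projections)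
qed

lemma borel_measurable_shrinkage_field:
  assumes "\<And>k. continuous_on decreasing_positive (g k)"
  shows "(shrinkage_field g :: ('p::{finite,linorder},'m::finite) cmat \<Rightarrow> ('p,'m) cmat) \<in> borel_measurable borel"
proof -
  have "continuous_on decreasing_positive (\<lambda>l. g k l / l $ k)" for k
    by (intro continuous_on_divide assms continuous_intros) (auto simp: decreasing_positive_def less_imp_neq[symmetric])
  then have "(\<lambda>z. indicator regular z *\<^sub>R spectral_field (\<lambda>k l. g k l / l $ k) (z :: ('p,'m) cmat)) \<in> borel_measurable borel"
    by (intro borel_measurable_continuous_on_indicator continuous_on_spectral_field borel_open open_regular)
  moreover have "shrinkage_field g = (\<lambda>z. indicator regular z *\<^sub>R spectral_field (\<lambda>k l. g k l / l $ k) (z :: ('p,'m) cmat))"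
    by (simp add: shrinkage_field_def fun_eq_iff)
  ultimately show ?thesis by simp
qed

lemma risk_eq:
  fixes \<delta> :: "complex^'p^'m \<Rightarrow> complex^'p^'m"
  assumes \<delta>: "\<delta> \<in> estimators"
  shows "risk \<delta> \<Xi> = ennreal (1 / pi ^ (CARD('m) * CARD('p))) * gaussian_risk \<delta> \<Xi>"
proof -
  let ?c = "1 / pi ^ (CARD('m) * CARD('p))"
  have [measurable]: "\<delta> \<in> borel_measurable lebesgue" using \<delta> by (simp add: estimators_def)
  have [measurable]: "(\<lambda>z::complex^'p^'m. exp (- (norm (z - \<Xi>))\<^sup>2)) \<in> borel_measurable lebesgue"
    by (intro measurable_completion) measurable
  have "risk \<delta> \<Xi> = (\<integral>\<^sup>+z. ennreal (exp (- (norm (z - \<Xi>))\<^sup>2) * ?c) * ennreal ((norm (\<delta> z - \<Xi>))\<^sup>2) \<partial>lebesgue)"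
    unfolding risk_def complex_normal_def norm_power2_eq_trace[symmetric] norm_power2_eq_trace'[symmetric]
    by (subst nn_integral_density) (auto simp: divide_inverse)
  also have "\<dots> = (\<integral>\<^sup>+z. ennreal ?c * ennreal ((norm (\<delta> z - \<Xi>))\<^sup>2 * exp (- (norm (z - \<Xi>))\<^sup>2)) \<partial>lebesgue)"
    by (intro nn_integral_cong) (simp add: mult.commute mult.left_commute flip: ennreal_mult)
  also have "\<dots> = ennreal ?c * (\<integral>\<^sup>+z. ennreal ((norm (\<delta> z - \<Xi>))\<^sup>2 * exp (- (norm (z - \<Xi>))\<^sup>2)) \<partial>lebesgue)"
    by (rule nn_integral_cmult) measurable
  also have "\<dots> = ennreal ?c * gaussian_risk \<delta> \<Xi>"
    by (simp only: nn_integral_completion gaussian_risk_def)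
  finally show ?thesis .
qed

text \<open>Tonelli's theorem is applied in the product of Borel spaces, so estimators that are only Lebesgue
measurable are first changed on a null set.\<close>

lemma lebesgue_measurable_eq_borel_AE:
  fixes f :: "'a::euclidean_space \<Rightarrow> 'b::euclidean_space"
  assumes "f \<in> borel_measurable lebesgue"
  obtains g where "g \<in> borel_measurable borel" "AE x in lborel. f x = g x"
proof -
  have "\<exists>g. g \<in> borel_measurable lborel \<and> (AE x in lborel. f x \<bullet> b = g x)" for b
    using completion_ex_borel_measurable_real[of "\<lambda>x. f x \<bullet> b" lborel] assms
    by (auto intro: borel_measurable_inner)
  then obtain g where g: "\<And>b. g b \<in> borel_measurable lborel" "\<And>b. AE x in lborel. f x \<bullet> b = g b x"
    by metis
  have "AE x in lborel. \<forall>b\<in>Basis. f x \<bullet> b = g b x"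
    using g(2) by (intro AE_finite_allI) auto
  then have "AE x in lborel. f x = (\<Sum>b\<in>Basis. g b x *\<^sub>R b)"
  proof eventually_elim
    case (elim x)
    then show ?case by (subst euclidean_representation[of "f x", symmetric]) simp
  qed
  moreover have "(\<lambda>x. \<Sum>b\<in>Basis. g b x *\<^sub>R b) \<in> borel_measurable borel"
    using g(1) by (intro borel_measurable_sum borel_measurable_scaleR) auto
  ultimately show thesis using that by blast
qed

lemma DIM_complex_matrix:
  "real DIM(complex^'p^'m) / 2 = real (CARD('m) * CARD('p))"
  "sqrt pi ^ DIM(complex^'p^'m) = pi ^ (CARD('m) * CARD('p))"
  by (simp_all add: power_mult mult.assoc[symmetric] mult.commute[of _ 2])

text \<open>Let the variance of the prior in \<open>gaussian_prior_bound\<close> tend to infinity.\<close>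

lemma sup_risk_lower_bound:
  fixes \<delta> :: "complex^'p^'m \<Rightarrow> complex^'p^'m"
  assumes \<delta>: "\<delta> \<in> estimators" and B: "\<And>\<Xi>. risk \<delta> \<Xi> \<le> B"
  shows "ennreal (real (CARD('m) * CARD('p))) \<le> B"
proof -
  let ?N = "real (CARD('m) * CARD('p))" and ?c = "pi ^ (CARD('m) * CARD('p))"
  obtain \<delta>' where \<delta>': "\<delta>' \<in> borel_measurable borel" "AE z in lborel. \<delta> z = \<delta>' z"
    using lebesgue_measurable_eq_borel_AE[of \<delta>] \<delta> by (auto simp: estimators_def)
  have "gaussian_risk \<delta>' \<Xi> \<le> ennreal ?c * B" for \<Xi>
  proof -
    have eq: "gaussian_risk \<delta>' \<Xi> = gaussian_risk \<delta> \<Xi>" (is "_ = ?I")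
      unfolding gaussian_risk_def
      using \<delta>'(2) by (intro nn_integral_cong_AE) (auto elim: eventually_mono)
    have "ennreal (1 / ?c) * ?I \<le> B" using B[of \<Xi>] by (simp only: risk_eq[OF \<delta>])
    then have "ennreal ?c * (ennreal (1 / ?c) * ?I) \<le> ennreal ?c * B" by (rule mult_left_mono) simp
    moreover have "ennreal ?c * (ennreal (1 / ?c) * ?I) = ?I"
      by (simp add: mult.assoc[symmetric] flip: ennreal_mult)
    ultimately show ?thesis by (simp only: eq)
  qed
  from gaussian_prior_bound[OF \<delta>'(1) _ this]
  have "ennreal (?N * (t / (1 + t)) * ?c) \<le> ennreal ?c * B" if "0 < t" for t
    using that by (simp only: DIM_complex_matrix)
  moreover have "ennreal (?N * (t / (1 + t)) * ?c) = ennreal ?c * ennreal (?N * (t / (1 + t)))" if "0 < t" for t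
    using that by (subst ennreal_mult[symmetric]) (auto simp: mult.commute)
  ultimately have "ennreal ?c * ennreal (?N * (t / (1 + t))) \<le> ennreal ?c * B" if "0 < t" for t
    using that by metis
  then have le: "ennreal (?N * (t / (1 + t))) \<le> B" if "0 < t" for t
    using that by (subst (asm) ennreal_mult_le_mult_iff) auto
  have "(\<lambda>n. real (Suc n) / (1 + real (Suc n))) \<longlonglongrightarrow> 1" by real_asymp
  then have "(\<lambda>n. ennreal (?N * (real (Suc n) / (1 + real (Suc n))))) \<longlonglongrightarrow> ennreal (?N * 1)"
    by (intro tendsto_ennrealI tendsto_mult tendsto_const)
  then have "ennreal (?N * 1) \<le> B"
    by (rule LIMSEQ_le_const2) (intro exI allI impI le, simp)
  then show ?thesis by simp
qed

text \<open>Fatou's lemma for the truncated functions, which converge pointwise to $\gamma_k$. The error in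
\<open>truncated_divergence\<close> is of order $1/n$.\<close>

lemma (in monotone_shrinkage) risk_integral_bound:
  fixes \<Xi> :: "('p::{finite,linorder},'m::finite) cmat"
  assumes b: "b = 2 * (real CARD('m) - real CARD('p))"
  shows "gaussian_risk (\<lambda>z. z - shrinkage_field \<gamma> z) \<Xi>
     \<le> ennreal (real (CARD('m) * CARD('p)) * pi ^ (CARD('m) * CARD('p)))"
proof -
  let ?N = "real (CARD('m) * CARD('p))" and ?c = "pi ^ (CARD('m) * CARD('p))"
  define g where "g n = truncated (real (Suc n))" for n
  define F where "F n z = ennreal ((norm (z - shrinkage_field (g n) z - \<Xi>))\<^sup>2 * exp (- (norm (z - \<Xi>))\<^sup>2))" for n z
  define e where "e n = 4 * real CARD('p) * b / real (Suc n)" for n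
  have Fbound: "(\<integral>\<^sup>+z. F n z \<partial>lborel) \<le> ennreal ((?N + 2 * e n) * ?c)" for n
  proof -
    have n: "0 < real (Suc n)" by simp
    obtain K where K: "compact K" "K \<subseteq> (decreasing_positive :: ('p rvec) set)"
      "\<And>l. l \<in> decreasing_positive \<Longrightarrow> l \<notin> K \<Longrightarrow> cutoff (real (Suc n)) l = 0"
      using cutoff_support[OF n] by blast
    show ?thesis
      unfolding F_def
    proof (rule shrinkage_field_risk[unfolded gaussian_risk_def, OF K(1,2), where g' = "\<lambda>k l. frechet_derivative (g n k) (at l)"])
      fix k and l :: "'p rvec"
      assume l: "l \<in> decreasing_positive"
      show "(g n k has_derivative frechet_derivative (g n k) (at l)) (at l)"
        unfolding g_def by (rule C1_on_frechet(1)[OF C1_truncated[OF n, of UNIV]]) simp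
      show "0 \<le> g n k l \<and> g n k l \<le> 2 * (real CARD('m) - real CARD('p))"
      proof -
        have "cutoff (real (Suc n)) l * smoothed (real (Suc n)) k l \<le> 1 * b"
          using cutoff_bounds smoothed_bounds[OF n l] b_nonneg by (intro mult_mono) auto
        then show ?thesis
          using mult_nonneg_nonneg[OF cutoff_bounds(1)[of "real (Suc n)" l] smoothed_bounds(1)[OF n l, of k]]
          by (simp add: g_def truncated_def b)
      qed
      show "l \<notin> K \<Longrightarrow> g n k l = 0" using K(3)[OF l] by (simp add: g_def truncated_def)
      show "g n j l \<le> g n i l" if "i < j" for i j
        using smoothed_ordered[OF n l that] cutoff_bounds[of "real (Suc n)" l]
        by (simp add: g_def truncated_def mult_left_mono)
      show "- e n \<le> (\<Sum>k\<in>UNIV. frechet_derivative (g n k) (at l) (axis k 1))"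
        using truncated_divergence[OF n l] by (simp add: g_def e_def)
    next
      fix k v
      show "continuous_on decreasing_positive (\<lambda>l. frechet_derivative (g n k) (at l) v)"
        unfolding g_def by (rule C1_on_frechet(2)[OF C1_truncated[OF n]])
      show "0 \<le> e n" using b_nonneg[OF zero_less_one] by (simp add: e_def)
    qed
  qed
  have "e \<longlonglongrightarrow> 0"
    unfolding e_def[abs_def] by real_asymp
  then have "(\<lambda>n. ennreal ((?N + 2 * e n) * ?c)) \<longlonglongrightarrow> ennreal ((?N + 2 * 0) * ?c)"
    by (intro tendsto_ennrealI tendsto_intros)
  then have lim: "liminf (\<lambda>n. ennreal ((?N + 2 * e n) * ?c)) = ennreal (?N * ?c)"
    by (intro lim_imp_Liminf) simp_all
  have pt: "(\<lambda>n. F n z) \<longlonglongrightarrow> ennreal ((norm (z - shrinkage_field \<gamma> z - \<Xi>))\<^sup>2 * exp (- (norm (z - \<Xi>))\<^sup>2))" for z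
  proof -
    have "(\<lambda>n. shrinkage_field (g n) z) \<longlonglongrightarrow> shrinkage_field \<gamma> z"
    proof (cases "z \<in> regular")
      case True
      then have l: "eigenvalues z \<in> decreasing_positive" by (simp add: regular_def)
      then have "eigenvalues z $ k \<noteq> 0" for k by (auto simp: decreasing_positive_def less_imp_neq[symmetric])
      then have "(\<lambda>n. spectral_field (\<lambda>k l. g n k l / l $ k) z) \<longlonglongrightarrow> spectral_field (\<lambda>k l. \<gamma> k l / l $ k) z"
        unfolding spectral_field_def g_def by (intro tendsto_intros truncated_tendsto l) auto
      then show ?thesis using True by (simp add: shrinkage_field_def)
    qed (simp add: shrinkage_field_def)
    then show ?thesis unfolding F_def by (intro tendsto_ennrealI tendsto_intros)
  qed
  have meas: "F n \<in> borel_measurable lborel" for n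
  proof -
    have [measurable]: "(shrinkage_field (g n) :: ('p,'m) cmat \<Rightarrow> _) \<in> borel_measurable borel"
      unfolding g_def by (intro borel_measurable_shrinkage_field C1_on_continuous C1_truncated) simp
    show ?thesis unfolding F_def[abs_def] by measurable
  qed
  have "gaussian_risk (\<lambda>z. z - shrinkage_field \<gamma> z) \<Xi>
     = (\<integral>\<^sup>+z. liminf (\<lambda>n. F n z) \<partial>lborel)"
    unfolding gaussian_risk_def by (intro nn_integral_cong lim_imp_Liminf[symmetric] pt) simp
  also have "\<dots> \<le> liminf (\<lambda>n. \<integral>\<^sup>+z. F n z \<partial>lborel)"
    by (rule nn_integral_liminf[OF meas])
  also have "\<dots> \<le> liminf (\<lambda>n. ennreal ((?N + 2 * e n) * ?c))"
    by (intro Liminf_mono always_eventually allI Fbound)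
  finally show ?thesis by (simp only: lim)
qed

lemma shrinkage_estimator_eq:
  assumes "is_spectral_decomp z V l"
  shows "z ** (mat 1 + V ** shrinkage_matrix \<gamma> l ** conj_transpose V) = z - shrinkage_field \<gamma> z"
proof -
  note d = is_spectral_decompD[OF assms]
  have "V ** shrinkage_matrix \<gamma> l ** conj_transpose V = - (\<Sum>k\<in>UNIV. (\<gamma> k l / l $ k) *\<^sub>R projections z $ k)"
    using unitary_real_diag[of V "\<chi> k. \<gamma> k l / l $ k"]
    by (simp add: shrinkage_matrix_def matrix_mult.minus_left matrix_mult.minus_right d)
  then show ?thesis
    by (simp add: shrinkage_field_def d spectral_field_def matrix_mult.diff_right matrix_mult.minus_right
        matrix_mult.sum_right matrix_mult.scaleR_right)
qed

theorem proposition1: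
  fixes \<gamma> :: "'p::{finite,linorder} \<Rightarrow> real^'p::{finite,linorder} \<Rightarrow> real"
    and U :: "complex^('p::{finite,linorder})^'m \<Rightarrow>
                complex^('p::{finite,linorder})^('p::{finite,linorder})"
    and L :: "complex^('p::{finite,linorder})^'m \<Rightarrow> real^('p::{finite,linorder})"
  assumes dims: "CARD('p) < CARD('m)"
    and spectral: "AE z in lebesgue. (\<exists>V l. is_spectral_decomp z V l) \<longrightarrow>
                        is_spectral_decomp z (U z) (L z)"
    and diff: "\<And>k. \<gamma> k differentiable_on decreasing_positive"
    and bounds: "\<And>k l. l \<in> decreasing_positive \<Longrightarrow>
                   0 \<le> \<gamma> k l \<and> \<gamma> k l \<le> 2 * (real CARD('m) - real CARD('p))"
    and monotone_in_own: "\<And>k l. l \<in> decreasing_positive \<Longrightarrow> 0 \<le> partial_deriv (\<gamma> k) k l"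
    and ordered: "\<And>i j l. l \<in> decreasing_positive \<Longrightarrow> i \<le> j \<Longrightarrow> \<gamma> j l \<le> \<gamma> i l"
  shows "minimax (\<lambda>z::complex^('p::{finite,linorder})^'m.
                   z ** (mat 1 + U z ** shrinkage_matrix \<gamma> (L z) ** conj_transpose (U z)))"
    (is "minimax ?\<delta>")
proof -
  let ?N = "real (CARD('m) * CARD('p))" and ?c = "pi ^ (CARD('m) * CARD('p))"
  interpret monotone_shrinkage \<gamma> "2 * (real CARD('m) - real CARD('p))"
    by unfold_locales (use diff bounds monotone_in_own ordered in auto)
  define \<delta>' where "\<delta>' z = z - shrinkage_field \<gamma> z" for z :: "complex^('p::{finite,linorder})^'m"
  have [measurable]: "\<delta>' \<in> borel_measurable borel"
    unfolding \<delta>'_def[abs_def]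
    by (intro borel_measurable_diff borel_measurable_shrinkage_field continuous_on_\<gamma>) auto
  have "AE z in lebesgue. z \<in> (regular :: (complex^('p::{finite,linorder})^'m) set)"
    using dims by (intro AE_completion AE_regular) simp
  with spectral have eq: "AE z in lebesgue. \<delta>' z = ?\<delta> z"
  proof eventually_elim
    case (elim z)
    then have "is_spectral_decomp z (U z) (L z)" using regular_iff by blast
    from shrinkage_estimator_eq[OF this] show ?case by (simp add: \<delta>'_def)
  qed
  have est: "?\<delta> \<in> estimators"
    unfolding estimators_def
    by (rule borel_measurable_AE[OF _ eq]) (intro measurable_completion, measurable)
  have risk: "risk ?\<delta> \<Xi> \<le> ennreal ?N" for \<Xi>
  proof -
    have "risk ?\<delta> \<Xi> = ennreal (1 / ?c) * gaussian_risk ?\<delta> \<Xi>"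
      by (rule risk_eq[OF est])
    also have "gaussian_risk ?\<delta> \<Xi> = gaussian_risk \<delta>' \<Xi>"
      using eq unfolding AE_completion_iff gaussian_risk_def by (intro nn_integral_cong_AE) (auto elim: eventually_mono)
    also have "ennreal (1 / ?c) * \<dots> \<le> ennreal (1 / ?c) * ennreal (?N * ?c)"
      unfolding \<delta>'_def[abs_def] by (intro mult_left_mono risk_integral_bound) auto
    also have "\<dots> = ennreal ?N" by (simp flip: ennreal_mult)
    finally show ?thesis .
  qed
  show ?thesis
    unfolding minimax_def
  proof (intro conjI est antisym)
    show "(SUP \<Xi>. risk ?\<delta> \<Xi>) \<le> (INF \<delta>'\<in>(estimators :: (complex^('p::{finite,linorder})^'m \<Rightarrow> complex^('p::{finite,linorder})^'m) set). SUP \<Xi>. risk \<delta>' \<Xi>)"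
    proof (rule INF_greatest)
      fix d :: "complex^('p::{finite,linorder})^'m \<Rightarrow> complex^('p::{finite,linorder})^'m"
      assume d: "d \<in> estimators"
      have "(SUP \<Xi>. risk ?\<delta> \<Xi>) \<le> ennreal ?N" by (intro SUP_least risk)
      also have "\<dots> \<le> (SUP \<Xi>. risk d \<Xi>)"
        by (rule sup_risk_lower_bound[OF d]) (rule SUP_upper, simp)
      finally show "(SUP \<Xi>. risk ?\<delta> \<Xi>) \<le> (SUP \<Xi>. risk d \<Xi>)" .
    qed
    show "(INF \<delta>'\<in>(estimators :: (complex^('p::{finite,linorder})^'m \<Rightarrow> complex^('p::{finite,linorder})^'m) set). SUP \<Xi>. risk \<delta>' \<Xi>) \<le> (SUP \<Xi>. risk ?\<delta> \<Xi>)"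
      by (rule INF_lower[OF est])
  qed
qed

end
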